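(* Let $p\ge0$ and, for $i=1,\dots,p$, let $J_{\lambda_i}(2n_{i1},\dots,2n_{is_i})$ be Jordan tuples with positive integers $n_{i1}\ge\dots\ge n_{is_i}$. There exists a finite-dimensional complex Lie algebra whose Jordan–Kronecker invariants consist exactly of these Jordan tuples and no Kronecker blocks if and only if each of these Jordan tuples has a unique maximum, i.e. $s_i=1$ or $n_{i1}>n_{i2}$ for every $i$.
   Context: For a finite-dimensional complex Lie algebra $\mathfrak g$ and $x\in\mathfrak g^*$, let $\mathcal A_x$ be the skew form $(\xi,\eta)\mapsto\langle x,[\xi,\eta]\rangle$ on $\mathfrak g$. By the Jordan–Kronecker theorem, a pair of skew forms on a finite-dimensional complex vector space admits a basis in which both are block-diagonal with blocks of types: Jordan $2n\times2n$ blocks with an eigenvalue $\mu\in\mathbb C\cup\{\infty\}$ ($A_i=\begin{pmatrix}0&J_\mu\\-J_\mu^T&0\end{pmatrix}$, $B_i=\begin{pmatrix}0&I_n\\-I_n&0\end{pmatrix}$, roles swapped for $\infty$), and Kronecker $(2k-1)\times(2k-1)$ blocks ($k\ge1$); block data grouped by eigenvalue are unique. The JK invariants of $\mathfrak g$ are, for $(x,a)$ in a nonempty Zariski open subset of $\mathfrak g^*\times\mathfrak g^*$ (where these data are constant), the Kronecker sizes $2k-1$ of the Kronecker blocks of $(\mathcal A_x,\mathcal A_a)$ and, for each distinct eigenvalue $\lambda_i$, the Jordan tuple $J_{\lambda_i}(2n_{i1},\dots,2n_{is_i})$ of sizes of Jordan blocks with eigenvalue $\lambda_i$ (eigenvalues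 regarded as distinct formal symbols; the data form a multiset). *)

theory Defs
  imports "Jordan_Normal_Form.Jordan_Normal_Form" "HOL-Library.Multiset"
begin

text \<open>A complex Lie algebra of dimension n with basis e_0..e_(n-1) is given by
  structure constants c i j k = coefficient of e_k in [e_i, e_j]
  (values outside the range i,j,k < n are irrelevant).\<close>

definition is_lie_alg :: "nat \<Rightarrow> (nat \<Rightarrow> nat \<Rightarrow> nat \<Rightarrow> complex) \<Rightarrow> bool" where
  "is_lie_alg n c \<longleftrightarrow>
     (\<forall>i<n. \<forall>j<n. \<forall>k<n. c i j k = - c j i k) \<and>
     (\<forall>i<n. \<forall>j<n. \<forall>k<n. \<forall>m<n.
        (\<Sum>l<n. c i j l * c l k m + c j k l * c l i m + c k i l * c l j m) = 0)"

text \<open>For x in g* (coordinates w.r.t. the dual basis), the skew form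
  A_x(e_i, e_j) = <x, [e_i, e_j]>.\<close>

definition lie_form :: "nat \<Rightarrow> (nat \<Rightarrow> nat \<Rightarrow> nat \<Rightarrow> complex) \<Rightarrow> complex vec \<Rightarrow> complex mat" where
  "lie_form n c x = mat n n (\<lambda>(i,j). \<Sum>k<n. x $ k * c i j k)"

definition skew_block :: "complex mat \<Rightarrow> complex mat" where
  "skew_block M = four_block_mat (0\<^sub>m (dim_row M) (dim_row M)) M
      (mat (dim_col M) (dim_row M) (\<lambda>(i,j). - M $$ (j,i))) (0\<^sub>m (dim_col M) (dim_col M))"

text \<open>Block descriptors: Jordan block with eigenvalue mu (None = infinity)
  of size 2m, and Kronecker block of size 2k-1.\<close>
datatype jk_block = Jor "complex option" nat | Kro nat

fun block_pair :: "jk_block \<Rightarrow> complex mat \<times> complex mat" where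
  "block_pair (Jor (Some \<mu>) m) = (skew_block (jordan_block m \<mu>), skew_block (1\<^sub>m m))"
| "block_pair (Jor None m) = (skew_block (1\<^sub>m m), skew_block (jordan_block m 0))"
| "block_pair (Kro k) =
     (skew_block (mat k (k - 1) (\<lambda>(i,j). if i = j then 1 else 0)),
      skew_block (mat k (k - 1) (\<lambda>(i,j). if i = Suc j then 1 else 0)))"

fun block_param :: "jk_block \<Rightarrow> nat" where
  "block_param (Jor _ m) = m"
| "block_param (Kro k) = k"

definition diag_mat :: "complex mat \<Rightarrow> complex mat \<Rightarrow> complex mat" where
  "diag_mat A B = four_block_mat A (0\<^sub>m (dim_row A) (dim_col B)) (0\<^sub>m (dim_row B) (dim_col A)) B"

fun blocks_pair :: "jk_block list \<Rightarrow> complex mat \<times> complex mat" where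
  "blocks_pair [] = (0\<^sub>m 0 0, 0\<^sub>m 0 0)"
| "blocks_pair (b # bs) =
     (diag_mat (fst (block_pair b)) (fst (blocks_pair bs)),
      diag_mat (snd (block_pair b)) (snd (blocks_pair bs)))"

definition jk_decomp :: "nat \<Rightarrow> complex mat \<Rightarrow> complex mat \<Rightarrow> jk_block list \<Rightarrow> bool" where
  "jk_decomp n A B bs \<longleftrightarrow>
     (\<forall>b \<in> set bs. block_param b > 0) \<and>
     (\<exists>P \<in> carrier_mat n n. invertible_mat P \<and>
        transpose_mat P * A * P = fst (blocks_pair bs) \<and>
        transpose_mat P * B * P = snd (blocks_pair bs))"

text \<open>Abstract JK data of a decomposition: the multiset of Kronecker parameters k
  (block sizes 2k-1) and the multiset of Jordan tuples, one tuple per distinct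
  eigenvalue, each tuple being the multiset of half-sizes n of the blocks 2n x 2n
  with that eigenvalue (eigenvalues forgotten, i.e. treated as formal symbols).\<close>
definition jk_data :: "jk_block list \<Rightarrow> nat multiset \<times> nat multiset multiset" where
  "jk_data bs =
     (mset [k. Kro k \<leftarrow> bs],
      image_mset (\<lambda>\<mu>. mset [m. Jor \<mu>' m \<leftarrow> bs, \<mu>' = \<mu>])
        (mset_set {\<mu>. \<exists>m. Jor \<mu> m \<in> set bs}))"

definition jk_type :: "nat \<Rightarrow> complex mat \<Rightarrow> complex mat \<Rightarrow> nat multiset \<times> nat multiset multiset \<Rightarrow> bool" where
  "jk_type n A B T \<longleftrightarrow> (\<exists>bs. jk_decomp n A B bs \<and> jk_data bs = T)"

inductive_set poly_funs :: "nat \<Rightarrow> (complex vec \<Rightarrow> complex) set" for N where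
  const: "(\<lambda>z. a) \<in> poly_funs N"
| coord: "i < N \<Longrightarrow> (\<lambda>z. z $ i) \<in> poly_funs N"
| add: "f \<in> poly_funs N \<Longrightarrow> g \<in> poly_funs N \<Longrightarrow> (\<lambda>z. f z + g z) \<in> poly_funs N"
| mult: "f \<in> poly_funs N \<Longrightarrow> g \<in> poly_funs N \<Longrightarrow> (\<lambda>z. f z * g z) \<in> poly_funs N"

definition zariski_open :: "nat \<Rightarrow> complex vec set \<Rightarrow> bool" where
  "zariski_open N U \<longleftrightarrow>
     (\<exists>F \<subseteq> poly_funs N. U = {z \<in> carrier_vec N. \<exists>f \<in> F. f z \<noteq> 0})"

text \<open>A point z of g* x g* = C^(2n) is split as (x, a).\<close>
definition JK_invariants :: "nat \<Rightarrow> (nat \<Rightarrow> nat \<Rightarrow> nat \<Rightarrow> complex) \<Rightarrow>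
    nat multiset \<times> nat multiset multiset \<Rightarrow> bool" where
  "JK_invariants n c T \<longleftrightarrow>
     (\<exists>U. zariski_open (2 * n) U \<and> U \<noteq> {} \<and>
        (\<forall>z \<in> U. jk_type n (lie_form n c (vec n (\<lambda>i. z $ i)))
                            (lie_form n c (vec n (\<lambda>i. z $ (n + i)))) T))"

end

theory Submission
  imports Defs "HOL-Computational_Algebra.Formal_Power_Series"
begin

text \<open>Necessity. For \<open>(x, a)\<close> generic, \<open>G(s) = m(s) (s A\<^sub>a - A\<^sub>x)\<^sup>-\<^sup>1\<close> is a polynomial matrix, where \<open>m\<close> is the
  product of \<open>(s - \<mu>)\<^bsup>n(\<mu>)\<^esup>\<close>, \<open>n(\<mu>)\<close> being the size of the largest block of the eigenvalue \<open>\<mu>\<close>, and the rank of \<open>G(\<mu>)\<close>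
  is twice the number of largest blocks. The Jacobi identity says that the 2-form \<open>A\<^sub>y\<^sup>-\<^sup>1\<close> in \<open>y = x - s a\<close> is
  closed; since the type is constant near \<open>x\<close>, its pole along the singular set has constant order, and the
  leading coefficient of the closedness relation reads \<open>d\<mu> \<and> G(\<mu>) = 0\<close>. As \<open>d\<mu>(a) \<noteq> 0\<close>, the form \<open>G(\<mu>)\<close> is
  decomposable, so it has rank at most 2.

  Sufficiency. For a tuple \<open>n > m\<^sub>1 \<ge> m\<^sub>2 \<ge> \<dots>\<close> let \<open>R = \<complex>[t]/t\<^sup>n\<close>, \<open>P = \<Oplus>\<^sub>k \<complex>[t]/t\<^bsup>m(k)\<^esup>\<close>. The commutative algebra \<open>R \<oplus> P\<close>
  with \<open>P\<^sup>2 = 0\<close> acts on an abelian copy of \<open>R \<oplus> P\<close>, where \<open>P \<times> P\<close> maps to \<open>R\<close> through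
  \<open>\<complex>[t]/t\<^sup>m \<cong> t\<^bsup>n-m\<^esup> R\<close>. In the semidirect product the pencil is, up to a coupling term, multiplication by a
  power series with generic linear coefficient, and the coupling is absorbed because \<open>m < n\<close>. Direct sums
  realise several tuples.\<close>

section \<open>Entries of block-diagonal pairs\<close>

text \<open>No eigenvalue is known beforehand to depend continuously on \<open>x\<close>, let alone
  differentiably: constancy of the type only fixes the number of eigenvalues and the sum of their
  largest block sizes. Derivatives of eigenvalues are therefore replaced by quotients along
  sequences \<open>A + t k V\<close> with \<open>t k\<close> tending to 0, one for each basis
  direction \<open>V\<close>. The two fixed numbers prevent roots from merging and pole orders from
  changing in the limit, and the limit of root displacement over \<open>t k\<close> takes the place
  of a partial derivative of \<mu>. An infinite eigenvalue would make \<open>A_a\<close> singular;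
  it is avoided by moving \<open>a\<close> slightly towards \<open>x\<close>, which turns
  \<open>A_a\<close> into \<open>A_a + t A_x\<close> and stays inside the open set.

  In the construction, the coupling of a module of length \<open>m\<close> into one of length
  \<open>n\<close> is \<open>t^(n-m)\<close> times a power series, and absorbing it requires a
  division by the nilpotent part of the pencil, which is a unit times \<open>t\<close>. The
  remaining exponent \<open>n - m - 1\<close> is where strictness of the maximum enters.\<close>

text \<open>A label \<open>(k, \<mu>, m, s, i)\<close> names the \<open>i\<close>-th vector in the second (\<open>s\<close>) or first (\<open>\<not> s\<close>) half of the \<open>k\<close>-th
  block, which has parameters \<open>\<mu>, m\<close>.\<close>

fun labels :: "nat \<Rightarrow> ('a \<times> nat) list \<Rightarrow> (nat \<times> 'a \<times> nat \<times> bool \<times> nat) list" where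
  "labels k [] = []"
| "labels k ((\<mu>, m) # ps) =
     map (\<lambda>i. (k, \<mu>, m, False, i)) [0..<m] @ map (\<lambda>i. (k, \<mu>, m, True, i)) [0..<m] @ labels (Suc k) ps"

fun ent :: "('a \<Rightarrow> nat \<Rightarrow> nat \<Rightarrow> nat \<Rightarrow> 'b::comm_ring_1) \<Rightarrow>
    nat \<times> 'a \<times> nat \<times> bool \<times> nat \<Rightarrow> nat \<times> 'a \<times> nat \<times> bool \<times> nat \<Rightarrow> 'b" where
  "ent f (k, \<mu>, m, s, i) (k', \<mu>', m', s', j) =
     (if k \<noteq> k' then 0
      else if \<not> s \<and> s' then f \<mu> m i j
      else if s \<and> \<not> s' then - f \<mu> m j i
      else 0)"

text \<open>Entries are read off labels instead of nested \<open>four_block_mat\<close>s, so that a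
  matrix product becomes a sum over a finite set of labels that collapses to a single block.\<close>

definition ent_mat :: "('a \<Rightarrow> nat \<Rightarrow> nat \<Rightarrow> nat \<Rightarrow> 'b::comm_ring_1) \<Rightarrow> ('a \<times> nat) list \<Rightarrow> 'b mat" where
  "ent_mat f ps = mat (length (labels 0 ps)) (length (labels 0 ps)) (\<lambda>(i,j). ent f (labels 0 ps ! i) (labels 0 ps ! j))"

definition jor_ent :: "'b::comm_ring_1 \<Rightarrow> nat \<Rightarrow> nat \<Rightarrow> nat \<Rightarrow> 'b" where
  "jor_ent \<mu> m i j = (if i = j then \<mu> else if Suc i = j then 1 else 0)"

definition one_ent :: "'a \<Rightarrow> nat \<Rightarrow> nat \<Rightarrow> nat \<Rightarrow> 'b::comm_ring_1" where
  "one_ent \<mu> m i j = (if i = j then 1 else 0)"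

lemma mem_labels:
  "(k, \<mu>, m, s, i) \<in> set (labels k0 ps) \<longleftrightarrow> k0 \<le> k \<and> k < k0 + length ps \<and> ps ! (k - k0) = (\<mu>, m) \<and> i < m"
proof (induction ps arbitrary: k0)
  case Nil then show ?case by auto
next
  case (Cons p ps)
  obtain \<mu>' m' where p: "p = (\<mu>', m')" by (cases p)
  show ?case
  proof (cases "k = k0")
    case True
    then show ?thesis using Cons.IH[of "Suc k0"] by (cases s) (auto simp: p)
  next
    case False
    then have "(k, \<mu>, m, s, i) \<in> set (labels k0 (p # ps)) \<longleftrightarrow> (k, \<mu>, m, s, i) \<in> set (labels (Suc k0) ps)"
      by (auto simp: p)
    also have "\<dots> \<longleftrightarrow> k0 \<le> k \<and> k < k0 + length (p # ps) \<and> (p # ps) ! (k - k0) = (\<mu>, m) \<and> i < m"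
      using False Cons.IH[of "Suc k0"] by (cases "k - k0") (auto simp: nth_Cons' diff_Suc split: nat.splits)
    finally show ?thesis .
  qed
qed

lemma distinct_labels: "distinct (labels k0 ps)"
  by (induction k0 ps rule: labels.induct) (auto simp: distinct_map inj_on_def mem_labels)

abbreviation num_labels :: "('a \<times> nat) list \<Rightarrow> nat" where
  "num_labels ps \<equiv> length (labels 0 ps)"

lemma sum_labels:
  "(\<Sum>q<num_labels ps. F (labels 0 ps ! q)) = sum F (set (labels 0 ps))"
  using sum.distinct_set_conv_list[OF distinct_labels, of F 0 ps]
  by (simp add: sum_list_sum_nth atLeast0LessThan)

lemma sum_labels_block:
  assumes "(k, \<mu>, m, s, i) \<in> set (labels 0 ps)" "\<And>l. fst l \<noteq> k \<Longrightarrow> F l = (0 :: 'b :: comm_monoid_add)"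
  shows "sum F (set (labels 0 ps)) = (\<Sum>j<m. F (k, \<mu>, m, False, j)) + (\<Sum>j<m. F (k, \<mu>, m, True, j))"
proof -
  let ?S = "(\<lambda>j. (k, \<mu>, m, False, j)) ` {..<m}" and ?T = "(\<lambda>j. (k, \<mu>, m, True, j)) ` {..<m}"
  have "sum F (set (labels 0 ps)) = sum F (?S \<union> ?T)"
  proof (rule sum.mono_neutral_right)
    show "?S \<union> ?T \<subseteq> set (labels 0 ps)" using assms(1) by (auto simp: mem_labels)
    show "\<forall>l\<in>set (labels 0 ps) - (?S \<union> ?T). F l = 0"
    proof
      fix l assume l: "l \<in> set (labels 0 ps) - (?S \<union> ?T)"
      obtain k' \<mu>' m' s' j where ll: "l = (k', \<mu>', m', s', j)" by (cases l)
      have "k' \<noteq> k" using l assms(1) unfolding ll by (cases s') (auto simp: mem_labels image_iff)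
      then show "F l = 0" using assms(2) ll by simp
    qed
  qed simp
  also have "\<dots> = sum F ?S + sum F ?T" by (rule sum.union_disjoint) auto
  also have "\<dots> = (\<Sum>j<m. F (k, \<mu>, m, False, j)) + (\<Sum>j<m. F (k, \<mu>, m, True, j))"
    by (subst (1 2) sum.reindex) (auto simp: inj_on_def)
  finally show ?thesis .
qed

lemma ent_mat_carrier[simp]: "ent_mat f ps \<in> carrier_mat (num_labels ps) (num_labels ps)"
  by (simp add: ent_mat_def)

text \<open>Blockwise this is \<open>[[0, f], [-f^T, 0]]\<close> times
  \<open>[[0, -K^T], [K, 0]]\<close>, with diagonal blocks \<open>f K\<close> and
  \<open>(K f)^T\<close>; hence the transposed sign and the two one-sided assumptions.\<close>

lemma ent_mat_mult:
  assumes "\<And>\<mu> m i j. (\<mu>, m) \<in> set ps \<Longrightarrow> i < m \<Longrightarrow> j < m \<Longrightarrow>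
      (\<Sum>q<m. f \<mu> m i q * K \<mu> m q j) = (if i = j then c else 0)"
    and "\<And>\<mu> m i j. (\<mu>, m) \<in> set ps \<Longrightarrow> i < m \<Longrightarrow> j < m \<Longrightarrow>
      (\<Sum>q<m. K \<mu> m i q * f \<mu> m q j) = (if i = j then c else 0)"
  shows "ent_mat f ps * ent_mat (\<lambda>\<mu> m i j. - K \<mu> m j i) ps = c \<cdot>\<^sub>m 1\<^sub>m (num_labels ps)"
proof (rule eq_matI)
  let ?g = "\<lambda>\<mu> m i j. - K \<mu> m j i" and ?L = "labels 0 ps"
  fix i j assume "i < dim_row (c \<cdot>\<^sub>m 1\<^sub>m (length ?L))" "j < dim_col (c \<cdot>\<^sub>m 1\<^sub>m (length ?L))"
  then have i: "i < length ?L" and j: "j < length ?L" by auto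
  obtain k \<mu> m s a where A: "?L ! i = (k, \<mu>, m, s, a)" by (cases "?L ! i")
  obtain k' \<mu>' m' s' b where B: "?L ! j = (k', \<mu>', m', s', b)" by (cases "?L ! j")
  have mA: "(k, \<mu>, m, s, a) \<in> set ?L" and mB: "(k', \<mu>', m', s', b) \<in> set ?L"
    using A B i j by (metis nth_mem)+
  have eq: "i = j \<longleftrightarrow> (k, \<mu>, m, s, a) = (k', \<mu>', m', s', b)"
    using A B i j distinct_labels nth_eq_iff_index_eq by metis
  have ps: "(\<mu>, m) \<in> set ps" using mA nth_mem[of k ps] by (simp add: mem_labels)
  have "(ent_mat f ps * ent_mat ?g ps) $$ (i, j) = (\<Sum>q<length ?L. ent f (?L ! i) (?L ! q) * ent ?g (?L ! q) (?L ! j))"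
    using i j by (simp add: ent_mat_def scalar_prod_def atLeast0LessThan)
  also have "\<dots> = (\<Sum>l\<in>set ?L. ent f (?L ! i) l * ent ?g l (?L ! j))"
    by (rule sum_labels[where F = "\<lambda>l. ent f (?L ! i) l * ent ?g l (?L ! j)"])
  also have "\<dots> = (\<Sum>q<m. ent f (?L ! i) (k, \<mu>, m, False, q) * ent ?g (k, \<mu>, m, False, q) (?L ! j)) +
       (\<Sum>q<m. ent f (?L ! i) (k, \<mu>, m, True, q) * ent ?g (k, \<mu>, m, True, q) (?L ! j))"
    by (rule sum_labels_block[OF mA]) (auto simp: A)
  also have "\<dots> = (if i = j then c else 0)"
  proof (cases "k = k'")
    case False then show ?thesis using eq by (auto simp: A B)
  next
    case True
    then have same: "\<mu>' = \<mu>" "m' = m" and ab: "a < m" "b < m" using mA mB by (auto simp: mem_labels)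
    show ?thesis
      using assms(1)[OF ps ab] assms(2)[OF ps ab(2,1)] eq True same
      by (cases s; cases s') (auto simp: A B mult.commute)
  qed
  finally show "(ent_mat f ps * ent_mat ?g ps) $$ (i, j) = (c \<cdot>\<^sub>m 1\<^sub>m (length ?L)) $$ (i, j)"
    using i j by simp
qed (auto simp: ent_mat_def)

definition jor_blocks :: "(complex \<times> nat) list \<Rightarrow> jk_block list" where
  "jor_blocks ps = map (\<lambda>(\<mu>, m). Jor (Some \<mu>) m) ps"

lemma diag_mat_ent:
  fixes f :: "complex \<Rightarrow> nat \<Rightarrow> nat \<Rightarrow> nat \<Rightarrow> complex"
  defines "E \<equiv> \<lambda>k ps. mat (length (labels k ps)) (length (labels k ps)) (\<lambda>(i,j). ent f (labels k ps ! i) (labels k ps ! j))"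
  shows "Defs.diag_mat (skew_block (mat m m (\<lambda>(i,j). f \<mu> m i j))) (E (Suc k) ps) = E k ((\<mu>, m) # ps)"
proof (rule eq_matI)
  let ?L = "labels (Suc k) ps"
  fix i j assume "i < dim_row (E k ((\<mu>, m) # ps))" "j < dim_col (E k ((\<mu>, m) # ps))"
  then have ij: "i < 2 * m + length ?L" "j < 2 * m + length ?L" by (auto simp: E_def)
  have nth: "labels k ((\<mu>, m) # ps) ! q =
    (if q < m then (k, \<mu>, m, False, q) else if q < 2 * m then (k, \<mu>, m, True, q - m) else ?L ! (q - 2 * m))"
    if "q < 2 * m + length ?L" for q
    using that by (auto simp: nth_append mult_2)
  have len: "length (labels k ((\<mu>, m) # ps)) = 2 * m + length ?L" by simp
  have k: "fst (?L ! q) \<noteq> k" "k \<noteq> fst (?L ! q)" if "q < length ?L" for q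
  proof -
    obtain k' \<mu>' m' s' a where q: "?L ! q = (k', \<mu>', m', s', a)" by (cases "?L ! q")
    have "(k', \<mu>', m', s', a) \<in> set ?L" using nth_mem[OF that] by (simp only: q)
    then show "fst (?L ! q) \<noteq> k" "k \<noteq> fst (?L ! q)" by (auto simp: q mem_labels)
  qed
  have ent0: "ent f a b = 0" if "fst a \<noteq> fst b" for a b
    using that by (cases a; cases b) auto
  show "Defs.diag_mat (skew_block (mat m m (\<lambda>(i,j). f \<mu> m i j))) (E (Suc k) ps) $$ (i,j) = E k ((\<mu>, m) # ps) $$ (i,j)"
    using ij k[of "i - 2 * m"] k[of "j - 2 * m"] nth[OF ij(1)] nth[OF ij(2)]
    by (auto simp: Defs.diag_mat_def skew_block_def E_def len ent0 mult_2 simp del: labels.simps)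
qed (auto simp: Defs.diag_mat_def skew_block_def E_def)

lemma blocks_pair_jor:
  "blocks_pair (jor_blocks ps) = (ent_mat jor_ent ps, ent_mat one_ent ps)"
proof -
  define E where "E = (\<lambda>(f :: complex \<Rightarrow> nat \<Rightarrow> nat \<Rightarrow> nat \<Rightarrow> complex) k ps.
     mat (length (labels k ps)) (length (labels k ps)) (\<lambda>(i,j). ent f (labels k ps ! i) (labels k ps ! j)))"
  \<comment> \<open>The number given to the first block is generalised, because the tail of the list
    is numbered from \<open>Suc k\<close>.\<close>
  have "blocks_pair (jor_blocks ps) = (E jor_ent k ps, E one_ent k ps)" for k
  proof (induction ps arbitrary: k)
    case Nil then show ?case by (auto simp: jor_blocks_def E_def intro!: eq_matI)
  next
    case (Cons p ps)
    obtain \<mu> m where p: "p = (\<mu>, m)" by (cases p)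
    have "jordan_block m \<mu> = mat m m (\<lambda>(i,j). jor_ent \<mu> m i j)"
      "1\<^sub>m m = mat m m (\<lambda>(i,j). one_ent \<mu> m i j :: complex)"
      by (auto simp: jordan_block_def jor_ent_def one_ent_def intro!: eq_matI)
    then show ?case
      using Cons.IH[of "Suc k"] diag_mat_ent[of m jor_ent \<mu> k ps] diag_mat_ent[of m one_ent \<mu> k ps]
      by (simp add: p jor_blocks_def E_def)
  qed
  from this[of 0] show ?thesis by (simp add: E_def ent_mat_def)
qed

section \<open>Polynomial resolvents\<close>

abbreviation const_mat :: "complex mat \<Rightarrow> complex poly mat" where
  "const_mat \<equiv> map_mat (\<lambda>c. [:c:])"

definition pencil :: "complex mat \<Rightarrow> complex mat \<Rightarrow> complex poly mat" where
  "pencil A B = [:0, 1:] \<cdot>\<^sub>m const_mat B - const_mat A"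

definition root_poly :: "complex set \<Rightarrow> (complex \<Rightarrow> nat) \<Rightarrow> complex poly" where
  "root_poly R e = (\<Prod>\<mu>\<in>R. [:- \<mu>, 1:] ^ e \<mu>)"

lemma const_mat_mult:
  "A \<in> carrier_mat n m \<Longrightarrow> B \<in> carrier_mat m k \<Longrightarrow> const_mat (A * B) = const_mat A * const_mat B"
proof -
  interpret semiring_hom "\<lambda>c :: complex. [:c:]" by unfold_locales (auto simp: one_pCons)
  show "A \<in> carrier_mat n m \<Longrightarrow> B \<in> carrier_mat m k \<Longrightarrow> const_mat (A * B) = const_mat A * const_mat B"
    by (rule mat_hom_mult)
qed

lemma const_mat_one: "const_mat (1\<^sub>m n) = 1\<^sub>m n"
  by (rule eq_matI) (auto simp: one_pCons)

lemma pencil_congruence: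
  assumes "P \<in> carrier_mat n n" "A \<in> carrier_mat n n" "B \<in> carrier_mat n n"
  shows "pencil (P\<^sup>T * A * P) (P\<^sup>T * B * P) =
    transpose_mat (const_mat P) * pencil A B * const_mat P"
proof -
  have t: "const_mat (P\<^sup>T) = transpose_mat (const_mat P)"
    using assms by (intro eq_matI) auto
  have c: "const_mat (P\<^sup>T * X * P) = transpose_mat (const_mat P) * const_mat X * const_mat P"
    if "X \<in> carrier_mat n n" for X
    using that assms by (simp add: const_mat_mult[where n=n and m=n and k=n] t)
  define p a b where "p = const_mat P" and "a = const_mat A" and "b = const_mat B"
  have car: "p \<in> carrier_mat n n" "a \<in> carrier_mat n n" "b \<in> carrier_mat n n"
    using assms by (auto simp: p_def a_def b_def)
  have "p\<^sup>T * ([:0,1:] \<cdot>\<^sub>m b - a) * p = (p\<^sup>T * ([:0,1:] \<cdot>\<^sub>m b) - p\<^sup>T * a) * p"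
    using car by (subst mult_minus_distrib_mat[where nr=n and n=n and nc=n]) auto
  also have "\<dots> = p\<^sup>T * ([:0,1:] \<cdot>\<^sub>m b) * p - p\<^sup>T * a * p"
    using car by (subst minus_mult_distrib_mat[where nr=n and n=n and nc=n]) auto
  also have "p\<^sup>T * ([:0,1:] \<cdot>\<^sub>m b) * p = [:0,1:] \<cdot>\<^sub>m (p\<^sup>T * b * p)"
    using car by (simp add: mult_smult_distrib[of _ n n _ n] mult_smult_assoc_mat[of _ n n _ n])
  finally show ?thesis
    unfolding pencil_def c[OF assms(2)] c[OF assms(3)] p_def a_def b_def by simp
qed

text \<open>Entry of \<open>root_poly R e\<close> times the inverse of \<open>s - J_\<mu>\<close>,
  by the geometric series \<open>sum_k N^k / (s - \<mu>)^(k+1)\<close> in the nilpotent shift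
  \<open>N\<close>. The exponent is a true difference as long as \<open>j < m\<close> and
  \<open>m \<le> e \<mu>\<close>.\<close>

definition cofactor_ent :: "complex set \<Rightarrow> (complex \<Rightarrow> nat) \<Rightarrow> complex \<Rightarrow> nat \<Rightarrow> nat \<Rightarrow> nat \<Rightarrow> complex poly" where
  "cofactor_ent R e \<mu> m i j = (if i \<le> j then [:- \<mu>, 1:] ^ (e \<mu> - 1 - (j - i)) * root_poly (R - {\<mu>}) e else 0)"

abbreviation cofactor_mat :: "complex set \<Rightarrow> (complex \<Rightarrow> nat) \<Rightarrow> (complex \<times> nat) list \<Rightarrow> complex poly mat" where
  "cofactor_mat R e ps \<equiv> ent_mat (\<lambda>\<mu> m i j. - cofactor_ent R e \<mu> m j i) ps"

definition pencil_ent :: "complex \<Rightarrow> nat \<Rightarrow> nat \<Rightarrow> nat \<Rightarrow> complex poly" where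
  "pencil_ent \<mu> m i j = (if i = j then [:- \<mu>, 1:] else if Suc i = j then -1 else 0)"

lemma pencil_ent_mat: "pencil (ent_mat jor_ent ps) (ent_mat one_ent ps) = ent_mat pencil_ent ps"
proof (rule eq_matI)
  fix i j assume "i < dim_row (ent_mat pencil_ent ps)" "j < dim_col (ent_mat pencil_ent ps)"
  then have ij: "i < num_labels ps" "j < num_labels ps" by (auto simp: ent_mat_def)
  have "[:0,1:] * [:ent one_ent a b:] - [:ent jor_ent a b:] = ent pencil_ent a b" for a b :: "nat \<times> complex \<times> nat \<times> bool \<times> nat"
    by (cases a; cases b) (auto simp: one_ent_def jor_ent_def pencil_ent_def one_pCons)
  then show "pencil (ent_mat jor_ent ps) (ent_mat one_ent ps) $$ (i,j) = ent_mat pencil_ent ps $$ (i,j)"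
    using ij by (simp add: pencil_def ent_mat_def)
qed (auto simp: pencil_def ent_mat_def)

lemma root_poly_remove:
  "finite R \<Longrightarrow> \<mu> \<in> R \<Longrightarrow> root_poly R e = [:- \<mu>, 1:] ^ e \<mu> * root_poly (R - {\<mu>}) e"
  unfolding root_poly_def by (rule prod.remove)

lemma degree_root_poly: "finite R \<Longrightarrow> degree (root_poly R e) = sum e R"
  unfolding root_poly_def
  by (induction R rule: finite_induct) (auto simp: degree_mult_eq degree_power_eq prod_zero_iff)

lemma sum_delta_two:
  fixes g :: "nat \<Rightarrow> 'b::comm_ring_1"
  assumes "i < m"
  shows "(\<Sum>q<m. (if i = q then a else if Suc i = q then b else 0) * g q) = a * g i + (if Suc i < m then b * g (Suc i) else 0)"
proof -
  have "(\<Sum>q<m. (if i = q then a else if Suc i = q then b else 0) * g q) =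
      (\<Sum>q<m. (if q = i then a * g i else 0) + (if q = Suc i then b * g (Suc i) else 0))"
    by (rule sum.cong) auto
  also have "\<dots> = a * g i + (if Suc i < m then b * g (Suc i) else 0)"
    using assms by (simp add: sum.distrib)
  finally show ?thesis .
qed

lemma sum_delta_two':
  fixes g :: "nat \<Rightarrow> 'b::comm_ring_1"
  assumes "j < m"
  shows "(\<Sum>q<m. g q * (if q = j then a else if Suc q = j then b else 0)) = g j * a + (if 0 < j then g (j - 1) * b else 0)"
proof -
  have "(\<Sum>q<m. g q * (if q = j then a else if Suc q = j then b else 0)) =
      (\<Sum>q<m. (if q = j then g j * a else 0) + (if q = j - 1 then (if 0 < j then g (j - 1) * b else 0) else 0))"
    by (rule sum.cong) auto
  also have "\<dots> = g j * a + (if 0 < j then g (j - 1) * b else 0)"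
    using assms by (simp add: sum.distrib)
  finally show ?thesis .
qed

lemma ent_mat_resolvent:
  assumes R: "R = fst ` set ps" and e: "\<And>\<mu> m. (\<mu>, m) \<in> set ps \<Longrightarrow> 0 < m \<and> m \<le> e \<mu>"
  shows "ent_mat pencil_ent ps * cofactor_mat R e ps =
    root_poly R e \<cdot>\<^sub>m 1\<^sub>m (num_labels ps)"
proof (rule ent_mat_mult)
  fix \<mu> m i j assume ps: "(\<mu>, m) \<in> set ps" and ij: "i < m" "j < m"
  have mu: "\<mu> \<in> R" "finite R" using ps R by force+
  let ?K = "cofactor_ent R e \<mu> m" and ?x = "[:- \<mu>, 1:]"
  have em: "m \<le> e \<mu>" using e[OF ps] by simp
  have diag: "?x * ?K i i = root_poly R e" for i
    using em ij by (subst root_poly_remove[OF mu(2,1)]) (auto simp: cofactor_ent_def mult.assoc[symmetric] power_Suc[symmetric] simp del: power_Suc mult_pCons_left)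
  \<comment> \<open>Neighbouring diagonals of \<open>?K\<close> differ by one factor
    \<open>s - \<mu>\<close>; this makes the two terms of each bidiagonal product cancel.\<close>
  have off: "?x * ?K i j = ?K (Suc i) j" "?x * ?K i j = ?K i (j - 1)" if "i < j" "j < m" for i j
  proof -
    have "Suc (e \<mu> - 1 - (j - i)) = e \<mu> - 1 - (j - Suc i)" "j - 1 - i = j - Suc i" using that em by auto
    then show "?x * ?K i j = ?K (Suc i) j" "?x * ?K i j = ?K i (j - 1)"
      using that unfolding cofactor_ent_def
      by (auto simp: mult.assoc[symmetric] power_Suc[symmetric] simp del: power_Suc mult_pCons_left)
  qed
  have low: "?K i j = 0" if "j < i" for i j using that by (simp add: cofactor_ent_def)
  have "(\<Sum>q<m. pencil_ent \<mu> m i q * ?K q j) = ?x * ?K i j + (if Suc i < m then -1 * ?K (Suc i) j else 0)"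
    unfolding pencil_ent_def by (rule sum_delta_two[OF ij(1)])
  also have "\<dots> = (if i = j then root_poly R e else 0)"
    using ij off[of i j] low[of j i] low[of j "Suc i"] diag[of i]
    by (cases i j rule: linorder_cases) (auto simp del: mult_pCons_left)
  finally show "(\<Sum>q<m. pencil_ent \<mu> m i q * ?K q j) = (if i = j then root_poly R e else 0)" .
  have "(\<Sum>q<m. ?K i q * pencil_ent \<mu> m q j) = ?K i j * ?x + (if 0 < j then ?K i (j - 1) * -1 else 0)"
    unfolding pencil_ent_def by (rule sum_delta_two'[OF ij(2)])
  also have "\<dots> = (if i = j then root_poly R e else 0)"
    using ij off[of i j] low[of j i] low[of "j - 1" i] diag[of i]
    by (cases i j rule: linorder_cases) (auto simp: mult.commute[of _ ?x] simp del: mult_pCons_left mult_pCons_right)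
  finally show "(\<Sum>q<m. ?K i q * pencil_ent \<mu> m q j) = (if i = j then root_poly R e else 0)" .
qed

lemma degree_cofactor_ent:
  assumes "finite R" "\<mu> \<in> R"
  shows "degree (cofactor_ent R e \<mu> m i j) \<le> sum e R"
proof -
  have "degree ([:- \<mu>, 1:] ^ k * root_poly (R - {\<mu>}) e) \<le> sum e R" if "k \<le> e \<mu>" for k
  proof -
    have "degree ([:- \<mu>, 1:] ^ k * root_poly (R - {\<mu>}) e) \<le> k + sum e (R - {\<mu>})"
      using degree_mult_le[of "[:- \<mu>, 1:] ^ k" "root_poly (R - {\<mu>}) e"] assms(1)
      by (simp add: degree_root_poly degree_power_eq)
    also have "\<dots> \<le> sum e R" using that sum.remove[OF assms, of e] by simp
    finally show ?thesis .
  qed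
  then show ?thesis by (simp add: cofactor_ent_def)
qed

lemma degree_ent_mat:
  assumes "\<And>\<mu> m i j. (\<mu>, m) \<in> set ps \<Longrightarrow> degree (f \<mu> m i j) \<le> d" "i < num_labels ps" "j < num_labels ps"
  shows "degree (ent_mat f ps $$ (i, j)) \<le> d"
proof -
  have "degree (ent f a b) \<le> d" if "a \<in> set (labels 0 ps)" for a b
  proof -
    obtain k \<mu> m s x where a: "a = (k, \<mu>, m, s, x)" by (cases a)
    have "(\<mu>, m) \<in> set ps" using that nth_mem[of k ps] by (simp add: a mem_labels)
    then show ?thesis using assms(1) by (cases b) (auto simp: a)
  qed
  then show ?thesis using assms(2,3) by (simp add: ent_mat_def)
qed

lemma eval_congruence:
  fixes H :: "complex poly mat"
  assumes "P \<in> carrier_mat n n" "H \<in> carrier_mat n n" "i < n" "j < n"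
  shows "(const_mat P * H * transpose_mat (const_mat P)) $$ (i, j) =
    (\<Sum>q<n. \<Sum>p<n. [:P $$ (i, p):] * H $$ (p, q) * [:P $$ (j, q):])"
proof -
  have "(const_mat P * H * transpose_mat (const_mat P)) $$ (i, j) =
     (\<Sum>q<n. (\<Sum>p<n. [:P $$ (i, p):] * H $$ (p, q)) * [:P $$ (j, q):])"
    using assms by (simp add: scalar_prod_def atLeast0LessThan del: assoc_mult_mat mult_pCons_left mult_pCons_right)
  then show ?thesis by (simp only: sum_distrib_right)
qed

text \<open>In a block of full size \<open>e \<mu>\<close> the corner entry
  \<open>(0, e \<mu> - 1)\<close> carries \<open>s - \<mu>\<close> to the power 0, so it does not
  vanish at \<open>\<mu>\<close>.\<close>

lemma ent_mat_cofactor_root: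
  assumes R: "R = fst ` set ps" and e: "\<And>\<mu> m. (\<mu>, m) \<in> set ps \<Longrightarrow> 0 < m \<and> m \<le> e \<mu>"
    and k: "k < length ps" "ps ! k = (\<mu>, e \<mu>)"
  obtains i j c where "i < num_labels ps" "j < num_labels ps" "c \<noteq> 0"
    "labels 0 ps ! i = (k, \<mu>, e \<mu>, True, 0)" "labels 0 ps ! j = (k, \<mu>, e \<mu>, False, e \<mu> - 1)"
    "c = poly (root_poly (R - {\<mu>}) e) \<mu>"
    "poly (cofactor_mat R e ps $$ (i, j)) \<mu> = c"
proof -
  have m: "(\<mu>, e \<mu>) \<in> set ps" using k nth_mem by metis
  then have "(k, \<mu>, e \<mu>, True, 0) \<in> set (labels 0 ps)" "(k, \<mu>, e \<mu>, False, e \<mu> - 1) \<in> set (labels 0 ps)"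
    using k e[OF m] by (auto simp: mem_labels)
  then obtain i j where ij: "i < num_labels ps" "j < num_labels ps"
    "labels 0 ps ! i = (k, \<mu>, e \<mu>, True, 0)" "labels 0 ps ! j = (k, \<mu>, e \<mu>, False, e \<mu> - 1)"
    by (metis in_set_conv_nth)
  define c where "c = poly (root_poly (R - {\<mu>}) e) \<mu>"
  have "finite R" using R by simp
  then have "c \<noteq> 0" by (auto simp: c_def root_poly_def poly_prod prod_zero_iff)
  moreover have "poly (cofactor_mat R e ps $$ (i, j)) \<mu> = c"
    using ij by (simp add: ent_mat_def cofactor_ent_def c_def)
  ultimately show ?thesis using that ij c_def by blast
qed

text \<open>Two largest blocks contribute a nonzero \<open>4 \<times> 4\<close> Pfaffian, contradicting the Pluecker relation.\<close>

lemma cofactor_not_decomposable: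
  assumes R: "R = fst ` set ps" and e: "\<And>\<mu> m. (\<mu>, m) \<in> set ps \<Longrightarrow> 0 < m \<and> m \<le> e \<mu>"
    and k: "k1 < length ps" "k2 < length ps" "k1 \<noteq> k2" "ps ! k1 = (\<mu>, e \<mu>)" "ps ! k2 = (\<mu>, e \<mu>)"
    and dec: "\<And>i j. i < num_labels ps \<Longrightarrow> j < num_labels ps \<Longrightarrow>
      poly (cofactor_mat R e ps $$ (i, j)) \<mu> = \<alpha> i * \<beta> j - \<alpha> j * (\<beta> i :: complex)"
  shows False
proof -
  let ?E = "\<lambda>i j. poly (cofactor_mat R e ps $$ (i, j)) \<mu>"
  obtain i1 j1 c where 1: "i1 < num_labels ps" "j1 < num_labels ps" "c \<noteq> 0"
    "labels 0 ps ! i1 = (k1, \<mu>, e \<mu>, True, 0)" "labels 0 ps ! j1 = (k1, \<mu>, e \<mu>, False, e \<mu> - 1)" "?E i1 j1 = c"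
    using ent_mat_cofactor_root[where R = R and e = e, OF R e k(1,4)] by metis
  obtain i2 j2 d where 2: "i2 < num_labels ps" "j2 < num_labels ps" "d \<noteq> 0"
    "labels 0 ps ! i2 = (k2, \<mu>, e \<mu>, True, 0)" "labels 0 ps ! j2 = (k2, \<mu>, e \<mu>, False, e \<mu> - 1)" "?E i2 j2 = d"
    using ent_mat_cofactor_root[where R = R and e = e, OF R e k(2,5)] by metis
  have z: "?E i1 i2 = 0" "?E i1 j2 = 0" "?E j1 i2 = 0" "?E j1 j2 = 0"
    using 1 2 k(3) by (simp_all add: ent_mat_def)
  have "?E i1 j1 * ?E i2 j2 - ?E i1 i2 * ?E j1 j2 + ?E i1 j2 * ?E j1 i2 = 0"
    unfolding dec[OF 1(1,2)] dec[OF 2(1,2)] dec[OF 1(1) 2(1)] dec[OF 1(2) 2(2)] dec[OF 1(1) 2(2)] dec[OF 1(2) 2(1)]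
    by (simp add: algebra_simps)
  then show False using z 1(3,6) 2(3,6) by simp
qed

lemma invertible_mat_inverse:
  fixes P :: "complex mat"
  assumes "P \<in> carrier_mat n n" "invertible_mat P"
  obtains Q where "Q \<in> carrier_mat n n" "P * Q = 1\<^sub>m n" "Q * P = 1\<^sub>m n"
proof -
  obtain Q where Q: "inverts_mat P Q" "inverts_mat Q P" using assms(2) unfolding invertible_mat_def by blast
  then have eqs: "P * Q = 1\<^sub>m n" "Q * P = 1\<^sub>m (dim_row Q)" using assms by (auto simp: inverts_mat_def)
  have "dim_col Q = n" using arg_cong[OF eqs(1), of dim_col] by simp
  moreover have "dim_row Q = n" using arg_cong[OF eqs(2), of dim_col] assms(1) by simp
  ultimately show ?thesis using that[of Q] eqs by auto
qed

abbreviation repeated :: "'a list \<Rightarrow> 'a \<Rightarrow> bool" where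
  "repeated xs q \<equiv> \<exists>k1<length xs. \<exists>k2<length xs. k1 \<noteq> k2 \<and> xs ! k1 = q \<and> xs ! k2 = q"

abbreviation wedge_at :: "nat \<Rightarrow> complex poly mat \<Rightarrow> complex \<Rightarrow> (nat \<Rightarrow> complex) \<Rightarrow> (nat \<Rightarrow> complex) \<Rightarrow> bool" where
  "wedge_at n G \<mu> \<alpha> \<beta> \<equiv> \<forall>i<n. \<forall>j<n. poly (G $$ (i, j)) \<mu> = \<alpha> i * \<beta> j - \<alpha> j * \<beta> i"

text \<open>A congruence of the pencil by \<open>P\<close> acts on the resolvent contragrediently,
  \<open>G = P H P^T\<close>. The degree bound is pushed forward along \<open>P\<close>;
  nonvanishing and indecomposability are pulled back along \<open>Q = P^-1\<close>.\<close>

lemma jk_resolvent: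
  fixes A B P :: "complex mat"
  assumes R: "R = fst ` set ps" and e: "\<And>\<mu> m. (\<mu>, m) \<in> set ps \<Longrightarrow> 0 < m \<and> m \<le> e \<mu>"
    and car: "A \<in> carrier_mat n n" "B \<in> carrier_mat n n" "P \<in> carrier_mat n n" and inv: "invertible_mat P"
    and PA: "P\<^sup>T * A * P = ent_mat jor_ent ps" and PB: "P\<^sup>T * B * P = ent_mat one_ent ps"
  obtains G where "G \<in> carrier_mat n n" "pencil A B * G = root_poly R e \<cdot>\<^sub>m 1\<^sub>m n"
    "\<And>i j. i < n \<Longrightarrow> j < n \<Longrightarrow> degree (G $$ (i, j)) \<le> sum e R"
    "\<And>\<mu>. \<exists>k<length ps. ps ! k = (\<mu>, e \<mu>) \<Longrightarrow> \<exists>i<n. \<exists>j<n. poly (G $$ (i, j)) \<mu> \<noteq> 0"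
    "\<And>\<mu> \<alpha> \<beta>. repeated ps (\<mu>, e \<mu>) \<Longrightarrow>
      \<not> (wedge_at n G \<mu> \<alpha> \<beta>)"
proof -
  have N: "num_labels ps = n"
    using arg_cong[OF PA, of dim_row] car by (simp add: ent_mat_def)
  define H where "H = cofactor_mat R e ps"
  define D where "D = pencil A B"
  have H: "H \<in> carrier_mat n n" unfolding H_def N[symmetric] by simp
  have D: "D \<in> carrier_mat n n" using car by (auto simp: D_def pencil_def)
  obtain Q where Q: "Q \<in> carrier_mat n n" "P * Q = 1\<^sub>m n" "Q * P = 1\<^sub>m n"
    using invertible_mat_inverse[OF car(3) inv] .
  let ?m = "root_poly R e"
  define p where "p = const_mat P" define q where "q = const_mat Q"
  have pq: "p \<in> carrier_mat n n" "q \<in> carrier_mat n n" using car Q by (auto simp: p_def q_def)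
  have pq1: "p * q = 1\<^sub>m n" "q * p = 1\<^sub>m n"
    using const_mat_mult[OF car(3) Q(1)] const_mat_mult[OF Q(1) car(3)] Q by (auto simp: p_def q_def const_mat_one)
  have t1: "p\<^sup>T * q\<^sup>T = 1\<^sub>m n" "q\<^sup>T * p\<^sup>T = 1\<^sub>m n"
    unfolding transpose_mult[OF pq(2,1), symmetric] transpose_mult[OF pq, symmetric] pq1 by (rule transpose_one)+
  have pen: "p\<^sup>T * D * p = ent_mat pencil_ent ps"
    using pencil_congruence[OF car(3,1,2)] PA PB by (simp add: pencil_ent_mat D_def p_def)
  have DH: "p\<^sup>T * D * p * H = ?m \<cdot>\<^sub>m 1\<^sub>m n"
    unfolding pen H_def using ent_mat_resolvent[OF R e] N by simp
  define G where "G = p * H * p\<^sup>T"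
  have G: "G \<in> carrier_mat n n" using pq H by (simp add: G_def)
  have "D * G = q\<^sup>T * (p\<^sup>T * D * p * H) * p\<^sup>T"
  proof -
    have "q\<^sup>T * (p\<^sup>T * D * p * H) * p\<^sup>T =
       (q\<^sup>T * p\<^sup>T) * (D * (p * H * p\<^sup>T))"
      using pq D H by (simp add: assoc_mult_mat[of _ n n _ n _ n])
    also have "\<dots> = D * G" using D G by (simp add: t1 G_def)
    finally show ?thesis ..
  qed
  also have "\<dots> = ?m \<cdot>\<^sub>m 1\<^sub>m n"
    unfolding DH using pq t1(2)
    by (simp add: mult_smult_distrib[of _ n n _ n] mult_smult_assoc_mat[of _ n n _ n])
  finally have DG: "D * G = ?m \<cdot>\<^sub>m 1\<^sub>m n" .
  have HG: "H = q * G * q\<^sup>T"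
  proof -
    have "q * G * q\<^sup>T = (q * p) * H * (p\<^sup>T * q\<^sup>T)"
      using pq H unfolding G_def by (simp add: assoc_mult_mat[of _ n n _ n _ n])
    also have "\<dots> = H" using H by (simp add: t1 pq1)
    finally show ?thesis ..
  qed
  have fR: "finite R" using R by simp
  have deg: "degree (G $$ (i, j)) \<le> sum e R" if ij: "i < n" "j < n" for i j
  proof -
    have dH: "degree (H $$ (k, l)) \<le> sum e R" if "k < n" "l < n" for k l
    proof -
      have "degree (- cofactor_ent R e \<mu> m j i) \<le> sum e R" if "(\<mu>, m) \<in> set ps" for \<mu> m i j
        using degree_cofactor_ent[OF fR, of \<mu>] that R by (metis degree_minus fst_conv image_eqI)
      from degree_ent_mat[where f = "\<lambda>\<mu> m i j. - cofactor_ent R e \<mu> m j i", OF this] show ?thesis using that by (simp add: H_def N)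
    qed
    have "degree ([:P $$ (i, k):] * H $$ (k, l) * [:P $$ (j, l):]) \<le> sum e R" if "k < n" "l < n" for k l
      using dH[OF that] degree_smult_le[of "P $$ (i, k)" "H $$ (k, l)"]
        degree_smult_le[of "P $$ (j, l)" "Polynomial.smult (P $$ (i, k)) (H $$ (k, l))"] by simp
    then show ?thesis
      unfolding G_def p_def eval_congruence[OF car(3) H ij] by (intro degree_sum_le) auto
  qed
  \<comment> \<open>The second conjunct treats nonvanishing as a special case:
    \<open>G(\<mu>) = 0\<close> is a decomposition with \<open>\<alpha> = 0\<close>, and it would
    force \<open>H(\<mu>) = 0\<close>.\<close>
  have dec: "\<exists>\<alpha>' \<beta>'. (\<forall>i<n. \<forall>j<n. poly (H $$ (i, j)) \<mu> = \<alpha>' i * \<beta>' j - \<alpha>' j * \<beta>' i) \<and> ((\<forall>i<n. \<alpha> i = 0) \<longrightarrow> (\<forall>i. \<alpha>' i = 0))"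
    if *: "\<And>i j. i < n \<Longrightarrow> j < n \<Longrightarrow> poly (G $$ (i, j)) \<mu> = \<alpha> i * \<beta> j - \<alpha> j * \<beta> i" for \<mu> and \<alpha> \<beta> :: "nat \<Rightarrow> complex"
  proof (intro exI conjI allI impI)
    let ?a = "\<lambda>i. \<Sum>k<n. Q $$ (i, k) * \<alpha> k" and ?b = "\<lambda>i. \<Sum>k<n. Q $$ (i, k) * \<beta> k"
    fix i j assume ij: "i < n" "j < n"
    have "poly (H $$ (i, j)) \<mu> = (\<Sum>l<n. \<Sum>k<n. Q $$ (i, k) * poly (G $$ (k, l)) \<mu> * Q $$ (j, l))"
      unfolding HG q_def eval_congruence[OF Q(1) G ij] by (simp add: poly_sum mult_ac)
    also have "\<dots> = (\<Sum>l<n. \<Sum>k<n. Q $$ (i, k) * \<alpha> k * (Q $$ (j, l) * \<beta> l) - Q $$ (j, l) * \<alpha> l * (Q $$ (i, k) * \<beta> k))"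
      by (intro sum.cong refl) (simp add: * algebra_simps)
    also have "\<dots> = ?a i * ?b j - ?a j * ?b i"
      by (simp add: sum_subtractf sum_product sum.swap[of "\<lambda>k l. Q $$ (i, k) * \<alpha> k * (Q $$ (j, l) * \<beta> l)"])
    finally show "poly (H $$ (i, j)) \<mu> = ?a i * ?b j - ?a j * ?b i" .
  qed auto
  show ?thesis
  proof (rule that[OF G DG[unfolded D_def] deg])
    fix \<mu> assume "\<exists>k<length ps. ps ! k = (\<mu>, e \<mu>)"
    then obtain k where k: "k < length ps" "ps ! k = (\<mu>, e \<mu>)" by blast
    show "\<exists>i<n. \<exists>j<n. poly (G $$ (i, j)) \<mu> \<noteq> 0"
    proof (rule ccontr)
      assume "\<not> ?thesis"
      then have "poly (G $$ (i, j)) \<mu> = (\<lambda>_. 0) i * (\<lambda>_. 0) j - (\<lambda>_. 0) j * (\<lambda>_. 0) i" if "i < n" "j < n" for i j using that by auto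
      from dec[OF this] obtain \<alpha>' \<beta>' where "\<forall>i<n. \<forall>j<n. poly (H $$ (i, j)) \<mu> = \<alpha>' i * \<beta>' j - \<alpha>' j * \<beta>' i" "\<forall>i. \<alpha>' i = 0"
        by blast
      then have z: "poly (H $$ (i, j)) \<mu> = 0" if "i < n" "j < n" for i j using that by simp
      show False using ent_mat_cofactor_root[where R = R and e = e, OF R e k] z unfolding H_def N by metis
    qed
  next
    fix \<mu> and \<alpha> \<beta> :: "nat \<Rightarrow> complex"
    assume "repeated ps (\<mu>, e \<mu>)"
    then obtain k1 k2 where k: "k1 < length ps" "k2 < length ps" "k1 \<noteq> k2" "ps ! k1 = (\<mu>, e \<mu>)" "ps ! k2 = (\<mu>, e \<mu>)" by blast
    show "\<not> (wedge_at n G \<mu> \<alpha> \<beta>)"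
    proof
      assume "wedge_at n G \<mu> \<alpha> \<beta>"
      then obtain \<alpha>' \<beta>' where "\<forall>i<n. \<forall>j<n. poly (H $$ (i, j)) \<mu> = \<alpha>' i * \<beta>' j - \<alpha>' j * \<beta>' i"
        using dec[of \<mu> \<alpha> \<beta>] by blast
      then show False using cofactor_not_decomposable[where R = R and e = e, OF R e k, of \<alpha>' \<beta>'] unfolding H_def N by blast
    qed
  qed
qed

section \<open>Perturbation of the resolvent\<close>

lemma convergent_coeff_of_pointwise:
  fixes f :: "nat \<Rightarrow> complex poly"
  assumes "\<And>k. degree (f k) \<le> d" "infinite S" "\<And>s. s \<in> S \<Longrightarrow> convergent (\<lambda>k. poly (f k) s)"
  shows "convergent (\<lambda>k. coeff (f k) i)"
  using assms
proof (induction d arbitrary: f S i)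
  case 0
  obtain s where s: "s \<in> S" using 0(2) by (metis ex_in_conv finite.emptyI)
  have "f k = [:coeff (f k) 0:]" for k using 0(1)[of k] by (simp add: degree_0_id)
  then have "poly (f k) s = coeff (f k) 0" for k by (metis poly_const_conv)
  then have "convergent (\<lambda>k. coeff (f k) 0)" using 0(3)[OF s] by simp
  moreover have "coeff (f k) i = 0" if "i > 0" for k using 0(1)[of k] that by (simp add: coeff_eq_0)
  ultimately show ?case by (cases "i = 0") (auto simp: convergent_const)
next
  case (Suc d)
  obtain s0 where s0: "s0 \<in> S" using Suc(3) by (metis ex_in_conv finite.emptyI)
  \<comment> \<open>Division by \<open>s - s0\<close> lowers the degree and keeps pointwise
    convergence away from \<open>s0\<close>, so the induction does the work of Lagrange
    interpolation.\<close>
  define g where "g = (\<lambda>k. synthetic_div (f k) s0)"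
  have f: "f k = [:poly (f k) s0:] + [:- s0, 1:] * g k" for k
    using synthetic_div_correct'[of s0 "f k"] by (simp add: g_def add.commute)
  have gc: "convergent (\<lambda>k. coeff (g k) i)" for i
  proof (rule Suc.IH)
    show "degree (g k) \<le> d" for k using Suc(2)[of k] by (simp add: g_def degree_synthetic_div)
    show "infinite (S - {s0})" using Suc(3) by simp
    fix s assume s: "s \<in> S - {s0}"
    have "poly (g k) s = (poly (f k) s - poly (f k) s0) * inverse (s - s0)" for k
    proof -
      have "poly (f k) s = poly (f k) s0 + (s - s0) * poly (g k) s"
        by (subst f) (simp add: algebra_simps)
      then show ?thesis using s by (simp add: field_simps)
    qed
    moreover have "convergent (\<lambda>k. (poly (f k) s - poly (f k) s0) * inverse (s - s0))"
      using s by (intro convergent_mult convergent_diff Suc(4) s0 convergent_const) auto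
    ultimately show "convergent (\<lambda>k. poly (g k) s)" by simp
  qed
  have "coeff (f k) i = (if i = 0 then poly (f k) s0 else coeff (g k) (i - 1)) + (- s0) * coeff (g k) i" for k
    by (subst f) (cases i; simp)
  moreover have "convergent (\<lambda>k. (if i = 0 then poly (f k) s0 else coeff (g k) (i - 1)) + (- s0) * coeff (g k) i)"
  proof (rule convergent_add)
    show "convergent (\<lambda>k. if i = 0 then poly (f k) s0 else coeff (g k) (i - 1))"
      using gc Suc(4)[OF s0] by (cases "i = 0") auto
  qed (intro convergent_mult convergent_const gc)
  ultimately show ?case by simp
qed

lemma coeff_limit_of_pointwise:
  fixes f :: "nat \<Rightarrow> complex poly"
  assumes "\<And>k. degree (f k) \<le> d" "infinite S" "\<And>s. s \<in> S \<Longrightarrow> convergent (\<lambda>k. poly (f k) s)"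
  obtains p where "degree p \<le> d" "\<And>i. (\<lambda>k. coeff (f k) i) \<longlonglongrightarrow> coeff p i"
proof -
  obtain c where c: "\<And>i. (\<lambda>k. coeff (f k) i) \<longlonglongrightarrow> c i"
    using convergent_coeff_of_pointwise[OF assms] unfolding convergent_def by metis
  define p where "p = (\<Sum>i\<le>d. monom (c i) i)"
  have "c i = 0" if "i > d" for i
  proof -
    have "coeff (f k) i = 0" for k using assms(1)[of k] that by (simp add: coeff_eq_0)
    then show ?thesis using c[of i] by (simp add: LIMSEQ_const_iff)
  qed
  then have "coeff p i = c i" for i by (auto simp: p_def coeff_sum not_le)
  moreover from this have "degree p \<le> d" using \<open>\<And>i. i > d \<Longrightarrow> c i = 0\<close> by (intro degree_le) auto
  ultimately show ?thesis using that c by metis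
qed

lemma poly_eq_sum_atMost:
  fixes p :: "complex poly"
  assumes "degree p \<le> d"
  shows "poly p s = (\<Sum>i\<le>d. coeff p i * s ^ i)"
  unfolding poly_altdef by (rule sum.mono_neutral_left) (use assms in \<open>auto simp: not_le coeff_eq_0\<close>)

lemma tendsto_poly_of_coeff:
  fixes f :: "nat \<Rightarrow> complex poly"
  assumes "\<And>k. degree (f k) \<le> d" "degree p \<le> d" "\<And>i. (\<lambda>k. coeff (f k) i) \<longlonglongrightarrow> coeff p i"
  shows "(\<lambda>k. poly (f k) s) \<longlonglongrightarrow> poly p s"
  unfolding poly_eq_sum_atMost[OF assms(1)] poly_eq_sum_atMost[OF assms(2)]
  by (intro tendsto_intros assms(3))

lemma tendsto_coeff_of_poly:
  fixes f :: "nat \<Rightarrow> complex poly"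
  assumes "\<And>k. degree (f k) \<le> d" "degree p \<le> d" "infinite S"
    "\<And>s. s \<in> S \<Longrightarrow> (\<lambda>k. poly (f k) s) \<longlonglongrightarrow> poly p s"
  shows "(\<lambda>k. coeff (f k) i) \<longlonglongrightarrow> coeff p i"
proof -
  have conv: "convergent (\<lambda>k. poly (f k) s)" if "s \<in> S" for s
    using assms(4)[OF that] by (auto simp: convergent_def)
  obtain q where q: "degree q \<le> d" "\<And>i. (\<lambda>k. coeff (f k) i) \<longlonglongrightarrow> coeff q i"
    by (rule coeff_limit_of_pointwise[OF assms(1,3) conv]) blast+
  have "poly (p - q) s = 0" if "s \<in> S" for s
    using LIMSEQ_unique[OF assms(4)[OF that] tendsto_poly_of_coeff[OF assms(1) q]] by simp
  then have "S \<subseteq> {s. poly (p - q) s = 0}" by auto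
  then have "p - q = 0" using assms(3) poly_roots_finite finite_subset by blast
  then show ?thesis using q by simp
qed

text \<open>Below order \<open>n\<close> the equation determines \<open>m\<^sub>k / t\<^sub>k\<close> recursively, so these coefficients converge. Since
  \<open>m\<^sub>k\<close> has an \<open>n\<close>-fold root at \<open>\<delta>\<^sub>k\<close>, this forces \<open>\<delta>\<^sub>k / t\<^sub>k\<close> to converge, and then only the coefficient of
  order \<open>n - 1\<close> survives.\<close>

lemma moving_root_limit:
  fixes q :: "nat \<Rightarrow> complex poly" and W :: "nat \<Rightarrow> 'i \<Rightarrow> complex poly"
  assumes \<delta>: "\<delta> \<longlonglongrightarrow> 0" and t: "\<And>k. t k \<noteq> (0 :: complex)" and n: "n > 0"
    and q: "\<And>i. (\<lambda>k. coeff (q k) i) \<longlonglongrightarrow> coeff q0 i" "coeff q0 0 \<noteq> 0"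
    and m: "\<And>k. m k = [:- \<delta> k, 1:] ^ n * q k"
    and G: "i0 \<in> I" "coeff (G i0) 0 \<noteq> 0"
    and eq: "\<And>k i l. i \<in> I \<Longrightarrow> l < n \<Longrightarrow> coeff (m k * G i) l + t k * coeff (W k i) l = 0"
    and W: "\<And>i l. i \<in> I \<Longrightarrow> (\<lambda>k. coeff (W k i) l) \<longlonglongrightarrow> coeff (w i) l"
  obtains \<kappa> where "\<And>i. i \<in> I \<Longrightarrow> coeff (w i) (n - 1) = \<kappa> * coeff (G i) 0"
proof -
  \<comment> \<open>Every coefficient of \<open>(s - \<delta> k)^n\<close> of order below
    \<open>n\<close> contains a factor \<open>\<delta> k\<close>; \<open>z k l\<close> is the
    coefficient of \<open>m k\<close> of order \<open>l\<close> with one such factor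
    removed.\<close>
  define z where "z = (\<lambda>k l. \<Sum>a\<le>l. - of_nat (n choose a) * (- \<delta> k) ^ (n - a - 1) * coeff (q k) (l - a))"
  have mz: "coeff (m k) l = \<delta> k * z k l" if "l < n" for k l
  proof -
    have "(- \<delta> k) ^ (n - a) = - \<delta> k * (- \<delta> k) ^ (n - a - 1)" if "a \<le> l" for a
    proof -
      have "n - a = Suc (n - a - 1)" using that \<open>l < n\<close> by arith
      then show ?thesis by (metis power_Suc)
    qed
    then show ?thesis
      unfolding m coeff_mult z_def sum_distrib_left
      by (intro sum.cong refl) (use \<open>l < n\<close> in \<open>auto simp: coeff_linear_poly_power\<close>)
  qed
  have zlim: "(\<lambda>k. z k l) \<longlonglongrightarrow> (if l = n - 1 then - of_nat n * coeff q0 0 else 0)" if "l < n" for l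
  proof -
    have "(\<lambda>k. z k l) \<longlonglongrightarrow> (\<Sum>a\<le>l. - of_nat (n choose a) * (- 0) ^ (n - a - 1) * coeff q0 (l - a))"
      unfolding z_def by (intro tendsto_intros \<delta> q)
    \<comment> \<open>All powers of 0 vanish except at \<open>a = n - 1\<close>, which is reached
      only for \<open>l = n - 1\<close>.\<close>
    also have "(\<Sum>a\<le>l. - of_nat (n choose a) * (- 0) ^ (n - a - 1) * coeff q0 (l - a)) =
        (\<Sum>a\<le>l. if a = n - 1 then - of_nat n * coeff q0 0 else 0)"
    proof (intro sum.cong refl)
      fix a assume a: "a \<in> {..l}"
      show "- of_nat (n choose a) * (- 0) ^ (n - a - 1) * coeff q0 (l - a) = (if a = n - 1 then - of_nat n * coeff q0 0 else 0)"
      proof (cases "a = n - 1")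
        case True
        then have "l = a" "n choose a = n" using a that n binomial_symmetric[of "n - 1" n] by auto
        then show ?thesis using True by simp
      next
        case False
        then have "n - a - 1 > 0" using a that by auto
        then show ?thesis using False by (simp add: zero_power)
      qed
    qed
    also have "\<dots> = (if l = n - 1 then - of_nat n * coeff q0 0 else 0)"
      using that by auto
    finally show ?thesis .
  qed
  have split: "coeff (m k * G i) l / t k = (\<Sum>a\<le>l. coeff (m k) a / t k * coeff (G i) (l - a))" for k i l
    by (simp add: coeff_mult sum_divide_distrib)
  have eq': "(\<Sum>a\<le>l. coeff (m k) a / t k * coeff (G i) (l - a)) = - coeff (W k i) l" if "i \<in> I" "l < n" for k i l
    using eq[OF that, of k] t[of k] unfolding split[symmetric] by (simp add: field_simps add_eq_0_iff)
  have conv: "convergent (\<lambda>k. coeff (m k) l / t k)" if "l < n" for l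
    using that
  proof (induction l rule: less_induct)
    case (less l)
    have "coeff (m k) l / t k = (- coeff (W k i0) l - (\<Sum>a<l. coeff (m k) a / t k * coeff (G i0) (l - a))) * inverse (coeff (G i0) 0)" for k
      using eq'[OF G(1) less.prems, of k] G(2) unfolding lessThan_Suc_atMost[symmetric] sum.lessThan_Suc
      by (simp add: field_simps)
    moreover have "convergent (\<lambda>k. \<Sum>a<l. coeff (m k) a / t k * coeff (G i0) (l - a))"
      using less by (intro convergent_sum convergent_mult convergent_const) auto
    moreover have "convergent (\<lambda>k. - coeff (W k i0) l)"
      using W[OF G(1), of l] by (intro convergent_minus_iff[THEN iffD1]) (auto simp: convergent_def)
    ultimately show ?case
      by (simp only:) (intro convergent_mult convergent_diff convergent_const; assumption)
  qed
  have z0: "- of_nat n * coeff q0 0 \<noteq> 0" using n q by simp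
  have z1: "(\<lambda>k. z k (n - 1)) \<longlonglongrightarrow> - of_nat n * coeff q0 0" using zlim[of "n - 1"] n by simp
  obtain L where L: "(\<lambda>k. coeff (m k) (n - 1) / t k) \<longlonglongrightarrow> L" using conv[of "n - 1"] n by (auto simp: convergent_def)
  \<comment> \<open>By \<open>mz\<close> this quotient equals \<open>\<delta> k / t k\<close>
    wherever \<open>z k (n - 1)\<close> is nonzero, hence eventually.\<close>
  have "(\<lambda>k. (coeff (m k) (n - 1) / t k) / z k (n - 1)) \<longlonglongrightarrow> L / (- of_nat n * coeff q0 0)"
    by (rule tendsto_divide[OF L z1 z0])
  moreover have "\<forall>\<^sub>F k in sequentially. (coeff (m k) (n - 1) / t k) / z k (n - 1) = \<delta> k / t k"
    using tendsto_imp_eventually_ne[OF z1 z0] by eventually_elim (use mz[of "n - 1"] n in simp)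
  ultimately have dt: "(\<lambda>k. \<delta> k / t k) \<longlonglongrightarrow> L / (- of_nat n * coeff q0 0)"
    by (rule Lim_transform_eventually)
  have mt: "(\<lambda>k. coeff (m k) l / t k) \<longlonglongrightarrow> (if l = n - 1 then L else 0)" if "l < n" for l
  proof -
    have "(\<lambda>k. \<delta> k / t k * z k l) \<longlonglongrightarrow> L / (- of_nat n * coeff q0 0) * (if l = n - 1 then - of_nat n * coeff q0 0 else 0)"
      by (intro tendsto_mult dt zlim that)
    moreover have "(\<lambda>k. coeff (m k) l / t k) = (\<lambda>k. \<delta> k / t k * z k l)" by (simp add: mz[OF that])
    moreover have "L / (- of_nat n * coeff q0 0) * (if l = n - 1 then - of_nat n * coeff q0 0 else 0) = (if l = n - 1 then L else 0)"
      using z0 by simp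
    ultimately show ?thesis by (simp only:)
  qed
  have "coeff (w i) (n - 1) = - L * coeff (G i) 0" if i: "i \<in> I" for i
  proof -
    have "(\<lambda>k. \<Sum>a\<le>n - 1. coeff (m k) a / t k * coeff (G i) (n - 1 - a)) \<longlonglongrightarrow> (\<Sum>a\<le>n - 1. (if a = n - 1 then L else 0) * coeff (G i) (n - 1 - a))"
      using n by (intro tendsto_sum tendsto_mult mt tendsto_const) auto
    moreover have "(\<Sum>a\<le>n - 1. (if a = n - 1 then L else 0) * coeff (G i) (n - 1 - a)) = L * coeff (G i) 0"
      by (simp add: if_distrib[of "\<lambda>x. x * _"] cong: if_cong)
    moreover have "(\<lambda>k. - coeff (W k i) (n - 1)) \<longlonglongrightarrow> - coeff (w i) (n - 1)" by (intro tendsto_minus W i)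
    moreover have "(\<Sum>a\<le>n - 1. coeff (m k) a / t k * coeff (G i) (n - 1 - a)) = - coeff (W k i) (n - 1)" for k
      using eq'[OF i, of "n - 1" k] n by simp
    ultimately have "L * coeff (G i) 0 = - coeff (w i) (n - 1)" using LIMSEQ_unique by simp
    then show ?thesis by (simp add: minus_equation_iff)
  qed
  then show ?thesis using that by blast
qed

section \<open>The resolvent identity and bounds for the eigenvalues\<close>

lemma resolvent_left:
  fixes A B :: "complex mat"
  assumes car: "A \<in> carrier_mat n n" "B \<in> carrier_mat n n" "G \<in> carrier_mat n n"
    and skew: "A\<^sup>T = - A" "B\<^sup>T = - B"
    and DG: "pencil A B * G = m \<cdot>\<^sub>m 1\<^sub>m n" and m: "m \<noteq> 0"
  shows "G * pencil A B = m \<cdot>\<^sub>m 1\<^sub>m n" "G\<^sup>T = - G"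
proof -
  define D where "D = pencil A B"
  have D: "D \<in> carrier_mat n n" using car by (auto simp: D_def pencil_def)
  have entA: "A $$ (j, i) = - A $$ (i, j)" if "i < n" "j < n" for i j
    using arg_cong[OF skew(1), of "\<lambda>X. X $$ (i, j)"] that car by simp
  have entB: "B $$ (j, i) = - B $$ (i, j)" if "i < n" "j < n" for i j
    using arg_cong[OF skew(2), of "\<lambda>X. X $$ (i, j)"] that car by simp
  have DT: "D\<^sup>T = - D"
  proof (rule eq_matI)
    fix i j assume "i < dim_row (- D)" "j < dim_col (- D)"
    then have ij: "i < n" "j < n" using D by auto
    show "D\<^sup>T $$ (i, j) = (- D) $$ (i, j)"
      using ij car D entA[OF ij] entB[OF ij] by (simp add: D_def pencil_def)
  qed (use D in auto)
  \<comment> \<open>Transposing \<open>D G = m\<close> with \<open>D\<close> skew shows that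
    \<open>- G^T\<close> is a left inverse up to \<open>m\<close>. It must agree with the right
    inverse \<open>G\<close> after cancelling \<open>m\<close>.\<close>
  define L where "L = - G\<^sup>T"
  have L: "L \<in> carrier_mat n n" using car by (simp add: L_def)
  have "L * D = G\<^sup>T * D\<^sup>T"
    using D car unfolding L_def DT by simp
  also have "\<dots> = transpose_mat (D * G)" using transpose_mult[OF D car(3)] by simp
  also have "\<dots> = m \<cdot>\<^sub>m 1\<^sub>m n" unfolding DG[folded D_def] by (intro eq_matI) auto
  finally have LD: "L * D = m \<cdot>\<^sub>m 1\<^sub>m n" .
  have "(L * D) * G = L * (D * G)" using L D car by simp
  then have "m \<cdot>\<^sub>m G = m \<cdot>\<^sub>m L"
    unfolding LD DG[folded D_def] using L car
    by (simp add: mult_smult_distrib[of _ n n _ n] mult_smult_assoc_mat[of _ n n _ n])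
  then have "m * G $$ (i, j) = m * L $$ (i, j)" if "i < n" "j < n" for i j
    using that L car by (metis carrier_matD index_smult_mat(1))
  then have GL: "G = L" using m L car by (intro eq_matI) auto
  show "G * pencil A B = m \<cdot>\<^sub>m 1\<^sub>m n" using LD GL D_def by simp
  show "G\<^sup>T = - G" using GL car by (metis L_def uminus_uminus_mat)
qed

text \<open>Entries of \<open>G V H\<close>. With \<open>H = G\<close> this is \<open>m^2\<close>
  times the derivative of \<open>(s B - A)^-1\<close> when \<open>A\<close> moves in the direction
  \<open>V\<close>.\<close>

definition sandwich :: "nat \<Rightarrow> complex poly mat \<Rightarrow> complex mat \<Rightarrow> complex poly mat \<Rightarrow> nat \<Rightarrow> nat \<Rightarrow> complex poly" where
  "sandwich n G V H i j = (\<Sum>q<n. (\<Sum>p<n. G $$ (i, p) * [:V $$ (p, q):]) * H $$ (q, j))"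

lemma sandwich_mat:
  assumes "G \<in> carrier_mat n n" "V \<in> carrier_mat n n" "H \<in> carrier_mat n n" "i < n" "j < n"
  shows "(G * const_mat V * H) $$ (i, j) = sandwich n G V H i j"
  using assms by (simp add: scalar_prod_def atLeast0LessThan sandwich_def del: assoc_mult_mat mult_pCons_right)

text \<open>The resolvent identity \<open>D'^-1 - D^-1 = t D^-1 V D'^-1\<close> for
  \<open>D' = D - t V\<close>, cleared of denominators: \<open>G D' H\<close> is expanded in two
  ways.\<close>

lemma resolvent_diff:
  fixes A B V :: "complex mat"
  assumes car: "A \<in> carrier_mat n n" "B \<in> carrier_mat n n" "V \<in> carrier_mat n n" "G \<in> carrier_mat n n" "H \<in> carrier_mat n n"
    and G: "G * pencil A B = m \<cdot>\<^sub>m 1\<^sub>m n" and H: "pencil (A + t \<cdot>\<^sub>m V) B * H = m' \<cdot>\<^sub>m 1\<^sub>m n"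
    and ij: "i < n" "j < n"
  shows "m * H $$ (i, j) - m' * G $$ (i, j) = [:t:] * sandwich n G V H i j"
proof -
  define D where "D = pencil A B"
  define W where "W = const_mat V"
  have D: "D \<in> carrier_mat n n" "W \<in> carrier_mat n n" using car by (auto simp: D_def pencil_def W_def)
  have D': "pencil (A + t \<cdot>\<^sub>m V) B = D - [:t:] \<cdot>\<^sub>m W"
    using car by (intro eq_matI) (auto simp: D_def pencil_def W_def)
  have tW: "[:t:] \<cdot>\<^sub>m W \<in> carrier_mat n n" using D by simp
  have "G * ((D - [:t:] \<cdot>\<^sub>m W) * H) = G * (D * H - [:t:] \<cdot>\<^sub>m W * H)"
    using D tW car by (simp add: minus_mult_distrib_mat[where nr=n and n=n and nc=n])
  also have "\<dots> = G * (D * H) - G * ([:t:] \<cdot>\<^sub>m W * H)"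
    using D tW car by (intro mult_minus_distrib_mat) auto
  also have "G * (D * H) = m \<cdot>\<^sub>m H"
  proof -
    have "G * (D * H) = (m \<cdot>\<^sub>m 1\<^sub>m n) * H" using assoc_mult_mat[OF car(4) D(1) car(5)] G by (simp add: D_def)
    also have "\<dots> = m \<cdot>\<^sub>m H" using car mult_smult_assoc_mat[of "1\<^sub>m n" n n H n m] by simp
    finally show ?thesis .
  qed
  also have "G * ([:t:] \<cdot>\<^sub>m W * H) = [:t:] \<cdot>\<^sub>m (G * W * H)"
    using D car by (simp add: mult_smult_distrib[of _ n n _ n] mult_smult_assoc_mat[of _ n n _ n])
  also have "(D - [:t:] \<cdot>\<^sub>m W) * H = m' \<cdot>\<^sub>m 1\<^sub>m n" using H D' by simp
  also have "G * (m' \<cdot>\<^sub>m 1\<^sub>m n) = m' \<cdot>\<^sub>m G"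
    using car by (simp add: mult_smult_distrib[of _ n n _ n])
  finally have eq: "m' \<cdot>\<^sub>m G = m \<cdot>\<^sub>m H - [:t:] \<cdot>\<^sub>m (G * W * H)" .
  have "m' * G $$ (i, j) = m * H $$ (i, j) - [:t:] * (G * W * H) $$ (i, j)"
    using arg_cong[OF eq, of "\<lambda>X. X $$ (i, j)"] ij car D by (simp del: assoc_mult_mat mult_pCons_left)
  then show ?thesis using sandwich_mat[OF car(4,3,5) ij] by (simp add: W_def)
qed

text \<open>The last conjunct says that numerator and denominator are in lowest terms at every root,
  so that \<open>e \<mu>\<close> is the exact pole order of the inverse pencil. The degree bound
  allows limits to be taken coefficientwise.\<close>

definition is_resolvent :: "nat \<Rightarrow> complex mat \<Rightarrow> complex mat \<Rightarrow> complex set \<Rightarrow> (complex \<Rightarrow> nat) \<Rightarrow> complex poly mat \<Rightarrow> bool" where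
  "is_resolvent n A B R e G \<longleftrightarrow> finite R \<and> G \<in> carrier_mat n n \<and> pencil A B * G = root_poly R e \<cdot>\<^sub>m 1\<^sub>m n \<and>
     (\<forall>i<n. \<forall>j<n. degree (G $$ (i, j)) \<le> sum e R) \<and>
     (\<forall>\<mu>\<in>R. 0 < e \<mu> \<and> (\<exists>i<n. \<exists>j<n. poly (G $$ (i, j)) \<mu> \<noteq> 0))"

lemma poly_root_poly: "poly (root_poly R e) s = (\<Prod>\<mu>\<in>R. (s - \<mu>) ^ e \<mu>)"
  by (simp add: root_poly_def poly_prod)

text \<open>A nonzero column of \<open>G(\<mu>)\<close> is an eigenvector of \<open>B^-1 A\<close>;
  its coordinate of largest modulus gives the estimate. The bound depends only on \<open>C\<close>
  and \<open>a\<close>, hence is uniform along a sequence of perturbations.\<close>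

lemma resolvent_root_bound:
  fixes A B :: "complex mat"
  assumes car: "A \<in> carrier_mat n n" "B \<in> carrier_mat n n" "C \<in> carrier_mat n n" and CB: "C * B = 1\<^sub>m n"
    and res: "is_resolvent n A B R e G" and \<mu>: "\<mu> \<in> R"
    and a: "\<And>i j. i < n \<Longrightarrow> j < n \<Longrightarrow> cmod (A $$ (i, j)) \<le> a i j"
  shows "cmod \<mu> \<le> (\<Sum>p<n. \<Sum>i<n. cmod (C $$ (p, i)) * (\<Sum>q<n. a i q))"
proof -
  obtain i0 j where ij: "i0 < n" "j < n" "poly (G $$ (i0, j)) \<mu> \<noteq> 0" and e: "0 < e \<mu>" and fin: "finite R"
    and G: "G \<in> carrier_mat n n" and DG: "pencil A B * G = root_poly R e \<cdot>\<^sub>m 1\<^sub>m n"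
    using res \<mu> unfolding is_resolvent_def by blast
  have root: "poly (root_poly R e) \<mu> = 0" using fin \<mu> e by (auto simp: poly_root_poly prod_zero_iff)
  define v where "v = vec n (\<lambda>i. poly (G $$ (i, j)) \<mu>)"
  have v: "v \<in> carrier_vec n" by (simp add: v_def)
  have "B *\<^sub>v (\<mu> \<cdot>\<^sub>v v) = A *\<^sub>v v"
  proof (rule eq_vecI)
    fix i assume "i < dim_vec (A *\<^sub>v v)"
    then have i: "i < n" using car by simp
    have "poly ((pencil A B * G) $$ (i, j)) \<mu> = 0" unfolding DG using i ij root by simp
    moreover have "(pencil A B * G) $$ (i, j) = (\<Sum>q<n. ([:0, 1:] * [:B $$ (i, q):] - [:A $$ (i, q):]) * G $$ (q, j))"
      using i ij car G by (simp add: pencil_def scalar_prod_def atLeast0LessThan del: mult_pCons_left)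
    ultimately have "poly (\<Sum>q<n. ([:0, 1:] * [:B $$ (i, q):] - [:A $$ (i, q):]) * G $$ (q, j)) \<mu> = 0"
      by (simp only:)
    then have "(\<Sum>q<n. (\<mu> * B $$ (i, q) - A $$ (i, q)) * poly (G $$ (q, j)) \<mu>) = 0"
      by (simp add: poly_sum algebra_simps)
    then show "(B *\<^sub>v (\<mu> \<cdot>\<^sub>v v)) $ i = (A *\<^sub>v v) $ i"
      using i car by (simp add: scalar_prod_def atLeast0LessThan v_def sum_subtractf algebra_simps)
  qed (use car in simp)
  then have "C *\<^sub>v (B *\<^sub>v (\<mu> \<cdot>\<^sub>v v)) = C *\<^sub>v (A *\<^sub>v v)" by simp
  then have eq: "\<mu> \<cdot>\<^sub>v v = C *\<^sub>v (A *\<^sub>v v)"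
    using assoc_mult_mat_vec[OF car(3,2), of "\<mu> \<cdot>\<^sub>v v"] v CB by simp
  obtain p where p: "p < n" "\<And>i. i < n \<Longrightarrow> cmod (v $ i) \<le> cmod (v $ p)"
  proof -
    have "finite ((\<lambda>i. cmod (v $ i)) ` {..<n})" "(\<lambda>i. cmod (v $ i)) ` {..<n} \<noteq> {}" using ij by auto
    from Max_in[OF this] Max_ge[OF this(1)] that show ?thesis by fastforce
  qed
  have "v $ i0 \<noteq> 0" using ij by (simp add: v_def)
  then have vp: "cmod (v $ p) > 0" using p(2)[OF ij(1)] by (metis norm_le_zero_iff not_le order.trans)
  have "\<mu> * v $ p = (\<Sum>i<n. C $$ (p, i) * (\<Sum>q<n. A $$ (i, q) * v $ q))"
    using arg_cong[OF eq, of "\<lambda>w. w $ p"] p car v by (simp add: scalar_prod_def atLeast0LessThan)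
  then have "cmod \<mu> * cmod (v $ p) = cmod (\<Sum>i<n. C $$ (p, i) * (\<Sum>q<n. A $$ (i, q) * v $ q))"
    by (metis norm_mult)
  also have "\<dots> \<le> (\<Sum>i<n. cmod (C $$ (p, i)) * (\<Sum>q<n. a i q * cmod (v $ p)))"
    by (intro sum_norm_le order.trans[OF norm_mult_ineq] mult_left_mono mult_mono a p order.trans[OF norm_ge_zero a]) auto
  also have "\<dots> = (\<Sum>i<n. cmod (C $$ (p, i)) * (\<Sum>q<n. a i q)) * cmod (v $ p)"
    by (simp add: sum_distrib_left sum_distrib_right mult_ac)
  finally have "cmod \<mu> \<le> (\<Sum>i<n. cmod (C $$ (p, i)) * (\<Sum>q<n. a i q))" using vp by simp
  also have "\<dots> \<le> (\<Sum>p<n. \<Sum>i<n. cmod (C $$ (p, i)) * (\<Sum>q<n. a i q))"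
    using p by (intro member_le_sum[where f = "\<lambda>p. \<Sum>i<n. cmod (C $$ (p, i)) * (\<Sum>q<n. a i q)"] sum_nonneg mult_nonneg_nonneg)
      (auto intro: order.trans[OF norm_ge_zero a])
  finally show ?thesis .
qed

section \<open>Convergence of the roots along a subsequence\<close>

lemma order_prod_linear:
  "finite I \<Longrightarrow> order \<mu> (\<Prod>i\<in>I. [:- \<rho> i, 1:] ^ \<epsilon> i) = (\<Sum>i\<in>I. if \<rho> i = \<mu> then \<epsilon> i else 0)" for \<mu> :: complex
proof (induction I rule: finite_induct)
  case (insert x I)
  have nz: "(\<Prod>i\<in>I. [:- \<rho> i, 1:] ^ \<epsilon> i) \<noteq> 0" using insert by (simp add: prod_zero_iff)
  have "order \<mu> ([:- \<rho> x, 1:] ^ \<epsilon> x) = (if \<rho> x = \<mu> then \<epsilon> x else 0)"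
    by (auto simp: order_power_n_n intro!: order_0I)
  then show ?case using insert nz by (simp add: order_mult)
qed (simp add: order_0I)

lemma Bseq_complex_subseq:
  fixes x :: "nat \<Rightarrow> complex"
  assumes "\<And>k. cmod (x k) \<le> M"
  obtains \<phi> where "strict_mono (\<phi> :: nat \<Rightarrow> nat)" "convergent (\<lambda>k. x (\<phi> k))"
proof -
  obtain f where "strict_mono f \<and> monoseq (\<lambda>k. Re (x (f k)))" using seq_monosub[of "\<lambda>k. Re (x k)"] ..
  then have f: "strict_mono f" "monoseq (\<lambda>k. Re (x (f k)))" by simp_all
  obtain g where "strict_mono g \<and> monoseq (\<lambda>k. Im (x (f (g k))))" using seq_monosub[of "\<lambda>k. Im (x (f k))"] ..
  then have g: "strict_mono g" "monoseq (\<lambda>k. Im (x (f (g k))))" by simp_all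
  have "Bseq (\<lambda>k. Re (x (f k)))" using assms by (intro BseqI'[of _ M]) (metis abs_Re_le_cmod order.trans real_norm_def)
  then have "convergent (\<lambda>k. Re (x (f k)))" using f(2) by (rule Bseq_monoseq_convergent)
  from convergent_subseq_convergent[OF this g(1)] have "convergent (\<lambda>k. Re (x (f (g k))))" by (simp add: o_def)
  moreover have "Bseq (\<lambda>k. Im (x (f (g k))))" using assms by (intro BseqI'[of _ M]) (metis abs_Im_le_cmod order.trans real_norm_def)
  then have "convergent (\<lambda>k. Im (x (f (g k))))" using g(2) by (rule Bseq_monoseq_convergent)
  ultimately obtain a b where "(\<lambda>k. Re (x (f (g k)))) \<longlonglongrightarrow> a" "(\<lambda>k. Im (x (f (g k)))) \<longlonglongrightarrow> b"
    unfolding convergent_def by blast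
  then have "(\<lambda>k. x (f (g k))) \<longlonglongrightarrow> Complex a b" unfolding tendsto_complex_iff by simp
  then have "convergent (\<lambda>k. x (f (g k)))" by (rule convergentI)
  moreover have "strict_mono (f \<circ> g)" using f g by (simp add: strict_mono_o)
  ultimately show ?thesis using that[of "f \<circ> g"] by simp
qed

lemma bounded_family_subseq:
  fixes x :: "nat \<Rightarrow> nat \<Rightarrow> complex"
  assumes "\<And>k i. i < p \<Longrightarrow> cmod (x k i) \<le> M"
  shows "\<exists>\<phi>. strict_mono (\<phi> :: nat \<Rightarrow> nat) \<and> (\<forall>i<p. convergent (\<lambda>k. x (\<phi> k) i))"
  using assms
proof (induction p)
  case 0 then show ?case by (auto intro!: exI[of _ id] simp: strict_mono_def)
next
  case (Suc p)
  then obtain \<phi> where \<phi>: "strict_mono \<phi>" "\<forall>i<p. convergent (\<lambda>k. x (\<phi> k) i)" by (metis less_Suc_eq)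
  obtain \<psi> where \<psi>: "strict_mono \<psi>" "convergent (\<lambda>k. x (\<phi> (\<psi> k)) p)"
    using Bseq_complex_subseq[of "\<lambda>k. x (\<phi> k) p" M] Suc.prems by blast
  have "convergent (\<lambda>k. x (\<phi> (\<psi> k)) i)" if "i < p" for i
    using convergent_subseq_convergent[OF _ \<psi>(1), of "\<lambda>k. x (\<phi> k) i"] \<phi>(2) that by (simp add: o_def)
  then have "\<forall>i<Suc p. convergent (\<lambda>k. x (\<phi> (\<psi> k)) i)" using \<psi>(2) by (auto simp: less_Suc_eq)
  moreover have "strict_mono (\<lambda>k. \<phi> (\<psi> k))" using \<phi> \<psi> by (simp add: strict_mono_def)
  ultimately show ?case by blast
qed

text \<open>After numbering each \<open>R k\<close> by \<open>{..<p}\<close>, the exponents form a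
  function into \<open>{..d}\<close>. There are finitely many of these, so the pigeonhole principle
  makes them constant along a subsequence; the bounded roots then converge along a further
  one.\<close>

lemma root_data_subseq:
  fixes R :: "nat \<Rightarrow> complex set" and e :: "nat \<Rightarrow> complex \<Rightarrow> nat"
  assumes fin: "\<And>k. finite (R k)" and card: "\<And>k. card (R k) = p" and sum: "\<And>k. sum (e k) (R k) = d"
    and M: "\<And>k \<mu>. \<mu> \<in> R k \<Longrightarrow> cmod \<mu> \<le> M"
  obtains \<phi> r \<epsilon> \<rho> where "strict_mono (\<phi> :: nat \<Rightarrow> nat)" "\<And>k. root_poly (R (\<phi> k)) (e (\<phi> k)) = (\<Prod>i<p. [:- r k i, 1:] ^ \<epsilon> i)"
    "sum \<epsilon> {..<p} = d" "\<And>i. i < p \<Longrightarrow> (\<lambda>k. r k i) \<longlonglongrightarrow> \<rho> i"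
proof -
  have "\<forall>k. \<exists>h. bij_betw h {..<p} (R k)"
    using ex_bij_betw_nat_finite[OF fin] card by (metis atLeast0LessThan)
  then obtain h where h: "\<And>k. bij_betw (h k) {..<p} (R k)" by metis
  have hR: "h k i \<in> R k" if "i < p" for k i using h[of k] that by (auto simp: bij_betw_def)
  define F where "F = (\<lambda>k. restrict (\<lambda>i. e k (h k i)) {..<p})"
  have "e k \<mu> \<le> d" if "\<mu> \<in> R k" for k \<mu>
    using member_le_sum[OF that, of "e k"] fin sum by auto
  then have "range F \<subseteq> PiE {..<p} (\<lambda>_. {..d})" unfolding F_def using hR by (intro image_subsetI restrict_PiE_iff[THEN iffD2]) auto
  then have "finite (range F)" by (rule finite_subset) (simp add: finite_PiE)
  then obtain k0 where "infinite {k. F k = F k0}" using pigeonhole_infinite[of UNIV F] by auto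
  then obtain \<theta> where \<theta>: "strict_mono (\<theta> :: nat \<Rightarrow> nat)" "\<And>k. F (\<theta> k) = F k0" using infinite_enumerate by blast
  obtain \<psi> where \<psi>: "strict_mono (\<psi> :: nat \<Rightarrow> nat)" "\<forall>i<p. convergent (\<lambda>k. h (\<theta> (\<psi> k)) i)"
    using bounded_family_subseq[of p "\<lambda>k i. h (\<theta> k) i" M] M hR by blast
  define \<epsilon> where "\<epsilon> = (\<lambda>i. e k0 (h k0 i))"
  have \<epsilon>: "e (\<theta> k) (h (\<theta> k) i) = \<epsilon> i" if "i < p" for k i
    using \<theta>(2)[of k] that by (auto simp: F_def \<epsilon>_def dest!: fun_cong[of _ _ i])
  show ?thesis
  proof (rule that[of "\<theta> \<circ> \<psi>" "\<lambda>k. h (\<theta> (\<psi> k))" \<epsilon> "\<lambda>i. lim (\<lambda>k. h (\<theta> (\<psi> k)) i)"])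
    show "strict_mono (\<theta> \<circ> \<psi>)" using \<theta> \<psi> by (simp add: strict_mono_o)
    show "root_poly (R ((\<theta> \<circ> \<psi>) k)) (e ((\<theta> \<circ> \<psi>) k)) = (\<Prod>i<p. [:- h (\<theta> (\<psi> k)) i, 1:] ^ \<epsilon> i)" for k
      unfolding root_poly_def o_def
      unfolding prod.reindex_bij_betw[OF h[of "\<theta> (\<psi> k)"], of "\<lambda>\<mu>. [:- \<mu>, 1:] ^ e (\<theta> (\<psi> k)) \<mu>", symmetric]
      by (rule prod.cong) (auto simp: \<epsilon>)
    show "sum \<epsilon> {..<p} = d"
      unfolding \<epsilon>_def using sum.reindex_bij_betw[OF h[of k0], of "e k0"] sum by simp
    show "(\<lambda>k. h (\<theta> (\<psi> k)) i) \<longlonglongrightarrow> lim (\<lambda>k. h (\<theta> (\<psi> k)) i)" if "i < p" for i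
      using \<psi>(2) that by (simp add: convergent_LIMSEQ_iff)
  qed
qed

text \<open>An absorption argument at a fixed value of \<open>s\<close>: the unknown column
  \<open>x\<close> recurs on the right, but multiplied by \<open>t k\<close>. Once
  \<open>cmod (t k) * c\<close> is below half of \<open>cmod m0\<close>, its norm is bounded and the
  right-hand side tends to 0.\<close>

lemma scalar_resolvent_limit:
  fixes x :: "nat \<Rightarrow> nat \<Rightarrow> nat \<Rightarrow> complex" and g u :: "nat \<Rightarrow> nat \<Rightarrow> complex"
  assumes eq: "\<And>k i j. i < n \<Longrightarrow> j < n \<Longrightarrow>
      m0 * x k i j - m k * g i j = t k * (\<Sum>q<n. u i q * x k q j)"
    and m0: "m0 \<noteq> 0" and m: "m \<longlonglongrightarrow> m'" and t: "t \<longlonglongrightarrow> 0" and ij: "i < n" "j < n"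
  shows "(\<lambda>k. x k i j) \<longlonglongrightarrow> m' * g i j / m0"
proof -
  define c where "c = (\<Sum>i<n. \<Sum>q<n. cmod (u i q))"
  define X where "X = (\<lambda>k j. \<Sum>i<n. cmod (x k i j))"
  have X0: "X k j \<ge> 0" for k j by (simp add: X_def sum_nonneg)
  have xX: "cmod (x k q j) \<le> X k j" if "q < n" for k q j
    unfolding X_def using that by (intro member_le_sum) auto
  have S: "cmod (\<Sum>q<n. u i q * x k q j) \<le> (\<Sum>q<n. cmod (u i q)) * X k j" for k i
  proof -
    have "cmod (\<Sum>q<n. u i q * x k q j) \<le> (\<Sum>q<n. cmod (u i q) * X k j)"
      by (intro sum_norm_le order.trans[OF norm_mult_ineq] mult_left_mono xX) auto
    then show ?thesis by (simp only: sum_distrib_right)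
  qed
  have xb: "cmod m0 * cmod (x k i j) \<le> cmod (m k) * cmod (g i j) + cmod (t k) * ((\<Sum>q<n. cmod (u i q)) * X k j)"
    if "i < n" for k i
  proof -
    have "m0 * x k i j = m k * g i j + t k * (\<Sum>q<n. u i q * x k q j)"
      using eq[OF that ij(2), of k] by (simp add: algebra_simps)
    then have "cmod (m0 * x k i j) \<le> cmod (m k * g i j) + cmod (t k * (\<Sum>q<n. u i q * x k q j))"
      by (simp only: norm_triangle_ineq)
    then have "cmod m0 * cmod (x k i j) \<le> cmod (m k * g i j) + cmod (t k * (\<Sum>q<n. u i q * x k q j))"
      by (simp only: norm_mult[of m0])
    also have "\<dots> \<le> cmod (m k) * cmod (g i j) + cmod (t k) * ((\<Sum>q<n. cmod (u i q)) * X k j)"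
      unfolding norm_mult by (intro add_left_mono mult_left_mono S) auto
    finally show ?thesis .
  qed
  have XX: "cmod m0 * X k j \<le> cmod (m k) * (\<Sum>i<n. cmod (g i j)) + cmod (t k) * c * X k j" for k
  proof -
    have "cmod m0 * X k j = (\<Sum>i<n. cmod m0 * cmod (x k i j))" by (simp add: X_def sum_distrib_left)
    also have "\<dots> \<le> (\<Sum>i<n. cmod (m k) * cmod (g i j) + cmod (t k) * ((\<Sum>q<n. cmod (u i q)) * X k j))"
      by (intro sum_mono xb) auto
    also have "\<dots> = cmod (m k) * (\<Sum>i<n. cmod (g i j)) + cmod (t k) * c * X k j"
      by (simp add: c_def sum.distrib sum_distrib_left sum_distrib_right mult.assoc)
    finally show ?thesis .
  qed
  obtain K where K: "\<And>k. cmod (m k) \<le> K" using convergent_imp_Bseq[OF convergentI[OF m]] by (auto simp: Bseq_def)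
  have K0: "K \<ge> 0" using K[of 0] norm_ge_zero order.trans by blast
  have "(\<lambda>k. cmod (t k) * c) \<longlonglongrightarrow> cmod 0 * c" by (intro tendsto_intros t)
  then have "\<forall>\<^sub>F k in sequentially. cmod (t k) * c < cmod m0 / 2"
    using m0 by (intro order_tendstoD) auto
  then have ev: "\<forall>\<^sub>F k in sequentially. X k j \<le> 2 * K * (\<Sum>i<n. cmod (g i j)) / cmod m0"
  proof eventually_elim
    case (elim k)
    have "cmod (t k) * c * X k j \<le> cmod m0 / 2 * X k j" using elim X0[of k j] by (intro mult_right_mono) auto
    moreover have "cmod (m k) * (\<Sum>i<n. cmod (g i j)) \<le> K * (\<Sum>i<n. cmod (g i j))"
      by (intro mult_right_mono K sum_nonneg) auto
    ultimately have "cmod m0 * X k j \<le> 2 * K * (\<Sum>i<n. cmod (g i j))" using XX[of k] by simp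
    then show ?case using m0 by (simp add: field_simps)
  qed
  have lim0: "(\<lambda>k. t k * (\<Sum>q<n. u i q * x k q j)) \<longlonglongrightarrow> 0"
  proof (rule tendsto_0_le[OF t])
    define B where "B = (\<Sum>q<n. cmod (u i q)) * (2 * K * (\<Sum>i<n. cmod (g i j)) / cmod m0)"
    show "\<forall>\<^sub>F k in sequentially. norm (t k * (\<Sum>q<n. u i q * x k q j)) \<le> cmod (t k) * B"
      using ev
    proof eventually_elim
      case (elim k)
      show ?case unfolding norm_mult B_def
        by (intro mult_left_mono order.trans[OF S] elim sum_nonneg) auto
    qed
  qed
  have "(\<lambda>k. (m k * g i j + t k * (\<Sum>q<n. u i q * x k q j)) / m0) \<longlonglongrightarrow> (m' * g i j + 0) / m0"
    by (intro tendsto_divide tendsto_add tendsto_mult m lim0 tendsto_const m0)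
  moreover have "x k i j = (m k * g i j + t k * (\<Sum>q<n. u i q * x k q j)) / m0" for k
    using eq[OF ij, of k] m0 by (simp add: field_simps)
  ultimately show ?thesis by simp
qed

text \<open>Weight counting: the total weight of the limit points equals \<open>sum e R\<close>,
  while each root needs at least its own \<open>e \<mu> > 0\<close>. Equality follows everywhere,
  all roots are hit, and \<open>card R\<close> indices leave no room for collisions.\<close>

lemma limit_roots_match:
  fixes R :: "complex set"
  assumes fin: "finite R" and pos: "\<And>\<mu>. \<mu> \<in> R \<Longrightarrow> 0 < e \<mu>"
    and sum: "sum \<epsilon> {..<card R} = sum e R"
    and ord: "\<And>\<mu>. \<mu> \<in> R \<Longrightarrow> e \<mu> \<le> order \<mu> (\<Prod>i<card R. [:- \<rho> i, 1:] ^ \<epsilon> i)"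
  shows "bij_betw \<rho> {..<card R} R" "\<And>i. i < card R \<Longrightarrow> \<epsilon> i = e (\<rho> i)"
proof -
  let ?p = "card R"
  define o' where "o' = (\<lambda>\<mu>. \<Sum>i<?p. if \<rho> i = \<mu> then \<epsilon> i else 0)"
  have o': "e \<mu> \<le> o' \<mu>" if "\<mu> \<in> R" for \<mu> using ord[OF that] by (simp add: order_prod_linear o'_def)
  have "sum o' R = (\<Sum>i<?p. \<Sum>\<mu>\<in>R. if \<rho> i = \<mu> then \<epsilon> i else 0)" unfolding o'_def by (rule sum.swap)
  also have "\<dots> = (\<Sum>i<?p. if \<rho> i \<in> R then \<epsilon> i else 0)" using fin by (intro sum.cong refl) simp
  also have "\<dots> \<le> sum \<epsilon> {..<?p}" by (intro sum_mono) auto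
  finally have le: "sum o' R \<le> sum e R" using sum by simp
  have oe: "o' \<mu> = e \<mu>" if "\<mu> \<in> R" for \<mu>
  proof (rule ccontr)
    assume "o' \<mu> \<noteq> e \<mu>"
    then have "e \<mu> < o' \<mu>" using o'[OF that] by simp
    then have "sum e R < sum o' R" using o' that fin by (intro sum_strict_mono_ex1) auto
    then show False using le by simp
  qed
  have "R \<subseteq> \<rho> ` {..<?p}"
  proof
    fix \<mu> assume \<mu>: "\<mu> \<in> R"
    show "\<mu> \<in> \<rho> ` {..<?p}"
    proof (rule ccontr)
      assume "\<mu> \<notin> \<rho> ` {..<?p}"
      then have "o' \<mu> = 0" by (auto simp: o'_def intro!: sum.neutral)
      then show False using oe[OF \<mu>] pos[OF \<mu>] by simp
    qed
  qed
  moreover have "card (\<rho> ` {..<?p}) \<le> card R" using card_image_le[of "{..<?p}" \<rho>] by simp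
  ultimately have img: "\<rho> ` {..<?p} = R" by (metis card_seteq finite_imageI finite_lessThan)
  then have inj: "inj_on \<rho> {..<?p}" by (intro eq_card_imp_inj_on) auto
  show "bij_betw \<rho> {..<?p} R" using img inj by (simp add: bij_betw_def)
  fix i assume i: "i < ?p"
  have "o' (\<rho> i) = (\<Sum>j<?p. if j = i then \<epsilon> i else 0)"
    unfolding o'_def using inj i by (intro sum.cong refl) (auto simp: inj_on_def)
  also have "\<dots> = \<epsilon> i" using i by simp
  finally show "\<epsilon> i = e (\<rho> i)" using oe[of "\<rho> i"] img i by auto
qed

lemma degree_sandwich:
  assumes "\<And>i j. i < n \<Longrightarrow> j < n \<Longrightarrow> degree (G $$ (i, j)) \<le> d" "\<And>i j. i < n \<Longrightarrow> j < n \<Longrightarrow> degree (H $$ (i, j)) \<le> d"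
    and "i < n" "j < n"
  shows "degree (sandwich n G V H i j) \<le> d + d"
proof -
  have "degree (\<Sum>p<n. G $$ (i, p) * [:V $$ (p, q):]) \<le> d" for q
  proof (rule degree_sum_le)
    fix p assume "p \<in> {..<n}"
    then show "degree (G $$ (i, p) * [:V $$ (p, q):]) \<le> d"
      using degree_smult_le[of "V $$ (p, q)" "G $$ (i, p)"] assms(1)[OF assms(3), of p] by simp
  qed simp
  then have "degree ((\<Sum>p<n. G $$ (i, p) * [:V $$ (p, q):]) * H $$ (q, j)) \<le> d + d" if "q < n" for q
    using assms(2)[OF that assms(4)] degree_mult_le add_mono order.trans by blast
  then show ?thesis unfolding sandwich_def by (intro degree_sum_le) auto
qed

lemma poly_sandwich:
  "poly (sandwich n G V H i j) s = (\<Sum>q<n. (\<Sum>p<n. poly (G $$ (i, p)) s * V $$ (p, q)) * poly (H $$ (q, j)) s)"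
  by (simp add: sandwich_def poly_sum mult.commute)

lemma pcompose_power: "pcompose (p ^ k) q = pcompose p q ^ k" for p :: "complex poly"
  by (induction k) (auto simp: pcompose_mult pcompose_1)

text \<open>The roots of the perturbed pencils are bounded; along a subsequence they converge, and comparing orders
  of vanishing shows that the limit polynomial is the one of the unperturbed pencil.\<close>

lemma resolvent_perturbation:
  fixes A B V C :: "complex mat"
  assumes car: "A \<in> carrier_mat n n" "B \<in> carrier_mat n n" "V \<in> carrier_mat n n" "C \<in> carrier_mat n n"
    and CB: "C * B = 1\<^sub>m n"
    and skew: "A\<^sup>T = - A" "B\<^sup>T = - B"
    and res0: "is_resolvent n A B R0 e0 G0"
    and t0: "\<And>k. t k \<noteq> 0" and tlim: "t \<longlonglongrightarrow> 0"
    and res: "\<And>k. is_resolvent n (A + t k \<cdot>\<^sub>m V) B (R k) (e k) (G k)"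
    and cardR: "\<And>k. card (R k) = card R0" and sume: "\<And>k. sum (e k) (R k) = sum e0 R0"
    and \<mu>: "\<mu> \<in> R0"
  obtains \<kappa> where "\<And>i j. i < n \<Longrightarrow> j < n \<Longrightarrow>
    coeff (pcompose (sandwich n G0 V G0 i j) [:\<mu>, 1:]) (e0 \<mu> - 1) = \<kappa> * poly (G0 $$ (i, j)) \<mu>"
proof -
  define d where "d = sum e0 R0"
  define m0 where "m0 = root_poly R0 e0"
  let ?p = "card R0"
  have fin: "finite R0" and G0: "G0 \<in> carrier_mat n n" and DG0: "pencil A B * G0 = m0 \<cdot>\<^sub>m 1\<^sub>m n"
    and dG0: "\<And>i j. i < n \<Longrightarrow> j < n \<Longrightarrow> degree (G0 $$ (i, j)) \<le> d"
    and nz0: "\<And>\<mu>. \<mu> \<in> R0 \<Longrightarrow> 0 < e0 \<mu> \<and> (\<exists>i<n. \<exists>j<n. poly (G0 $$ (i, j)) \<mu> \<noteq> 0)"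
    using res0 by (auto simp: is_resolvent_def d_def m0_def)
  have finR: "finite (R k)" and GC: "G k \<in> carrier_mat n n"
    and DG: "pencil (A + t k \<cdot>\<^sub>m V) B * G k = root_poly (R k) (e k) \<cdot>\<^sub>m 1\<^sub>m n"
    and dG: "\<And>i j. i < n \<Longrightarrow> j < n \<Longrightarrow> degree (G k $$ (i, j)) \<le> d" for k
    using res[of k] sume[of k] by (auto simp: is_resolvent_def d_def)
  have m0nz: "m0 \<noteq> 0" using fin by (auto simp: m0_def root_poly_def prod_zero_iff)
  have G0D: "G0 * pencil A B = m0 \<cdot>\<^sub>m 1\<^sub>m n" by (rule resolvent_left(1)[OF car(1,2) G0 skew DG0 m0nz])

  obtain T where T: "\<And>k. cmod (t k) \<le> T" using convergent_imp_Bseq[OF convergentI[OF tlim]] by (auto simp: Bseq_def)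
  define a where "a = (\<lambda>i j. cmod (A $$ (i, j)) + T * cmod (V $$ (i, j)))"
  have bnd: "cmod ((A + t k \<cdot>\<^sub>m V) $$ (i, j)) \<le> a i j" if "i < n" "j < n" for i j k
  proof -
    have "cmod (A $$ (i, j) + t k * V $$ (i, j)) \<le> cmod (A $$ (i, j)) + cmod (t k) * cmod (V $$ (i, j))"
      by (metis norm_mult norm_triangle_ineq)
    also have "\<dots> \<le> a i j" unfolding a_def by (intro add_left_mono mult_right_mono T) auto
    finally show ?thesis using that car by simp
  qed
  define M where "M = (\<Sum>p<n. \<Sum>i<n. cmod (C $$ (p, i)) * (\<Sum>q<n. a i q))"
  have M: "cmod \<nu> \<le> M" if "\<nu> \<in> R k" for k \<nu>
    unfolding M_def using car by (intro resolvent_root_bound[OF _ car(2,4) CB res that bnd]) auto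
  obtain \<phi> r \<epsilon> \<rho> where \<phi>: "strict_mono (\<phi> :: nat \<Rightarrow> nat)"
    and mr: "\<And>k. root_poly (R (\<phi> k)) (e (\<phi> k)) = (\<Prod>i<?p. [:- r k i, 1:] ^ \<epsilon> i)"
    and \<epsilon>: "sum \<epsilon> {..<?p} = d" and r: "\<And>i. i < ?p \<Longrightarrow> (\<lambda>k. r k i) \<longlonglongrightarrow> \<rho> i"
    by (rule root_data_subseq[where R = R and e = e and M = M, OF finR cardR sume M]) (auto simp: d_def)
  define m where "m = (\<lambda>k. \<Prod>i<?p. [:- r k i, 1:] ^ \<epsilon> i)"
  define m' where "m' = (\<Prod>i<?p. [:- \<rho> i, 1:] ^ \<epsilon> i)"
  define \<tau> where "\<tau> = (\<lambda>k. t (\<phi> k))"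
  define H where "H = (\<lambda>k. G (\<phi> k))"
  have \<tau>: "\<tau> k \<noteq> 0" "\<tau> \<longlonglongrightarrow> 0" for k
    using t0 LIMSEQ_subseq_LIMSEQ[OF tlim \<phi>] by (auto simp: \<tau>_def o_def)
  have HC: "H k \<in> carrier_mat n n" for k by (simp add: H_def GC)
  have dH: "degree (H k $$ (i, j)) \<le> d" if "i < n" "j < n" for k i j using dG that by (simp add: H_def)
  have diff: "m0 * H k $$ (i, j) - m k * G0 $$ (i, j) = [:\<tau> k:] * sandwich n G0 V (H k) i j" if "i < n" "j < n" for k i j
    unfolding \<tau>_def
    by (rule resolvent_diff[OF car(1,2,3) G0 HC G0D _ that]) (use DG[of "\<phi> k"] mr[of k] in \<open>simp add: H_def m_def\<close>)
  have mlim: "(\<lambda>k. poly (m k) s) \<longlonglongrightarrow> poly m' s" for s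
    unfolding m_def m'_def poly_prod poly_power by (intro tendsto_prod tendsto_power) (auto intro!: tendsto_intros r)
  have Hlim: "(\<lambda>k. poly (H k $$ (i, j)) s) \<longlonglongrightarrow> poly m' s * poly (G0 $$ (i, j)) s / poly m0 s"
    if ij: "i < n" "j < n" and s: "poly m0 s \<noteq> 0" for i j s
  proof (rule scalar_resolvent_limit[where u = "\<lambda>i q. \<Sum>p<n. poly (G0 $$ (i, p)) s * V $$ (p, q)", OF _ s mlim \<tau>(2) ij])
    fix k i j assume "i < n" "j < n"
    from arg_cong[OF diff[OF this, of k], of "\<lambda>f. poly f s"]
    show "poly m0 s * poly (H k $$ (i, j)) s - poly (m k) s * poly (G0 $$ (i, j)) s =
       \<tau> k * (\<Sum>q<n. (\<Sum>p<n. poly (G0 $$ (i, p)) s * V $$ (p, q)) * poly (H k $$ (q, j)) s)"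
      by (simp add: poly_sandwich)
  qed
  let ?S = "{s. poly m0 s \<noteq> 0}"
  have infS: "infinite ?S"
  proof
    assume "finite ?S"
    moreover have "finite {s. poly m0 s = 0}" by (rule poly_roots_finite[OF m0nz])
    ultimately have "finite (?S \<union> {s. poly m0 s = 0})" by simp
    moreover have "?S \<union> {s. poly m0 s = 0} = UNIV" by auto
    ultimately show False using infinite_UNIV_char_0 by metis
  qed
  \<comment> \<open>Bounded degrees turn the pointwise limits off the roots of \<open>m0\<close>
    into coefficient limits. The relation \<open>m0 * q = m' * G0\<close> then extends to all
    \<open>s\<close>, roots included.\<close>
  have lim_poly: "\<exists>q. m0 * q = m' * G0 $$ (i, j) \<and> degree q \<le> d \<and> (\<forall>l. (\<lambda>k. coeff (H k $$ (i, j)) l) \<longlonglongrightarrow> coeff q l)"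
    if ij: "i < n" "j < n" for i j
  proof -
    have cv: "convergent (\<lambda>k. poly (H k $$ (i, j)) s)" if "s \<in> ?S" for s
      using Hlim[OF ij, of s] that by (auto simp: convergent_def)
    obtain q where q: "degree q \<le> d" "\<And>l. (\<lambda>k. coeff (H k $$ (i, j)) l) \<longlonglongrightarrow> coeff q l"
      by (rule coeff_limit_of_pointwise[where f = "\<lambda>k. H k $$ (i, j)", OF dH[OF ij] infS cv]) blast+
    have "poly (m0 * q - m' * G0 $$ (i, j)) s = 0" if "s \<in> ?S" for s
      using LIMSEQ_unique[OF tendsto_poly_of_coeff[where f = "\<lambda>k. H k $$ (i, j)", OF dH[OF ij] q] Hlim[OF ij, of s]] that
      by (simp add: field_simps)
    then have "?S \<subseteq> {s. poly (m0 * q - m' * G0 $$ (i, j)) s = 0}" by blast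
    then have "m0 * q - m' * G0 $$ (i, j) = 0" using infS poly_roots_finite finite_subset by blast
    then show ?thesis using q by auto
  qed
  \<comment> \<open>Some entry of \<open>G0\<close> is nonzero at \<open>\<nu>\<close>, so the whole
    factor \<open>(s - \<nu>)^(e0 \<nu>)\<close> of \<open>m0\<close> has to divide
    \<open>m'\<close>.\<close>
  have ord: "e0 \<nu> \<le> order \<nu> (\<Prod>i<?p. [:- \<rho> i, 1:] ^ \<epsilon> i)" if \<nu>: "\<nu> \<in> R0" for \<nu>
  proof -
    obtain i j where ij: "i < n" "j < n" "poly (G0 $$ (i, j)) \<nu> \<noteq> 0" using nz0[OF \<nu>] by blast
    obtain q where q: "m0 * q = m' * G0 $$ (i, j)" using lim_poly ij by blast
    have m'nz: "m' \<noteq> 0" by (auto simp: m'_def prod_zero_iff)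
    have nz: "m' * G0 $$ (i, j) \<noteq> 0" using m'nz ij(3) by auto
    have "[:- \<nu>, 1:] ^ e0 \<nu> dvd m' * G0 $$ (i, j)"
      unfolding q[symmetric] m0_def root_poly_remove[OF fin \<nu>] by (simp add: dvd_mult2 mult.assoc)
    then have "e0 \<nu> \<le> order \<nu> (m' * G0 $$ (i, j))" using nz order_divides by blast
    also have "\<dots> = order \<nu> m'" using nz ij(3) by (simp add: order_mult order_0I)
    finally show ?thesis by (simp add: m'_def)
  qed
  have bij: "bij_betw \<rho> {..<?p} R0" and \<epsilon>e: "\<And>i. i < ?p \<Longrightarrow> \<epsilon> i = e0 (\<rho> i)"
    using limit_roots_match[OF fin _ _ ord] nz0 \<epsilon> unfolding d_def by blast+
  have "m0 = m'"
    unfolding m0_def m'_def root_poly_def prod.reindex_bij_betw[OF bij, of "\<lambda>\<mu>. [:- \<mu>, 1:] ^ e0 \<mu>", symmetric]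
    by (intro prod.cong) (auto simp: \<epsilon>e)
  have Hc: "(\<lambda>k. coeff (H k $$ (i, j)) l) \<longlonglongrightarrow> coeff (G0 $$ (i, j)) l" if "i < n" "j < n" for i j l
    using lim_poly[OF that] m0nz unfolding \<open>m0 = m'\<close> by auto
  have Hp: "(\<lambda>k. poly (H k $$ (i, j)) s) \<longlonglongrightarrow> poly (G0 $$ (i, j)) s" if "i < n" "j < n" for i j s
    by (rule tendsto_poly_of_coeff[where f = "\<lambda>k. H k $$ (i, j)", OF dH[OF that] dG0[OF that] Hc[OF that]])

  obtain i1 where i1: "i1 < ?p" "\<rho> i1 = \<mu>" using bij \<mu> by (force simp: bij_betw_def)
  \<comment> \<open>Translation of \<open>\<mu>\<close> to 0 turns orders at \<open>\<mu>\<close>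
    into coefficient indices. As \<open>\<rho>\<close> is a bijection, \<open>i1\<close> is the only
    root sequence tending to \<open>\<mu>\<close>.\<close>
  let ?h = "\<lambda>f. pcompose f [:\<mu>, 1:]" and ?N = "e0 \<mu>"
  have N: "?N > 0" using nz0[OF \<mu>] by blast
  define q where "q = (\<lambda>k. ?h (\<Prod>i\<in>{..<?p}-{i1}. [:- r k i, 1:] ^ \<epsilon> i))"
  define q0 where "q0 = ?h (\<Prod>i\<in>{..<?p}-{i1}. [:- \<rho> i, 1:] ^ \<epsilon> i)"
  have hdeg: "degree (?h f) = degree f" for f by (simp add: degree_pcompose)
  have hlin: "?h [:- c, 1:] = [:- (c - \<mu>), 1:]" for c by (simp add: pcompose_pCons)
  have degq: "degree (\<Prod>i\<in>{..<?p}-{i1}. [:- c i, 1:] ^ \<epsilon> i) \<le> d" for c :: "nat \<Rightarrow> complex"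
  proof -
    have "degree (\<Prod>i\<in>{..<?p}-{i1}. [:- c i, 1:] ^ \<epsilon> i) = (\<Sum>i\<in>{..<?p}-{i1}. \<epsilon> i)"
      by (subst degree_prod_eq_sum_degree) (auto simp: degree_power_eq)
    also have "\<dots> \<le> d" unfolding \<epsilon>[symmetric] by (rule sum_mono2) auto
    finally show ?thesis .
  qed
  have split: "?h (\<Prod>i<?p. [:- c i, 1:] ^ \<epsilon> i) = [:- (c i1 - \<mu>), 1:] ^ ?N * ?h (\<Prod>i\<in>{..<?p}-{i1}. [:- c i, 1:] ^ \<epsilon> i)"
    for c :: "nat \<Rightarrow> complex"
    using i1 \<epsilon>e[OF i1(1)] by (subst prod.remove[of _ i1]) (auto simp: pcompose_mult pcompose_power hlin)
  define W where "W = (\<lambda>k ij. ?h (sandwich n G0 V (H k) (fst ij) (snd ij)))"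
  define w where "w = (\<lambda>ij. ?h (sandwich n G0 V G0 (fst ij) (snd ij)))"
  define Gh where "Gh = (\<lambda>ij. ?h (G0 $$ ij))"
  obtain i0 j0 where ij0: "i0 < n" "j0 < n" "poly (G0 $$ (i0, j0)) \<mu> \<noteq> 0" using nz0[OF \<mu>] by blast
  obtain \<kappa> where \<kappa>: "\<And>ij. ij \<in> {..<n} \<times> {..<n} \<Longrightarrow> coeff (w ij) (?N - 1) = \<kappa> * coeff (Gh ij) 0"
  proof (rule moving_root_limit[where I = "{..<n} \<times> {..<n}" and \<delta> = "\<lambda>k. r k i1 - \<mu>" and t = \<tau> and n = ?N and q = q and ?q0.0 = q0
        and m = "\<lambda>k. ?h (m k)" and G = Gh and ?i0.0 = "(i0, j0)" and W = W and w = w])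
    show "(\<lambda>k. r k i1 - \<mu>) \<longlonglongrightarrow> 0" using r[OF i1(1)] i1(2) by (simp add: LIM_zero)
    show "\<tau> k \<noteq> 0" for k by (rule \<tau>)
    show "(\<lambda>k. coeff (q k) i) \<longlonglongrightarrow> coeff q0 i" for i
    proof (rule tendsto_coeff_of_poly[where S = UNIV and d = d])
      show "degree (q k) \<le> d" "degree q0 \<le> d" for k unfolding q_def q0_def hdeg by (rule degq)+
      show "infinite (UNIV :: complex set)" by (rule infinite_UNIV_char_0)
      show "(\<lambda>k. poly (q k) s) \<longlonglongrightarrow> poly q0 s" for s
        unfolding q_def q0_def poly_pcompose poly_prod poly_power
        by (intro tendsto_prod tendsto_power) (auto intro!: tendsto_intros r)
    qed
    show "coeff q0 0 \<noteq> 0"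
      using bij i1 by (auto simp: q0_def poly_0_coeff_0[symmetric] poly_pcompose poly_prod prod_zero_iff bij_betw_def inj_on_def)
    show "?h (m k) = [:- (r k i1 - \<mu>), 1:] ^ ?N * q k" for k
      unfolding m_def q_def by (rule split)
    show "coeff (Gh (i0, j0)) 0 \<noteq> 0" using ij0 by (simp add: Gh_def poly_0_coeff_0[symmetric] poly_pcompose)
    fix k l and ij :: "nat \<times> nat" assume ij: "ij \<in> {..<n} \<times> {..<n}"
    obtain i j where [simp]: "ij = (i, j)" "i < n" "j < n" using ij by auto
    \<comment> \<open>The unperturbed root sits exactly at 0 after the shift, so
      \<open>m0 * H\<close> contributes nothing below order \<open>e0 \<mu>\<close>; this yields the
      equation that \<open>moving_root_limit\<close> requires.\<close>
    have hm0: "?h m0 = monom 1 ?N * q0"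
      using split[of \<rho>] i1 unfolding \<open>m0 = m'\<close> m'_def q0_def by (simp add: monom_altdef)
    show "coeff (?h (m k) * Gh ij) l + \<tau> k * coeff (W k ij) l = 0" if "l < ?N"
    proof -
      have "?h m0 * ?h (H k $$ (i, j)) - ?h (m k) * ?h (G0 $$ (i, j)) = [:\<tau> k:] * W k ij"
        using arg_cong[OF diff[of i j k], of ?h] by (simp add: pcompose_mult pcompose_diff pcompose_smult W_def)
      then have "coeff (?h m0 * ?h (H k $$ (i, j))) l - coeff (?h (m k) * Gh ij) l = \<tau> k * coeff (W k ij) l"
        by (metis (no_types, lifting) coeff_diff coeff_smult Gh_def \<open>ij = (i, j)\<close> mult_pCons_left mult_zero_left pCons_0_0 add.right_neutral)
      moreover have "coeff (?h m0 * ?h (H k $$ (i, j))) l = 0"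
        unfolding hm0 mult.assoc using that by (simp add: coeff_monom_mult)
      ultimately have "- coeff (?h (m k) * Gh ij) l = \<tau> k * coeff (W k ij) l" by simp
      then show ?thesis by (metis add.right_inverse)
    qed
    show "(\<lambda>k. coeff (W k ij) l) \<longlonglongrightarrow> coeff (w ij) l"
    proof (rule tendsto_coeff_of_poly[where S = UNIV and d = "d + d"])
      show "degree (W k ij) \<le> d + d" "degree (w ij) \<le> d + d" for k
        unfolding W_def w_def hdeg by (intro degree_sandwich dG0 dH; simp)+
      show "infinite (UNIV :: complex set)" by (rule infinite_UNIV_char_0)
      show "(\<lambda>k. poly (W k ij) s) \<longlonglongrightarrow> poly (w ij) s" for s
        unfolding W_def w_def poly_pcompose poly_sandwich
        by (intro tendsto_sum tendsto_mult tendsto_const Hp) auto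
    qed
  qed (use ij0 N in auto)
  show ?thesis
  proof (rule that)
    fix i j assume "i < n" "j < n"
    then show "coeff (?h (sandwich n G0 V G0 i j)) (?N - 1) = \<kappa> * poly (G0 $$ (i, j)) \<mu>"
      using \<kappa>[of "(i, j)"] by (simp add: w_def Gh_def poly_0_coeff_0[symmetric] poly_pcompose)
  qed
qed

section \<open>Necessity\<close>

lemma lie_form_carrier[simp]: "lie_form n c x \<in> carrier_mat n n"
  by (simp add: lie_form_def)

lemma pencil_carrier: "A \<in> carrier_mat n n \<Longrightarrow> B \<in> carrier_mat n n \<Longrightarrow> pencil A B \<in> carrier_mat n n"
  by (auto simp: pencil_def)

lemma lie_form_skew:
  assumes "is_lie_alg n c"
  shows "transpose_mat (lie_form n c x) = - lie_form n c x"
proof (rule eq_matI)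
  fix i j assume "i < dim_row (- lie_form n c x)" "j < dim_col (- lie_form n c x)"
  then have ij: "i < n" "j < n" by (auto simp: lie_form_def)
  have *: "x $ k * c j i k = - (x $ k * c i j k)" if "k < n" for k
  proof -
    have "c j i k = - c i j k" using assms ij that unfolding is_lie_alg_def by blast
    then show ?thesis by (simp only: mult_minus_right)
  qed
  have "(\<Sum>k<n. x $ k * c j i k) = - (\<Sum>k<n. x $ k * c i j k)"
    unfolding sum_negf[symmetric] by (intro sum.cong refl *) simp
  then show "transpose_mat (lie_form n c x) $$ (i, j) = (- lie_form n c x) $$ (i, j)"
    using ij by (simp add: lie_form_def)
qed (auto simp: lie_form_def)

lemma lie_form_add_smult:
  "x \<in> carrier_vec n \<Longrightarrow> v \<in> carrier_vec n \<Longrightarrow>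
    lie_form n c (x + t \<cdot>\<^sub>v v) = lie_form n c x + t \<cdot>\<^sub>m lie_form n c v"
  by (rule eq_matI) (auto simp: lie_form_def sum.distrib sum_distrib_left algebra_simps)

lemma lie_form_unit: "k < n \<Longrightarrow> p < n \<Longrightarrow> q < n \<Longrightarrow> lie_form n c (unit_vec n k) $$ (p, q) = c p q k"
proof -
  assume *: "k < n" "p < n" "q < n"
  have "(\<Sum>l<n. unit_vec n k $ l * c p q l) = (\<Sum>l<n. if l = k then c p q k else 0)"
    using * by (intro sum.cong refl) auto
  then show ?thesis using * by (simp add: lie_form_def)
qed

text \<open>Closedness of the inverse form, evaluated on basis covectors.\<close>

lemma resolvent_jacobi:
  fixes G :: "complex poly mat"
  assumes lie: "is_lie_alg n c" and G: "G \<in> carrier_mat n n" and x: "x \<in> carrier_vec n" "a \<in> carrier_vec n"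
    and DG: "pencil (lie_form n c x) (lie_form n c a) * G = m \<cdot>\<^sub>m 1\<^sub>m n" and m: "m \<noteq> 0"
    and skew: "G\<^sup>T = - G" and ijk: "i < n" "j < n" "k < n"
  shows "sandwich n G (lie_form n c (unit_vec n k)) G i j + sandwich n G (lie_form n c (unit_vec n i)) G j k +
    sandwich n G (lie_form n c (unit_vec n j)) G k i = 0"
proof -
  define C where "C = (\<lambda>p q l. [:c p q l:])"
  \<comment> \<open>Coordinates of the covector \<open>s a - x\<close> with polynomial entries: the
    pencil is the Lie form of this moving covector.\<close>
  define y where "y = (\<lambda>r. [:- x $ r, a $ r:])"
  define g where "g = (\<lambda>p q. G $$ (p, q))"
  have gs: "g p q = - g q p" if "p < n" "q < n" for p q
    using arg_cong[OF skew, of "\<lambda>X. X $$ (q, p)"] that G by (simp add: g_def)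
  have Dy: "pencil (lie_form n c x) (lie_form n c a) $$ (l, s) = (\<Sum>r<n. y r * C l s r)" if "l < n" "s < n" for l s
    using that x by (simp add: pencil_def lie_form_def y_def C_def poly_eq_iff coeff_sum coeff_pCons sum_negf mult.commute split: nat.splits)
  have res: "(\<Sum>s<n. (\<Sum>r<n. y r * C l s r) * g s k) = (if l = k then m else 0)" if "l < n" "k < n" for l k
  proof -
    have "pencil (lie_form n c x) (lie_form n c a) \<in> carrier_mat n n" by (simp add: pencil_carrier)
    then have "(\<Sum>s<n. pencil (lie_form n c x) (lie_form n c a) $$ (l, s) * G $$ (s, k)) = (pencil (lie_form n c x) (lie_form n c a) * G) $$ (l, k)"
      using that G by (simp add: scalar_prod_def atLeast0LessThan)
    then show ?thesis using that by (simp add: DG Dy g_def)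
  qed
  define S where "S = (\<lambda>i j k. \<Sum>p<n. \<Sum>q<n. g p i * C p q k * g q j)"
  have sS: "sandwich n G (lie_form n c (unit_vec n k)) G i j = - S i j k" if "i < n" "j < n" "k < n" for i j k
  proof -
    have "sandwich n G (lie_form n c (unit_vec n k)) G i j = (\<Sum>q<n. \<Sum>p<n. g i p * C p q k * g q j)"
      using that unfolding sandwich_def sum_distrib_right
      by (intro sum.cong refl) (simp add: lie_form_unit g_def C_def)
    also have "\<dots> = (\<Sum>q<n. \<Sum>p<n. - (g p i * C p q k * g q j))"
      using that by (intro sum.cong refl) (simp add: gs[of i])
    also have "\<dots> = - S i j k" unfolding S_def sum_negf by (subst sum.swap) simp
    finally show ?thesis .
  qed
  \<comment> \<open>The pairing of \<open>y\<close> with the double bracket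
    \<open>[[e_p, e_q], e_s]\<close>; the Jacobi identity is its cyclic sum.\<close>
  define T where "T = (\<lambda>p q s. \<Sum>l<n. \<Sum>r<n. y r * (C p q l * C l s r))"
  have mS: "m * S i j k = (\<Sum>p<n. \<Sum>q<n. \<Sum>s<n. g p i * g q j * g s k * T p q s)" if "i < n" "j < n" "k < n" for i j k
  proof -
    \<comment> \<open>The factor \<open>m\<close> at the free index \<open>k\<close> is written as
      pencil times \<open>G\<close>. This contracts \<open>[e_p, e_q]\<close> with a second bracket
      and so produces \<open>T\<close>.\<close>
    have "m * C p q k = (\<Sum>s<n. g s k * T p q s)" if "p < n" "q < n" for p q
    proof -
      have "m * C p q k = (\<Sum>l<n. C p q l * (if l = k then m else 0))"
        using \<open>k < n\<close> by (simp add: if_distrib[of "\<lambda>x. _ * x"] mult.commute cong: if_cong)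
      also have "\<dots> = (\<Sum>l<n. C p q l * (\<Sum>s<n. (\<Sum>r<n. y r * C l s r) * g s k))"
        using \<open>k < n\<close> by (intro sum.cong refl) (simp add: res)
      also have "\<dots> = (\<Sum>l<n. \<Sum>s<n. \<Sum>r<n. g s k * (y r * (C p q l * C l s r)))"
        by (simp add: sum_distrib_left sum_distrib_right mult_ac)
      also have "\<dots> = (\<Sum>s<n. \<Sum>l<n. \<Sum>r<n. g s k * (y r * (C p q l * C l s r)))" by (rule sum.swap)
      finally show ?thesis by (simp add: T_def sum_distrib_left)
    qed
    then have "(\<Sum>p<n. \<Sum>q<n. g p i * g q j * (m * C p q k)) = (\<Sum>p<n. \<Sum>q<n. g p i * g q j * (\<Sum>s<n. g s k * T p q s))"
      by (intro sum.cong refl) simp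
    then show ?thesis by (simp add: S_def sum_distrib_left mult_ac)
  qed
  have jac: "T p q s + T q s p + T s p q = 0" if "p < n" "q < n" "s < n" for p q s
  proof -
    have cs: "(\<Sum>l<n. C p q l * C l s r + C q s l * C l p r + C s p l * C l q r) =
        [:\<Sum>l<n. c p q l * c l s r + c q s l * c l p r + c s p l * c l q r:]" for r
      by (simp add: C_def poly_eq_iff coeff_sum coeff_pCons mult.commute split: nat.splits)
    have "T p q s + T q s p + T s p q = (\<Sum>l<n. \<Sum>r<n. y r * (C p q l * C l s r + C q s l * C l p r + C s p l * C l q r))"
      by (simp add: T_def sum.distrib distrib_left)
    also have "\<dots> = (\<Sum>r<n. y r * (\<Sum>l<n. C p q l * C l s r + C q s l * C l p r + C s p l * C l q r))"
      by (subst sum.swap) (simp add: sum_distrib_left)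
    also have "\<dots> = (\<Sum>r<n. y r * [:\<Sum>l<n. c p q l * c l s r + c q s l * c l p r + c s p l * c l q r:])" by (simp only: cs)
    also have "\<dots> = 0"
    proof (intro sum.neutral ballI)
      fix r assume "r \<in> {..<n}"
      then have "(\<Sum>l<n. c p q l * c l s r + c q s l * c l p r + c s p l * c l q r) = 0"
        using lie that unfolding is_lie_alg_def by blast
      then show "y r * [:\<Sum>l<n. c p q l * c l s r + c q s l * c l p r + c s p l * c l q r:] = 0" by simp
    qed
    finally show ?thesis .
  qed
  have "m * (S i j k + S j k i + S k i j) =
     (\<Sum>p<n. \<Sum>q<n. \<Sum>s<n. g p i * g q j * g s k * T p q s) +
     (\<Sum>q<n. \<Sum>s<n. \<Sum>p<n. g q j * g s k * g p i * T q s p) +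
     (\<Sum>s<n. \<Sum>p<n. \<Sum>q<n. g s k * g p i * g q j * T s p q)"
    using ijk by (simp add: mS distrib_left)
  also have "(\<Sum>q<n. \<Sum>s<n. \<Sum>p<n. g q j * g s k * g p i * T q s p) = (\<Sum>p<n. \<Sum>q<n. \<Sum>s<n. g q j * g s k * g p i * T q s p)"
    by (rule trans[OF sum.cong[OF refl sum.swap] sum.swap])
  also have "(\<Sum>s<n. \<Sum>p<n. \<Sum>q<n. g s k * g p i * g q j * T s p q) = (\<Sum>p<n. \<Sum>q<n. \<Sum>s<n. g s k * g p i * g q j * T s p q)"
    by (subst sum.swap) (intro sum.cong refl sum.swap)
  also have "(\<Sum>p<n. \<Sum>q<n. \<Sum>s<n. g p i * g q j * g s k * T p q s) + (\<Sum>p<n. \<Sum>q<n. \<Sum>s<n. g q j * g s k * g p i * T q s p) +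
     (\<Sum>p<n. \<Sum>q<n. \<Sum>s<n. g s k * g p i * g q j * T s p q) = (\<Sum>p<n. \<Sum>q<n. \<Sum>s<n. g p i * g q j * g s k * (T p q s + T q s p + T s p q))"
    by (simp add: sum.distrib distrib_left mult_ac)
  also have "\<dots> = 0" by (intro sum.neutral ballI) (simp add: jac)
  finally have "S i j k + S j k i + S k i j = 0" using m by simp
  moreover have "sandwich n G (lie_form n c (unit_vec n k)) G i j + sandwich n G (lie_form n c (unit_vec n i)) G j k +
    sandwich n G (lie_form n c (unit_vec n j)) G k i = - (S i j k + S j k i + S k i j)"
    using ijk by (simp add: sS)
  ultimately show ?thesis by simp
qed

lemma sandwich_lie_form:
  assumes "i < n" "j < n" "a \<in> carrier_vec n"
  shows "sandwich n G (lie_form n c a) H i j = (\<Sum>k<n. [:a $ k:] * sandwich n G (lie_form n c (unit_vec n k)) H i j)"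
proof -
  have V: "[:lie_form n c a $$ (p, q):] = (\<Sum>k<n. [:a $ k:] * [:lie_form n c (unit_vec n k) $$ (p, q):])" if "p < n" "q < n" for p q
  proof -
    have "lie_form n c a $$ (p, q) = (\<Sum>k<n. a $ k * lie_form n c (unit_vec n k) $$ (p, q))"
      using that by (simp add: lie_form_unit) (simp add: lie_form_def)
    then show ?thesis by (simp add: poly_eq_iff coeff_sum coeff_pCons mult.commute split: nat.splits)
  qed
  have "sandwich n G (lie_form n c a) H i j =
     (\<Sum>q<n. \<Sum>p<n. \<Sum>k<n. [:a $ k:] * (G $$ (i, p) * [:lie_form n c (unit_vec n k) $$ (p, q):] * H $$ (q, j)))"
    unfolding sandwich_def sum_distrib_right
    by (intro sum.cong refl) (simp add: V sum_distrib_left sum_distrib_right mult_ac del: mult_pCons_left mult_pCons_right)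
  also have "\<dots> = (\<Sum>k<n. \<Sum>q<n. \<Sum>p<n. [:a $ k:] * (G $$ (i, p) * [:lie_form n c (unit_vec n k) $$ (p, q):] * H $$ (q, j)))"
    by (rule trans[OF sum.cong[OF refl sum.swap] sum.swap])
  finally show ?thesis by (simp only: sandwich_def sum_distrib_left sum_distrib_right)
qed

text \<open>Differentiate \<open>D G = m\<close> in \<open>s\<close>, where \<open>D' = B\<close>,
  and multiply by \<open>G\<close> from the left.\<close>

lemma sandwich_pencil_derivative:
  assumes car: "A \<in> carrier_mat n n" "B \<in> carrier_mat n n" "G \<in> carrier_mat n n"
    and DG: "pencil A B * G = m \<cdot>\<^sub>m 1\<^sub>m n" "G * pencil A B = m \<cdot>\<^sub>m 1\<^sub>m n" and ij: "i < n" "j < n"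
  shows "sandwich n G B G i j = pderiv m * G $$ (i, j) - m * pderiv (G $$ (i, j))"
proof -
  define D where "D = (\<lambda>p q. pencil A B $$ (p, q))"
  have D: "pderiv (D p q) = [:B $$ (p, q):]" if "p < n" "q < n" for p q
    using that car by (simp add: D_def pencil_def pderiv_pCons pderiv_diff)
  have r1: "(\<Sum>q<n. D p q * G $$ (q, j)) = (if p = j then m else 0)" if "p < n" for p
    using arg_cong[OF DG(1), of "\<lambda>X. X $$ (p, j)"] that ij car by (simp add: D_def pencil_def scalar_prod_def atLeast0LessThan)
  have r2: "(\<Sum>p<n. G $$ (i, p) * D p q) = (if i = q then m else 0)" if "q < n" for q
    using arg_cong[OF DG(2), of "\<lambda>X. X $$ (i, q)"] that ij car by (simp add: D_def pencil_def scalar_prod_def atLeast0LessThan)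
  have r3: "(\<Sum>q<n. [:B $$ (p, q):] * G $$ (q, j)) + (\<Sum>q<n. D p q * pderiv (G $$ (q, j))) = (if p = j then pderiv m else 0)" if "p < n" for p
    using arg_cong[OF r1[OF that], of pderiv] that
    by (simp add: pderiv_sum pderiv_mult D sum.distrib pderiv_0 mult.commute add.commute split: if_splits del: mult_pCons_left mult_pCons_right)
  have "(\<Sum>p<n. G $$ (i, p) * ((\<Sum>q<n. [:B $$ (p, q):] * G $$ (q, j)) + (\<Sum>q<n. D p q * pderiv (G $$ (q, j))))) = G $$ (i, j) * pderiv m"
    using ij by (simp add: r3 if_distrib[of "\<lambda>x. _ * x"] cong: if_cong del: mult_pCons_left mult_pCons_right)
  moreover have "(\<Sum>p<n. G $$ (i, p) * (\<Sum>q<n. [:B $$ (p, q):] * G $$ (q, j))) = sandwich n G B G i j"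
    unfolding sandwich_def sum_distrib_left sum_distrib_right by (subst sum.swap) (simp only: mult.assoc)
  moreover have "(\<Sum>p<n. G $$ (i, p) * (\<Sum>q<n. D p q * pderiv (G $$ (q, j)))) = (\<Sum>q<n. (\<Sum>p<n. G $$ (i, p) * D p q) * pderiv (G $$ (q, j)))"
    unfolding sum_distrib_left sum_distrib_right by (subst sum.swap) (simp only: mult.assoc)
  moreover have "\<dots> = m * pderiv (G $$ (i, j))"
    using ij by (simp add: r2 if_distrib[of "\<lambda>x. x * _"] cong: if_cong)
  ultimately show ?thesis by (simp add: distrib_left sum.distrib algebra_simps)
qed

text \<open>In \<open>m' G - m G'\<close> the second term vanishes at \<open>\<mu>\<close> to order
  \<open>e \<mu>\<close>, so only the leading term of \<open>m'\<close> reaches the coefficient of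
  order \<open>e \<mu> - 1\<close>.\<close>

lemma sandwich_pencil_coeff:
  assumes car: "A \<in> carrier_mat n n" "B \<in> carrier_mat n n" "G \<in> carrier_mat n n"
    and DG: "pencil A B * G = root_poly R e \<cdot>\<^sub>m 1\<^sub>m n" "G * pencil A B = root_poly R e \<cdot>\<^sub>m 1\<^sub>m n" and ij: "i < n" "j < n"
    and \<mu>: "finite R" "\<mu> \<in> R" "0 < e \<mu>"
  shows "coeff (pcompose (sandwich n G B G i j) [:\<mu>, 1:]) (e \<mu> - 1) =
    of_nat (e \<mu>) * poly (root_poly (R - {\<mu>}) e) \<mu> * poly (G $$ (i, j)) \<mu>"
proof -
  let ?h = "\<lambda>f. pcompose f [:\<mu>, 1:]"
  define q where "q = root_poly (R - {\<mu>}) e"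
  obtain N where N: "e \<mu> = Suc N" using \<mu>(3) gr0_implies_Suc by blast
  define L where "L = [:- \<mu>, 1:]"
  have m: "root_poly R e = L ^ Suc N * q" using root_poly_remove[OF \<mu>(1,2), of e] by (simp only: q_def N L_def)
  have lin: "?h L = [:0, 1:]" by (simp add: pcompose_pCons L_def)
  have pL: "pderiv L = 1" by (simp add: pderiv_pCons L_def)
  have L0: "poly L \<mu> = 0" by (simp add: L_def)
  have pd: "pderiv (root_poly R e) = L ^ N * (Polynomial.smult (of_nat (Suc N)) q + L * pderiv q)"
    unfolding m pderiv_mult pderiv_power_Suc pL by (simp add: algebra_simps)
  define g where "g = (Polynomial.smult (of_nat (Suc N)) q + L * pderiv q) * G $$ (i, j) - L * q * pderiv (G $$ (i, j))"
  have "sandwich n G B G i j = L ^ N * g"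
    unfolding sandwich_pencil_derivative[OF car DG ij] pd g_def unfolding m by (simp add: algebra_simps)
  then have "?h (sandwich n G B G i j) = monom 1 N * ?h g"
    by (simp only: pcompose_mult pcompose_power lin monom_altdef smult_1_left)
  then have "coeff (?h (sandwich n G B G i j)) N = poly g \<mu>"
    by (simp add: coeff_monom_mult poly_0_coeff_0[symmetric] poly_pcompose)
  then have "coeff (?h (sandwich n G B G i j)) N = of_nat (Suc N) * poly q \<mu> * poly (G $$ (i, j)) \<mu>"
    by (simp add: g_def L0)
  then show ?thesis by (simp add: N q_def)
qed

section \<open>From block data to a resolvent\<close>

lemma diag_mat_carrier[simp]:
  "A \<in> carrier_mat n n \<Longrightarrow> B \<in> carrier_mat m m \<Longrightarrow> Defs.diag_mat A B \<in> carrier_mat (n + m) (n + m)"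
  by (auto simp: Defs.diag_mat_def)

lemma det_diag_mat:
  "A \<in> carrier_mat n n \<Longrightarrow> B \<in> carrier_mat m m \<Longrightarrow> det (Defs.diag_mat A B) = det A * det B"
  unfolding Defs.diag_mat_def by (subst det_four_block_mat_lower_left_zero[of _ n _ m]) auto

lemma skew_block_carrier[simp]: "M \<in> carrier_mat m m \<Longrightarrow> skew_block M \<in> carrier_mat (m + m) (m + m)"
  by (auto simp: skew_block_def)

lemma det_skew_block:
  assumes M: "M \<in> carrier_mat m m"
  shows "det (skew_block M) = det M * det M"
proof -
  have t: "mat (dim_col M) (dim_row M) (\<lambda>(i,j). - M $$ (j,i)) = - M\<^sup>T"
    using M by (intro eq_matI) auto
  have "det (skew_block M) = det (0\<^sub>m m m * 0\<^sub>m m m - M * (- M\<^sup>T))"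
    unfolding skew_block_def t using M by (subst det_four_block_mat[of _ m]) auto
  also have "0\<^sub>m m m * 0\<^sub>m m m - M * (- M\<^sup>T) = M * M\<^sup>T"
    using M by (intro eq_matI) auto
  finally show ?thesis using M by (simp add: det_mult[of _ m] det_transpose)
qed

fun is_jor :: "jk_block \<Rightarrow> bool" where
  "is_jor (Jor _ _) = True"
| "is_jor (Kro _) = False"

lemma is_jor_of_jk_data:
  assumes "jk_data bs = ({#}, Ts)" "b \<in> set bs"
  shows "is_jor b"
proof (cases b)
  case (Kro k)
  have "k \<in># fst (jk_data bs)" using assms(2) Kro by (force simp: jk_data_def)
  then show ?thesis using assms(1) by simp
qed simp

lemma skew_block_add_smult:
  assumes "M \<in> carrier_mat m m" "M' \<in> carrier_mat m m"
  shows "skew_block M + t \<cdot>\<^sub>m skew_block M' = skew_block (M + t \<cdot>\<^sub>m M')"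
  using assms by (intro eq_matI) (auto simp: skew_block_def)

lemma diag_mat_add_smult:
  assumes "A \<in> carrier_mat n n" "A' \<in> carrier_mat n n" "B \<in> carrier_mat m m" "B' \<in> carrier_mat m m"
  shows "Defs.diag_mat A B + t \<cdot>\<^sub>m Defs.diag_mat A' B' = Defs.diag_mat (A + t \<cdot>\<^sub>m A') (B + t \<cdot>\<^sub>m B')"
  using assms by (intro eq_matI) (auto simp: Defs.diag_mat_def)

lemma block_pair_carrier:
  "is_jor b \<Longrightarrow> fst (block_pair b) \<in> carrier_mat (2 * block_param b) (2 * block_param b) \<and>
     snd (block_pair b) \<in> carrier_mat (2 * block_param b) (2 * block_param b)"
  by (induction b rule: block_pair.induct) (auto simp: mult_2)

lemma blocks_pair_carrier:
  "\<forall>b\<in>set bs. is_jor b \<Longrightarrow> \<exists>n. fst (blocks_pair bs) \<in> carrier_mat n n \<and> snd (blocks_pair bs) \<in> carrier_mat n n"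
proof (induction bs)
  case (Cons b bs)
  then obtain n where "fst (blocks_pair bs) \<in> carrier_mat n n" "snd (blocks_pair bs) \<in> carrier_mat n n" by auto
  then show ?case using block_pair_carrier[of b] Cons.prems diag_mat_carrier by (simp, blast)
qed (auto intro: exI[of _ 0])

lemma det_upper: "A \<in> carrier_mat n n \<Longrightarrow> upper_triangular A \<Longrightarrow> (\<And>i. i < n \<Longrightarrow> A $$ (i, i) \<noteq> 0) \<Longrightarrow> det A \<noteq> 0"
  for A :: "complex mat"
  by (subst det_upper_triangular) (auto simp: Matrix.diag_mat_def prod_list_zero_iff)

text \<open>A block with eigenvalue infinity becomes \<open>J_0 + t\<close>, invertible for every
  \<open>t \<noteq> 0\<close>; a finite one becomes \<open>1 + t J_\<mu>\<close>, invertible for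
  small \<open>t\<close>.\<close>

lemma block_perturbed_det:
  assumes "is_jor b" "t \<longlonglongrightarrow> 0" "\<And>k. t k \<noteq> (0 :: complex)"
  shows "\<forall>\<^sub>F k in sequentially. det (snd (block_pair b) + t k \<cdot>\<^sub>m fst (block_pair b)) \<noteq> 0"
proof (cases b)
  case (Jor \<mu>' m)
  show ?thesis
  proof (cases \<mu>')
    case None
    have "det (jordan_block m 0 + t k \<cdot>\<^sub>m 1\<^sub>m m) \<noteq> 0" for k
      by (rule det_upper) (auto simp: jordan_block_def upper_triangular_def assms)
    then show ?thesis
      using None Jor by (simp add: skew_block_add_smult[of _ m] det_skew_block[of _ m])
  next
    case (Some \<mu>)
    have "(\<lambda>k. 1 + t k * \<mu>) \<longlonglongrightarrow> 1 + 0 * \<mu>" by (intro tendsto_intros assms)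
    then have "\<forall>\<^sub>F k in sequentially. 1 + t k * \<mu> \<noteq> 0" by (rule tendsto_imp_eventually_ne) simp
    then show ?thesis
    proof eventually_elim
      case (elim k)
      have "det (1\<^sub>m m + t k \<cdot>\<^sub>m jordan_block m \<mu>) \<noteq> 0"
        by (rule det_upper) (auto simp: jordan_block_def upper_triangular_def elim)
      then show ?case
        using Some Jor by (simp add: skew_block_add_smult[of _ m] det_skew_block[of _ m])
    qed
  qed
qed (use assms in simp)

lemma blocks_perturbed_det:
  assumes "\<forall>b\<in>set bs. is_jor b" "t \<longlonglongrightarrow> 0" "\<And>k. t k \<noteq> (0 :: complex)"
  shows "\<forall>\<^sub>F k in sequentially. det (snd (blocks_pair bs) + t k \<cdot>\<^sub>m fst (blocks_pair bs)) \<noteq> 0"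
  using assms(1)
proof (induction bs)
  case Nil
  have "0\<^sub>m 0 0 + t k \<cdot>\<^sub>m 0\<^sub>m 0 0 = (1\<^sub>m 0 :: complex mat)" for k by (rule eq_matI) auto
  then show ?case by simp
next
  case (Cons b bs)
  let ?m = "2 * block_param b"
  have b: "fst (block_pair b) \<in> carrier_mat ?m ?m" "snd (block_pair b) \<in> carrier_mat ?m ?m"
    using block_pair_carrier[of b] Cons.prems by auto
  obtain n where n: "fst (blocks_pair bs) \<in> carrier_mat n n" "snd (blocks_pair bs) \<in> carrier_mat n n"
    using blocks_pair_carrier[of bs] Cons.prems by auto
  have "\<forall>\<^sub>F k in sequentially. det (snd (blocks_pair bs) + t k \<cdot>\<^sub>m fst (blocks_pair bs)) \<noteq> 0"
    using Cons by simp
  moreover have "\<forall>\<^sub>F k in sequentially. det (snd (block_pair b) + t k \<cdot>\<^sub>m fst (block_pair b)) \<noteq> 0"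
    using Cons.prems by (intro block_perturbed_det assms) auto
  ultimately show ?case
  proof eventually_elim
    case (elim k)
    then show ?case
      using b n by (simp add: diag_mat_add_smult[of _ ?m _ _ n] det_diag_mat[of _ ?m _ n])
  qed
qed

text \<open>An infinite block of positive size has the singular
  \<open>skew_block (jordan_block m 0)\<close> as its second form, so a nonzero determinant excludes
  it.\<close>

lemma nondegenerate_blocks:
  assumes "\<forall>b\<in>set bs. is_jor b \<and> 0 < block_param b" "det (snd (blocks_pair bs)) \<noteq> 0"
  shows "\<exists>ps. bs = jor_blocks ps \<and> (\<forall>(\<mu>, m)\<in>set ps. 0 < m)"
  using assms
proof (induction bs)
  case Nil
  then show ?case by (intro exI[of _ "[]"]) (simp add: jor_blocks_def)
next
  case (Cons b bs)
  let ?m = "2 * block_param b"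
  have b: "fst (block_pair b) \<in> carrier_mat ?m ?m" "snd (block_pair b) \<in> carrier_mat ?m ?m"
    using block_pair_carrier[of b] Cons.prems by auto
  obtain n where n: "fst (blocks_pair bs) \<in> carrier_mat n n" "snd (blocks_pair bs) \<in> carrier_mat n n"
    using blocks_pair_carrier[of bs] Cons.prems by auto
  have d: "det (snd (block_pair b)) \<noteq> 0" "det (snd (blocks_pair bs)) \<noteq> 0"
    using Cons.prems(2) b n by (auto simp: det_diag_mat[of _ ?m _ n])
  obtain ps where ps: "bs = jor_blocks ps" "\<forall>(\<mu>, m)\<in>set ps. 0 < m" using Cons.IH Cons.prems d by auto
  have "\<exists>\<mu> m. b = Jor (Some \<mu>) m"
  proof (cases b)
    case (Jor \<mu>' m)
    have m: "0 < m" using Cons.prems Jor by simp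
    show ?thesis
    proof (cases \<mu>')
      case None
      have "det (jordan_block m (0::complex)) = prod_list (Matrix.diag_mat (jordan_block m 0))"
        by (rule det_upper_triangular[of _ m]) (auto simp: jordan_block_def upper_triangular_def)
      also have "\<dots> = 0" using m by (auto simp: Matrix.diag_mat_def prod_list_zero_iff jordan_block_def image_iff intro: bexI[of _ 0])
      finally have "det (snd (block_pair b)) = 0" using None Jor by (simp add: det_skew_block[of _ m])
      then show ?thesis using d by simp
    qed (use Jor in auto)
  qed (use Cons.prems in simp)
  then obtain \<mu> m where bm: "b = Jor (Some \<mu>) m" by blast
  then show ?case using ps Cons.prems by (intro exI[of _ "(\<mu>, m) # ps"]) (auto simp: jor_blocks_def)
qed

definition tuple_of :: "('a \<times> nat) list \<Rightarrow> 'a \<Rightarrow> nat multiset" where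
  "tuple_of ps \<mu> = mset (map snd (filter (\<lambda>q. fst q = \<mu>) ps))"

lemma jk_data_jor:
  "jk_data (jor_blocks ps) = ({#}, image_mset (tuple_of ps) (mset_set (fst ` set ps)))"
proof -
  have kro: "concat (map (\<lambda>x. case x of Jor a b \<Rightarrow> [] | Kro k \<Rightarrow> [k]) (jor_blocks ps)) = []"
    by (auto simp: jor_blocks_def)
  have set: "{\<mu>. \<exists>m. Jor \<mu> m \<in> set (jor_blocks ps)} = Some ` fst ` set ps"
    by (force simp: jor_blocks_def)
  have tup: "mset (concat (map (\<lambda>x. case x of Jor \<mu>' m \<Rightarrow> if \<mu>' = Some \<mu> then [m] else [] | Kro k \<Rightarrow> []) (jor_blocks ps))) = tuple_of ps \<mu>" for \<mu>
    by (induction ps) (auto simp: jor_blocks_def tuple_of_def)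
  show ?thesis
    unfolding jk_data_def set
    by (simp add: kro tup image_mset_mset_set[symmetric] multiset.map_comp o_def)
qed

lemma tuple_of_mem: "m \<in># tuple_of ps \<mu> \<longleftrightarrow> (\<mu>, m) \<in> set ps"
  by (force simp: tuple_of_def)

lemma tuple_of_count:
  assumes "2 \<le> count (tuple_of ps \<mu>) m"
  shows "repeated ps (\<mu>, m)"
proof -
  have "count (tuple_of ps \<mu>) m = length (filter (\<lambda>q. q = (\<mu>, m)) ps)"
    by (induction ps) (auto simp: tuple_of_def)
  then have "2 \<le> card {k. k < length ps \<and> ps ! k = (\<mu>, m)}" using assms by (simp add: length_filter_conv_card)
  then have "\<not> card {k. k < length ps \<and> ps ! k = (\<mu>, m)} \<le> Suc 0" by simp
  moreover have "finite {k. k < length ps \<and> ps ! k = (\<mu>, m)}" by simp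
  ultimately show ?thesis using card_le_Suc0_iff_eq by blast
qed

lemma jk_type_jor_data:
  assumes type: "jk_type n A B ({#}, Ts)" and car: "B \<in> carrier_mat n n" and det: "det B \<noteq> 0"
  obtains ps P where "\<And>\<mu> m. (\<mu>, m) \<in> set ps \<Longrightarrow> 0 < m" "Ts = image_mset (tuple_of ps) (mset_set (fst ` set ps))"
    "P \<in> carrier_mat n n" "invertible_mat P" "P\<^sup>T * A * P = ent_mat jor_ent ps" "P\<^sup>T * B * P = ent_mat one_ent ps"
proof -
  obtain bs P where bs: "\<forall>b \<in> set bs. block_param b > 0" "jk_data bs = ({#}, Ts)" and P: "P \<in> carrier_mat n n" "invertible_mat P"
    "P\<^sup>T * A * P = fst (blocks_pair bs)" "P\<^sup>T * B * P = snd (blocks_pair bs)"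
    using type unfolding jk_type_def jk_decomp_def by blast
  have "is_jor b" if "b \<in> set bs" for b by (rule is_jor_of_jk_data[OF bs(2) that])
  moreover have "det (snd (blocks_pair bs)) \<noteq> 0"
  proof -
    obtain Q where Q: "Q \<in> carrier_mat n n" "P * Q = 1\<^sub>m n" using invertible_mat_inverse[OF P(1,2)] by metis
    then have "det P \<noteq> 0" using det_mult[OF P(1) Q(1)] by auto
    then show ?thesis
      unfolding P(4)[symmetric] using P(1) car det by (simp add: det_mult[of _ n] det_transpose del: assoc_mult_mat)
  qed
  ultimately obtain ps where ps: "bs = jor_blocks ps" "\<forall>(\<mu>, m)\<in>set ps. 0 < m" using nondegenerate_blocks[of bs] bs(1) by blast
  show ?thesis
    by (rule that[of ps P]) (use ps bs P in \<open>auto simp: jk_data_jor blocks_pair_jor\<close>)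
qed

text \<open>\<open>card R\<close> and \<open>sum e R\<close> depend on \<open>Ts\<close> alone and
  not on the eigenvalues. These two equations are the form in which constancy of the type enters the
  perturbation argument.\<close>

lemma jk_type_resolvent:
  assumes type: "jk_type n A B ({#}, Ts)" and car: "A \<in> carrier_mat n n" "B \<in> carrier_mat n n" and det: "det B \<noteq> 0"
  obtains R e G where "is_resolvent n A B R e G" "card R = size Ts" "sum e R = sum_mset (image_mset Max_mset Ts)"
    "\<And>T. T \<in># Ts \<Longrightarrow> 2 \<le> count T (Max_mset T) \<Longrightarrow>
       \<exists>\<mu>\<in>R. \<forall>\<alpha> \<beta>. \<not> (wedge_at n G \<mu> \<alpha> \<beta>)"
proof -
  obtain ps P where ps: "\<And>\<mu> m. (\<mu>, m) \<in> set ps \<Longrightarrow> 0 < m" and Ts: "Ts = image_mset (tuple_of ps) (mset_set (fst ` set ps))"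
    and P: "P \<in> carrier_mat n n" "invertible_mat P" "P\<^sup>T * A * P = ent_mat jor_ent ps" "P\<^sup>T * B * P = ent_mat one_ent ps"
    using jk_type_jor_data[OF type car(2) det] by metis
  define R where "R = fst ` set ps"
  define e where "e = (\<lambda>\<mu>. Max_mset (tuple_of ps \<mu>))"
  have e: "0 < m \<and> m \<le> e \<mu>" if "(\<mu>, m) \<in> set ps" for \<mu> m
    using ps[OF that] that unfolding e_def by (intro conjI Max_ge) (auto simp: tuple_of_mem)
  have eR: "(\<mu>, e \<mu>) \<in> set ps" if "\<mu> \<in> R" for \<mu>
  proof -
    have "set_mset (tuple_of ps \<mu>) \<noteq> {}" using that by (force simp: R_def tuple_of_def)
    then have "e \<mu> \<in># tuple_of ps \<mu>" unfolding e_def by (intro Max_in) auto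
    then show ?thesis by (simp add: tuple_of_mem)
  qed
  show ?thesis
  proof (rule jk_resolvent[where R = R and e = e, OF R_def e car P])
    fix G assume G: "G \<in> carrier_mat n n" "pencil A B * G = root_poly R e \<cdot>\<^sub>m 1\<^sub>m n"
      "\<And>i j. i < n \<Longrightarrow> j < n \<Longrightarrow> degree (G $$ (i, j)) \<le> sum e R"
      "\<And>\<mu>. \<exists>k<length ps. ps ! k = (\<mu>, e \<mu>) \<Longrightarrow> \<exists>i<n. \<exists>j<n. poly (G $$ (i, j)) \<mu> \<noteq> 0"
      "\<And>\<mu> \<alpha> \<beta>. repeated ps (\<mu>, e \<mu>) \<Longrightarrow>
        \<not> (wedge_at n G \<mu> \<alpha> \<beta>)"
    show ?thesis
    proof (rule that)
    have "0 < e \<mu> \<and> (\<exists>i<n. \<exists>j<n. poly (G $$ (i, j)) \<mu> \<noteq> 0)" if "\<mu> \<in> R" for \<mu>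
      using eR[OF that] ps G(4)[of \<mu>] by (auto simp: in_set_conv_nth)
    then show "is_resolvent n A B R e G" using G by (auto simp: is_resolvent_def R_def)
    show "card R = size Ts" by (simp add: Ts R_def)
    show "sum e R = sum_mset (image_mset Max_mset Ts)"
      by (simp add: Ts R_def e_def sum_unfold_sum_mset multiset.map_comp o_def)
    fix T assume "T \<in># Ts" and cT: "2 \<le> count T (Max_mset T)"
    then obtain \<mu> where \<mu>: "\<mu> \<in> R" "T = tuple_of ps \<mu>" by (auto simp: Ts R_def)
    then show "\<exists>\<mu>\<in>R. \<forall>\<alpha> \<beta>. \<not> (wedge_at n G \<mu> \<alpha> \<beta>)"
      using G(5)[of \<mu>] tuple_of_count[of ps \<mu> "e \<mu>"] cT by (auto simp: e_def)
    qed
  qed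
qed

section \<open>Choice of the point and of sequences near it\<close>

lemma poly_funs_tendsto:
  assumes "f \<in> poly_funs N" "z \<in> carrier_vec N" "w \<in> carrier_vec N" "t \<longlonglongrightarrow> 0"
  shows "(\<lambda>k. f (z + t k \<cdot>\<^sub>v w)) \<longlonglongrightarrow> f z"
  using assms(1)
proof induction
  case (coord i)
  have "(\<lambda>k. z $ i + t k * w $ i) \<longlonglongrightarrow> z $ i + 0 * w $ i" by (intro tendsto_intros assms)
  then show ?case using coord assms by simp
qed (auto intro: tendsto_intros)

lemma zariski_open_eventually:
  assumes U: "zariski_open N U" "z \<in> U" and "w \<in> carrier_vec N" "t \<longlonglongrightarrow> 0"
  shows "\<forall>\<^sub>F k in sequentially. z + t k \<cdot>\<^sub>v w \<in> U"
proof -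
  obtain F where F: "F \<subseteq> poly_funs N" "U = {z \<in> carrier_vec N. \<exists>f \<in> F. f z \<noteq> 0}"
    using U unfolding zariski_open_def by blast
  obtain f where f: "f \<in> F" "f z \<noteq> 0" "z \<in> carrier_vec N" using U F by auto
  have "(\<lambda>k. f (z + t k \<cdot>\<^sub>v w)) \<longlonglongrightarrow> f z" by (rule poly_funs_tendsto) (use f F assms in auto)
  from tendsto_imp_eventually_ne[OF this f(2)] show ?thesis
    by eventually_elim (use F f assms in auto)
qed

lemma inverse_seq:
  fixes K :: nat
  defines "t \<equiv> \<lambda>k. 1 / of_nat (k + K + 1) :: complex"
  shows "t \<longlonglongrightarrow> 0" "t k \<noteq> 0"
proof -
  have "(\<lambda>k. 1 / of_nat (k + Suc K) :: complex) \<longlonglongrightarrow> 0" using LIMSEQ_ignore_initial_segment[OF lim_1_over_n] .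
  then show "t \<longlonglongrightarrow> 0" by (simp add: t_def)
  show "t k \<noteq> 0" unfolding t_def by (metis One_nat_def add_Suc_right divide_eq_0_iff nat.distinct(1) of_nat_eq_0_iff zero_neq_one)
qed

lemma eventually_shift_seq:
  assumes "\<forall>\<^sub>F k in sequentially. P (1 / of_nat (k + 1) :: complex)"
  obtains t where "t \<longlonglongrightarrow> 0" "\<And>k. t k \<noteq> (0::complex)" "\<And>k. P (t k)"
proof -
  obtain K where K: "\<And>k. K \<le> k \<Longrightarrow> P (1 / of_nat (k + 1) :: complex)" using assms unfolding eventually_sequentially by blast
  show ?thesis
  proof (rule that[of "\<lambda>k. 1 / of_nat (k + K + 1)"])
    show "P (1 / of_nat (k + K + 1))" for k by (rule K) simp
  qed (rule inverse_seq)+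
qed

abbreviation type_along :: "nat \<Rightarrow> complex mat \<Rightarrow> complex mat \<Rightarrow> complex mat \<Rightarrow> nat multiset multiset \<Rightarrow> bool" where
  "type_along n A V B Ts \<equiv>
    \<exists>t. t \<longlonglongrightarrow> 0 \<and> (\<forall>k. t k \<noteq> 0 \<and> jk_type n (A + t k \<cdot>\<^sub>m V) B ({#}, Ts))"

text \<open>Jordan blocks at infinity may make the second form singular at the first point found.
  Since the absence of Kronecker blocks makes \<open>A_a + t A_x\<close> invertible for small
  \<open>t \<noteq> 0\<close>, the point \<open>(x, a + t x)\<close> is used instead.\<close>

lemma JK_invariants_nondegenerate_point:
  assumes lie: "is_lie_alg n c" and JK: "JK_invariants n c ({#}, Ts)"
  obtains x a where "x \<in> carrier_vec n" "a \<in> carrier_vec n" "det (lie_form n c a) \<noteq> 0"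
    "jk_type n (lie_form n c x) (lie_form n c a) ({#}, Ts)"
    "\<And>v. v \<in> carrier_vec n \<Longrightarrow> type_along n (lie_form n c x) (lie_form n c v) (lie_form n c a) Ts"
proof -
  obtain U where U: "zariski_open (2 * n) U" "U \<noteq> {}" and
    T: "\<And>z. z \<in> U \<Longrightarrow> jk_type n (lie_form n c (vec n (\<lambda>i. z $ i))) (lie_form n c (vec n (\<lambda>i. z $ (n + i)))) ({#}, Ts)"
    using JK unfolding JK_invariants_def by blast
  have Uc: "z \<in> carrier_vec (2 * n)" if "z \<in> U" for z using U(1) that unfolding zariski_open_def by auto
  define px where "px = (\<lambda>z :: complex vec. vec n (\<lambda>i. z $ i))"
  define pa where "pa = (\<lambda>z :: complex vec. vec n (\<lambda>i. z $ (n + i)))"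
  have c[simp]: "px z \<in> carrier_vec n" "pa z \<in> carrier_vec n" for z by (auto simp: px_def pa_def)
  obtain z0 where z0: "z0 \<in> U" using U by blast
  \<comment> \<open>The direction \<open>(0, x)\<close> in the product: \<open>x\<close> stays fixed
    and \<open>a\<close> moves towards \<open>a + x\<close>.\<close>
  define w where "w = vec (2 * n) (\<lambda>i. if i < n then 0 else z0 $ (i - n))"
  have w: "w \<in> carrier_vec (2 * n)" by (simp add: w_def)
  have pa_w: "pa (z0 + t \<cdot>\<^sub>v w) = pa z0 + t \<cdot>\<^sub>v px z0" for t
    using Uc[OF z0] w by (intro eq_vecI) (auto simp: pa_def px_def w_def)
  obtain bs P where bs: "jk_data bs = ({#}, Ts)" and P: "P \<in> carrier_mat n n" "invertible_mat P"
    "P\<^sup>T * lie_form n c (px z0) * P = fst (blocks_pair bs)" "P\<^sup>T * lie_form n c (pa z0) * P = snd (blocks_pair bs)"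
    using T[OF z0] unfolding jk_type_def jk_decomp_def px_def pa_def by blast
  have jor: "\<forall>b\<in>set bs. is_jor b" using is_jor_of_jk_data[OF bs] by blast
  have det: "det (snd (blocks_pair bs) + t \<cdot>\<^sub>m fst (blocks_pair bs)) = det P * det (lie_form n c (pa z0 + t \<cdot>\<^sub>v px z0)) * det P" for t
  proof -
    have "snd (blocks_pair bs) + t \<cdot>\<^sub>m fst (blocks_pair bs) = P\<^sup>T * lie_form n c (pa z0 + t \<cdot>\<^sub>v px z0) * P"
    proof -
      define A B where "A = lie_form n c (px z0)" and "B = lie_form n c (pa z0)"
      have [simp]: "A \<in> carrier_mat n n" "B \<in> carrier_mat n n" by (simp_all add: A_def B_def)
      have "P\<^sup>T * (B + t \<cdot>\<^sub>m A) * P = (P\<^sup>T * B + t \<cdot>\<^sub>m (P\<^sup>T * A)) * P"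
        using P(1) by (subst mult_add_distrib_mat[of _ n n _ n]) (auto simp: mult_smult_distrib[of _ n n _ n])
      also have "\<dots> = P\<^sup>T * B * P + t \<cdot>\<^sub>m (P\<^sup>T * A * P)"
        using P(1) by (subst add_mult_distrib_mat[of _ n n _ _ n]) (auto simp: mult_smult_assoc_mat[of _ n n _ n] simp del: assoc_mult_mat)
      finally show ?thesis using P(3,4) by (simp only: A_def B_def lie_form_add_smult[OF c(2) c(1)])
    qed
    then show ?thesis using P(1) by (simp add: det_mult[of _ n] det_transpose del: assoc_mult_mat)
  qed
  have t1: "(\<lambda>k. 1 / of_nat (k + 1) :: complex) \<longlonglongrightarrow> 0" "1 / of_nat (k + 1) \<noteq> (0 :: complex)" for k
    using inverse_seq[where K = 0] by auto
  have "\<forall>\<^sub>F k in sequentially. z0 + (1 / of_nat (k + 1)) \<cdot>\<^sub>v w \<in> U \<and> det (lie_form n c (pa (z0 + (1 / of_nat (k + 1)) \<cdot>\<^sub>v w))) \<noteq> 0"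
    using zariski_open_eventually[OF U(1) z0 w t1(1)] blocks_perturbed_det[OF jor t1]
    by eventually_elim (auto simp: det pa_w)
  then obtain z where z: "z \<in> U" "det (lie_form n c (pa z)) \<noteq> 0"
    using eventually_happens'[OF sequentially_bot] by blast
  show ?thesis
  proof (rule that[of "px z" "pa z"])
    show "jk_type n (lie_form n c (px z)) (lie_form n c (pa z)) ({#}, Ts)" using T[OF z(1)] by (simp add: px_def pa_def)
    fix v :: "complex vec" assume v: "v \<in> carrier_vec n"
    define w where "w = vec (2 * n) (\<lambda>i. if i < n then v $ i else 0)"
    have w: "w \<in> carrier_vec (2 * n)" by (simp add: w_def)
    have p: "px (z + t \<cdot>\<^sub>v w) = px z + t \<cdot>\<^sub>v v" "pa (z + t \<cdot>\<^sub>v w) = pa z" for t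
      using Uc[OF z(1)] v by (auto simp: px_def pa_def w_def)
    obtain t where t: "t \<longlonglongrightarrow> 0" "\<And>k. t k \<noteq> 0" "\<And>k. z + t k \<cdot>\<^sub>v w \<in> U"
      by (rule eventually_shift_seq[OF zariski_open_eventually[OF U(1) z(1) w t1(1)]]) blast
    have "jk_type n (lie_form n c (px (z + t k \<cdot>\<^sub>v w))) (lie_form n c (pa (z + t k \<cdot>\<^sub>v w))) ({#}, Ts)" for k
      unfolding px_def pa_def by (rule T[OF t(3)])
    then have "jk_type n (lie_form n c (px z) + t k \<cdot>\<^sub>m lie_form n c v) (lie_form n c (pa z)) ({#}, Ts)" for k
      unfolding p lie_form_add_smult[OF c(1) v] .
    then show "type_along n (lie_form n c (px z)) (lie_form n c v) (lie_form n c (pa z)) Ts"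
      using t by blast
  qed (use z in auto)
qed

lemma JK_invariants_imp_unique_max:
  assumes Ts: "\<And>T. T \<in># Ts \<Longrightarrow> T \<noteq> {#}" and lie: "is_lie_alg n c" and JK: "JK_invariants n c ({#}, Ts)" and T: "T \<in># Ts"
  shows "count T (Max_mset T) = 1"
proof (rule ccontr)
  assume *: "count T (Max_mset T) \<noteq> 1"
  have "Max_mset T \<in># T" using Ts[OF T] by (intro Max_in) auto
  then have two: "2 \<le> count T (Max_mset T)" using * by (metis One_nat_def Suc_leI count_greater_eq_one_iff le_neq_implies_less numeral_2_eq_2)
  obtain x a where x: "x \<in> carrier_vec n" and a: "a \<in> carrier_vec n" and det: "det (lie_form n c a) \<noteq> 0"
    and type: "jk_type n (lie_form n c x) (lie_form n c a) ({#}, Ts)"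
    and dir: "\<And>v. v \<in> carrier_vec n \<Longrightarrow> type_along n (lie_form n c x) (lie_form n c v) (lie_form n c a) Ts"
    using JK_invariants_nondegenerate_point[OF lie JK] by metis
  define A B where "A = lie_form n c x" and "B = lie_form n c a"
  define L where "L = (\<lambda>k. lie_form n c (unit_vec n k))"
  have car[simp]: "A \<in> carrier_mat n n" "B \<in> carrier_mat n n" "L k \<in> carrier_mat n n" for k by (simp_all add: A_def B_def L_def)
  have skew: "A\<^sup>T = - A" "B\<^sup>T = - B" by (simp_all add: A_def B_def lie_form_skew[OF lie])
  obtain C where C: "C \<in> carrier_mat n n" "C * B = 1\<^sub>m n"
    using det_non_zero_imp_unit[OF car(2)] det unfolding B_def[symmetric] Units_def ring_mat_def by auto
  obtain R e G where res: "is_resolvent n A B R e G" and R: "card R = size Ts" "sum e R = sum_mset (image_mset Max_mset Ts)"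
    and bad: "\<And>T. T \<in># Ts \<Longrightarrow> 2 \<le> count T (Max_mset T) \<Longrightarrow>
       \<exists>\<mu>\<in>R. \<forall>\<alpha> \<beta>. \<not> (wedge_at n G \<mu> \<alpha> \<beta>)"
    by (rule jk_type_resolvent[OF type[folded A_def B_def] car(1,2) det[folded B_def]]) blast
  obtain \<mu> where \<mu>: "\<mu> \<in> R" and nd: "\<And>\<alpha> \<beta>. \<not> (wedge_at n G \<mu> \<alpha> \<beta>)"
    using bad[OF T two] by blast
  have fin: "finite R" and G: "G \<in> carrier_mat n n" and DG: "pencil A B * G = root_poly R e \<cdot>\<^sub>m 1\<^sub>m n" and e: "0 < e \<mu>"
    using res \<mu> by (auto simp: is_resolvent_def)
  have nz: "root_poly R e \<noteq> 0" using fin by (auto simp: root_poly_def prod_zero_iff)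
  note left = resolvent_left[OF car(1,2) G skew DG nz]
  \<comment> \<open>One \<open>\<kappa>\<close> serves all entries. Up to the common factor
    \<open>N\<close> introduced below, it is the derivative of the eigenvalue in the direction of
    the \<open>k\<close>-th basis covector.\<close>
  have "\<exists>\<kappa>. \<forall>i<n. \<forall>j<n. coeff (pcompose (sandwich n G (L k) G i j) [:\<mu>, 1:]) (e \<mu> - 1) = \<kappa> * poly (G $$ (i, j)) \<mu>" for k
  proof -
    obtain t where t: "t \<longlonglongrightarrow> 0" "\<And>l. t l \<noteq> 0" "\<And>l. jk_type n (A + t l \<cdot>\<^sub>m L k) B ({#}, Ts)"
      using dir[of "unit_vec n k"] unfolding A_def B_def L_def by auto
    have "\<exists>R' e' G'. is_resolvent n (A + t l \<cdot>\<^sub>m L k) B R' e' G' \<and> card R' = card R \<and> sum e' R' = sum e R" for l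
      by (rule jk_type_resolvent[OF t(3)[of l] _ car(2) det[folded B_def]]) (auto simp: R)
    then obtain R' e' G' where r: "\<And>l. is_resolvent n (A + t l \<cdot>\<^sub>m L k) B (R' l) (e' l) (G' l)" "\<And>l. card (R' l) = card R" "\<And>l. sum (e' l) (R' l) = sum e R"
      by metis
    show ?thesis
      by (rule resolvent_perturbation[OF car(1,2) car(3)[of k] C skew res t(2,1) r \<mu>]) blast
  qed
  then obtain \<kappa> where \<kappa>: "\<And>k i j. i < n \<Longrightarrow> j < n \<Longrightarrow> coeff (pcompose (sandwich n G (L k) G i j) [:\<mu>, 1:]) (e \<mu> - 1) = \<kappa> k * poly (G $$ (i, j)) \<mu>"
    by metis
  define g where "g = (\<lambda>i j. poly (G $$ (i, j)) \<mu>)"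
  have gs: "g j i = - g i j" if "i < n" "j < n" for i j
    using arg_cong[OF left(2), of "\<lambda>X. X $$ (i, j)"] that G by (simp add: g_def)
  define N where "N = of_nat (e \<mu>) * poly (root_poly (R - {\<mu>}) e) \<mu>"
  have N: "N \<noteq> 0" using e fin by (auto simp: N_def poly_root_poly prod_zero_iff)
  define h where "h = (\<lambda>f. coeff (pcompose f [:\<mu>, 1:]) (e \<mu> - 1))"
  have h: "h (f + f') = h f + h f'" "h ([:r:] * f) = r * h f" "h (sum F I) = (\<Sum>i\<in>I. h (F i))" for f f' r and F :: "nat \<Rightarrow> complex poly" and I
    by (auto simp: h_def pcompose_add pcompose_smult pcompose_sum coeff_sum)
  \<comment> \<open>The closedness relation contracted with \<open>a\<close>, in its coefficient of
    order \<open>e \<mu> - 1\<close>. The first summand becomes \<open>G B G\<close>, because the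
    forms \<open>L k\<close> weighted by \<open>a $ k\<close> add up to \<open>B\<close>.\<close>
  have rel: "N * g i j + \<kappa> i * (\<Sum>k<n. a $ k * g j k) + \<kappa> j * (\<Sum>k<n. a $ k * g k i) = 0" if ij: "i < n" "j < n" for i j
  proof -
    have "(\<Sum>k<n. [:a $ k:] * (sandwich n G (L k) G i j + sandwich n G (L i) G j k + sandwich n G (L j) G k i)) = 0"
      using resolvent_jacobi[OF lie G x a DG[unfolded A_def B_def] nz left(2) ij] by (intro sum.neutral) (auto simp: L_def)
    then have "h (\<Sum>k<n. [:a $ k:] * (sandwich n G (L k) G i j + sandwich n G (L i) G j k + sandwich n G (L j) G k i)) = 0"
      by (simp add: h_def)
    moreover have "h (\<Sum>k<n. [:a $ k:] * (sandwich n G (L k) G i j + sandwich n G (L i) G j k + sandwich n G (L j) G k i)) =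
       h (sandwich n G B G i j) + (\<Sum>k<n. a $ k * (\<kappa> i * g j k)) + (\<Sum>k<n. a $ k * (\<kappa> j * g k i))"
    proof -
      have "h (sandwich n G (L i) G j k) = \<kappa> i * g j k" "h (sandwich n G (L j) G k i) = \<kappa> j * g k i" if "k < n" for k
        using \<kappa> ij that by (auto simp: h_def g_def)
      moreover have "h (sandwich n G B G i j) = (\<Sum>k<n. a $ k * h (sandwich n G (L k) G i j))"
        unfolding B_def sandwich_lie_form[OF ij a] h L_def ..
      ultimately show ?thesis unfolding h by (simp add: distrib_left sum.distrib)
    qed
    moreover have "h (sandwich n G B G i j) = N * g i j"
      unfolding h_def g_def N_def by (rule sandwich_pencil_coeff[OF car(1,2) G DG left(1) ij fin \<mu> e])
    ultimately show ?thesis by (simp add: sum_distrib_left mult.left_commute)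
  qed
  \<comment> \<open>Solving \<open>rel\<close> for \<open>g i j\<close>: \<open>\<alpha>\<close> is
    minus the differential of the eigenvalue and \<open>\<beta>\<close> is the contraction of
    \<open>g\<close> with \<open>a\<close>.\<close>
  define \<alpha> where "\<alpha> = (\<lambda>i. - \<kappa> i / N)"
  define \<beta> where "\<beta> = (\<lambda>j. \<Sum>k<n. a $ k * g j k)"
  have "\<forall>i<n. \<forall>j<n. g i j = \<alpha> i * \<beta> j - \<alpha> j * \<beta> i"
  proof (intro allI impI)
    fix i j assume ij: "i < n" "j < n"
    have "(\<Sum>k<n. a $ k * g k i) = (\<Sum>k<n. - (a $ k * g i k))" using ij by (intro sum.cong refl) (simp add: gs[of i])
    then have eq: "N * g i j + \<kappa> i * (\<Sum>k<n. a $ k * g j k) - \<kappa> j * (\<Sum>k<n. a $ k * g i k) = 0"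
      using rel[OF ij] by (simp add: sum_negf)
    have alg: "y = - ki / N * bj - - kj / N * bi" if "N * y + ki * bj - kj * bi = 0" for y ki kj bi bj :: complex
    proof -
      have "N * y = kj * bi - ki * bj" using that by (simp add: eq_diff_eq)
      then have "y = (kj * bi - ki * bj) / N" using N by (metis nonzero_mult_div_cancel_left)
      then show ?thesis by (simp add: diff_divide_distrib)
    qed
    show "g i j = \<alpha> i * \<beta> j - \<alpha> j * \<beta> i"
      unfolding \<alpha>_def \<beta>_def using alg[OF eq] .
  qed
  then show False using nd[of \<alpha> \<beta>] by (simp add: g_def)
qed

section \<open>Sufficiency\<close>

lemma left_inverse_of_trivial_kernel:
  fixes G :: "'i \<Rightarrow> 'i \<Rightarrow> complex"
  assumes fin: "finite I" and ker: "\<And>z b. \<forall>a\<in>I. (\<Sum>b\<in>I. G a b * z b) = 0 \<Longrightarrow> b \<in> I \<Longrightarrow> z b = 0"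
  obtains Q where "\<And>b b'. b \<in> I \<Longrightarrow> b' \<in> I \<Longrightarrow> (\<Sum>a\<in>I. Q b a * G a b') = (if b = b' then 1 else 0)"
proof -
  define n where "n = card I"
  obtain h where h: "bij_betw h {..<n} I" using ex_bij_betw_nat_finite[OF fin] by (auto simp: n_def atLeast0LessThan)
  define g where "g = the_inv_into {..<n} h"
  have gh: "g (h i) = i" if "i < n" for i using h that by (simp add: g_def the_inv_into_f_f bij_betw_def)
  have hg: "h (g b) = b" "g b < n" if "b \<in> I" for b
    using h that f_the_inv_into_f[of h "{..<n}" b] the_inv_into_into[of h "{..<n}" b] by (auto simp: g_def bij_betw_def)
  have hI: "h i \<in> I" if "i < n" for i using h that by (auto simp: bij_betw_def)
  define A where "A = mat n n (\<lambda>(i, j). G (h i) (h j))"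
  have A: "A \<in> carrier_mat n n" by (simp add: A_def)
  have "det A \<noteq> 0"
  proof
    assume "det A = 0"
    then obtain v where v: "v \<in> carrier_vec n" "v \<noteq> 0\<^sub>v n" "A *\<^sub>v v = 0\<^sub>v n" using det_0_iff_vec_prod_zero[OF A] by blast
    have "(\<Sum>b\<in>I. G a b * v $ g b) = 0" if a: "a \<in> I" for a
    proof -
      have "(\<Sum>b\<in>I. G a b * v $ g b) = (\<Sum>j<n. G a (h j) * v $ g (h j))" by (rule sum.reindex_bij_betw[OF h, symmetric])
      also have "\<dots> = (\<Sum>j<n. A $$ (g a, j) * v $ j)" using hg[OF a] by (intro sum.cong refl) (simp add: A_def gh)
      also have "\<dots> = (A *\<^sub>v v) $ g a" using hg[OF a] A v(1) by (simp add: scalar_prod_def atLeast0LessThan)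
      finally show ?thesis using v(3) hg[OF a] by simp
    qed
    then have "v $ g b = 0" if "b \<in> I" for b using ker[of "\<lambda>b. v $ g b" b] that by blast
    then have "v $ i = 0" if "i < n" for i using that hI gh by metis
    then have "v = 0\<^sub>v n" using v(1) by (intro eq_vecI) auto
    then show False using v(2) by simp
  qed
  then obtain C where C: "C \<in> carrier_mat n n" "C * A = 1\<^sub>m n"
    using det_non_zero_imp_unit[OF A] unfolding Units_def ring_mat_def by auto
  show ?thesis
  proof (rule that[of "\<lambda>b a. C $$ (g b, g a)"])
    fix b b' assume b: "b \<in> I" "b' \<in> I"
    have "(\<Sum>a\<in>I. C $$ (g b, g a) * G a b') = (\<Sum>i<n. C $$ (g b, g (h i)) * G (h i) b')" by (rule sum.reindex_bij_betw[OF h, symmetric])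
    also have "\<dots> = (\<Sum>i<n. C $$ (g b, i) * A $$ (i, g b'))" using hg b by (intro sum.cong refl) (simp add: A_def gh)
    also have "\<dots> = (C * A) $$ (g b, g b')" using hg b A C(1) by (simp add: scalar_prod_def atLeast0LessThan)
    also have "\<dots> = (if b = b' then 1 else 0)" using hg b C(2) by (metis index_one_mat(1))
    finally show "(\<Sum>a\<in>I. C $$ (g b, g a) * G a b') = (if b = b' then 1 else 0)" .
  qed
qed

text \<open>Reversing the coefficients turns the Hankel form \<open>x (i + j)\<close> into
  multiplication of power series followed by reading off the coefficient
  \<open>m - 1\<close>.\<close>

lemma fps_nth_convolution:
  fixes X \<beta> :: "complex fps"
  assumes X: "\<And>t. t < m \<Longrightarrow> fps_nth X t = x (m - 1 - t)" and m: "m > 0"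
  shows "(\<Sum>j<m. (if i + j < m then x (i + j) else 0) * fps_nth \<beta> j) = fps_nth (X * fps_X ^ i * \<beta>) (m - 1)"
proof -
  have "fps_nth (X * fps_X ^ i * \<beta>) (m - 1) = fps_nth (fps_X ^ i * (\<beta> * X)) (m - 1)" by (simp add: mult_ac)
  also have "\<dots> = (if m - 1 < i then 0 else fps_nth (\<beta> * X) (m - 1 - i))" by (simp add: fps_X_power_mult_nth)
  also have "\<dots> = (\<Sum>j<m. (if i + j < m then x (i + j) else 0) * fps_nth \<beta> j)"
  proof (cases "m - 1 < i")
    case False
    then have "fps_nth (\<beta> * X) (m - 1 - i) = (\<Sum>j\<in>{0..m - 1 - i}. x (i + j) * fps_nth \<beta> j)"
      unfolding fps_mult_nth using m by (intro sum.cong refl) (auto simp: X mult.commute)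
    also have "\<dots> = (\<Sum>j<m. (if i + j < m then x (i + j) else 0) * fps_nth \<beta> j)"
      using False m by (intro sum.mono_neutral_cong_left) auto
    finally show ?thesis using False by simp
  next
    case True
    then have "(\<Sum>j<m. (if i + j < m then x (i + j) else 0) * fps_nth \<beta> j) = 0" by (intro sum.neutral) auto
    then show ?thesis using True by simp
  qed
  finally show ?thesis ..
qed

text \<open>Reading off the top coefficient is a nondegenerate trace form on
  \<open>C[t]/t^m\<close>: the choice \<open>i = m - 1 - j\<close> isolates the coefficient
  \<open>j\<close> of \<open>\<beta> * A\<close>, and \<open>A\<close> is a unit.\<close>

lemma fps_pairing_nondegenerate:
  fixes A \<beta> :: "complex fps"
  assumes "fps_nth A 0 \<noteq> 0" "\<And>i. i < m \<Longrightarrow> fps_nth (A * fps_X ^ i * \<beta>) (m - 1) = 0" "j < m"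
  shows "fps_nth \<beta> j = 0"
  using assms(3)
proof (induction j rule: less_induct)
  case (less j)
  have "fps_nth (fps_X ^ (m - 1 - j) * (\<beta> * A)) (m - 1) = 0" using assms(2)[of "m - 1 - j"] less.prems by (simp add: mult_ac)
  moreover have "\<not> m - 1 < m - 1 - j" "m - 1 - (m - 1 - j) = j" using less.prems by auto
  ultimately have "fps_nth (\<beta> * A) j = 0" by (simp only: fps_X_power_mult_nth if_False)
  moreover have "fps_nth (\<beta> * A) j = (\<Sum>t\<in>{0..j}. if t = j then fps_nth \<beta> j * fps_nth A 0 else 0)"
    unfolding fps_mult_nth using less by (intro sum.cong refl) auto
  ultimately show ?case using assms(1) by simp
qed

text \<open>For \<open>\<nu>\<close> of order exactly 1 the powers are triangular with respect to
  the monomials. For \<open>m = 1\<close> only \<open>\<nu>^0\<close> occurs, so the linear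
  coefficient is constrained from \<open>m = 2\<close> on.\<close>

lemma fps_power_independent:
  fixes \<nu> :: "complex fps"
  assumes \<nu>: "fps_nth \<nu> 0 = 0" "m \<ge> 2 \<Longrightarrow> fps_nth \<nu> 1 \<noteq> 0"
    and z: "\<And>j. j < m \<Longrightarrow> fps_nth (\<Sum>r<m. fps_const (z r) * \<nu> ^ r) j = 0" and r: "r < m"
  shows "z r = 0"
  using r
proof (induction r rule: less_induct)
  case (less r)
  have low: "fps_nth (\<nu> ^ s) t = 0" if "t < s" for s t using \<nu>(1) that by (simp add: startsby_zero_power_prefix)
  have "0 = (\<Sum>s<m. z s * fps_nth (\<nu> ^ s) r)" using z[OF less.prems] by (simp add: fps_sum_nth)
  also have "\<dots> = (\<Sum>s<m. if s = r then z r * fps_nth (\<nu> ^ r) r else 0)"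
  proof (intro sum.cong refl)
    fix s assume s: "s \<in> {..<m}"
    show "z s * fps_nth (\<nu> ^ s) r = (if s = r then z r * fps_nth (\<nu> ^ r) r else 0)"
      using less.IH[of s] s low[of r s] by (cases s r rule: linorder_cases) auto
  qed
  also have "\<dots> = z r * fps_nth \<nu> 1 ^ r" using less.prems \<nu>(1) by (simp add: startsby_zero_power_nth_same)
  finally show ?case using \<nu>(2) less.prems by (cases r) auto
qed

text \<open>All tuples are treated at once: an index \<open>k < K\<close> stands for one Jordan
  block of half-size \<open>m k\<close>, and \<open>hd k\<close> for the largest block of its tuple.
  The strict inequality encodes uniqueness of the maximum.\<close>

locale block_data =
  fixes K :: nat and m hd :: "nat \<Rightarrow> nat"
  assumes hd_less: "k < K \<Longrightarrow> hd k < K"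
    and hd_hd: "k < K \<Longrightarrow> hd (hd k) = hd k"
    and m_pos: "k < K \<Longrightarrow> 0 < m k"
    and m_less: "k < K \<Longrightarrow> hd k \<noteq> k \<Longrightarrow> m k < m (hd k)"
begin

definition half :: "(nat \<times> nat) set" where
  "half = (SIGMA k:{..<K}. {..<m k})"

text \<open>With \<open>t\<close> the shift, the head \<open>k\<close> of a tuple acts as multiplication by \<open>t\<^sup>i\<close> on all modules
  \<open>\<complex>[t]/t\<^bsup>m l\<^esup>\<close> of its tuple; the other \<open>k\<close> map their own module into the one of the head,
  via the embedding \<open>\<complex>[t]/t\<^bsup>m k\<^esup> \<cong> t\<^bsup>m (hd k) - m k\<^esup> \<complex>[t]/t\<^bsup>m (hd k)\<^esup>\<close>.\<close>

fun act :: "nat \<times> nat \<Rightarrow> nat \<times> nat \<Rightarrow> (nat \<times> nat) option" where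
  "act (k, i) (l, j) =
     (if i + j < m l then
        if hd k = k then (if hd l = k then Some (l, i + j) else None)
        else if l = k then Some (hd k, i + j + (m (hd k) - m k)) else None
      else None)"

lemma finite_half[simp]: "finite half"
  by (simp add: half_def)

lemma mem_half: "(k, i) \<in> half \<longleftrightarrow> k < K \<and> i < m k"
  by (simp add: half_def)

lemma act_half: "a \<in> half \<Longrightarrow> b \<in> half \<Longrightarrow> act a b = Some b' \<Longrightarrow> b' \<in> half"
proof -
  assume *: "a \<in> half" "b \<in> half" "act a b = Some b'"
  obtain k i l j where [simp]: "a = (k, i)" "b = (l, j)" by (cases a; cases b) auto
  have k: "k < K" "l < K" using * by (simp_all add: mem_half)
  show "b' \<in> half"
  proof (cases "hd k = k")
    case True
    then have "i + j < m l" "b' = (l, i + j)" using *(3) by (simp_all split: if_splits)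
    then show ?thesis using k by (simp add: mem_half)
  next
    case False
    then have "i + j < m k" "b' = (hd k, i + j + (m (hd k) - m k))" using *(3) by (auto split: if_splits)
    then show ?thesis using hd_less[OF k(1)] m_less[OF k(1) False] by (simp add: mem_half)
  qed
qed

text \<open>Two non-heads compose to nothing, as the first lands in a head module, on which no
  non-head acts. A head commutes with a non-head because the shift by \<open>m (hd k) - m k\<close>
  turns the truncation at \<open>m k\<close> into the one at \<open>m (hd k)\<close>.\<close>

lemma act_commute:
  assumes "a \<in> half" "a' \<in> half" "b \<in> half"
  shows "Option.bind (act a b) (act a') = Option.bind (act a' b) (act a)"
proof -
  obtain k i k' i' l j where [simp]: "a = (k, i)" "a' = (k', i')" "b = (l, j)" by (cases a; cases a'; cases b) auto
  have k: "k < K" "k' < K" "l < K" using assms by (auto simp: mem_half)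
  show ?thesis
  proof (cases "hd k = k"; cases "hd k' = k'")
    assume "hd k = k" "hd k' = k'"
    then show ?thesis by (simp add: add_ac)
  next
    assume h: "hd k = k" "hd k' \<noteq> k'"
    then show ?thesis using hd_hd[OF k(2)] m_less[OF k(2)] by (auto simp: add_ac)
  next
    assume h: "hd k \<noteq> k" "hd k' = k'"
    then show ?thesis using hd_hd[OF k(1)] m_less[OF k(1)] by (auto simp: add_ac)
  next
    assume h: "hd k \<noteq> k" "hd k' \<noteq> k'"
    then have "k' \<noteq> hd k" "k \<noteq> hd k'" using hd_hd[OF k(1)] hd_hd[OF k(2)] by auto
    then show ?thesis using h by simp
  qed
qed

definition form :: "(nat \<times> nat \<Rightarrow> complex) \<Rightarrow> nat \<times> nat \<Rightarrow> nat \<times> nat \<Rightarrow> complex" where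
  "form x a b = (case act a b of None \<Rightarrow> 0 | Some b' \<Rightarrow> x b')"

text \<open>The second argument of \<open>form\<close> is a family of power series of which only the
  coefficients below \<open>m l\<close> count; units can thus be inverted without
  truncating.\<close>

definition pairing :: "(nat \<times> nat \<Rightarrow> complex) \<Rightarrow> nat \<times> nat \<Rightarrow> (nat \<Rightarrow> complex fps) \<Rightarrow> complex" where
  "pairing x a \<beta> = (\<Sum>b\<in>half. form x a b * fps_nth (\<beta> (fst b)) (snd b))"

text \<open>Reversed, so that the top coordinate becomes the constant term: invertibility is the
  nonvanishing of that coordinate.\<close>

definition rev_fps :: "(nat \<times> nat \<Rightarrow> complex) \<Rightarrow> nat \<Rightarrow> complex fps" where
  "rev_fps x l = Abs_fps (\<lambda>t. if t < m l then x (l, m l - 1 - t) else 0)"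

lemma sum_half: "(\<Sum>b\<in>half. F b) = (\<Sum>l<K. \<Sum>j<m l. F (l, j))"
  unfolding half_def by (subst sum.Sigma) (auto simp: split_def)

lemma pairing_head:
  assumes k: "k = hd k" "i < m k"
  shows "pairing x (k, i) \<beta> = (\<Sum>l\<in>{l. l < K \<and> hd l = k}. fps_nth (rev_fps x l * fps_X ^ i * \<beta> l) (m l - 1))"
proof -
  have "pairing x (k, i) \<beta> = (\<Sum>l<K. if hd l = k then \<Sum>j<m l. (if i + j < m l then x (l, i + j) else 0) * fps_nth (\<beta> l) j else 0)"
    unfolding pairing_def sum_half by (intro sum.cong refl) (use k(1) in \<open>auto simp: form_def intro!: sum.cong sum.neutral\<close>)
  also have "\<dots> = (\<Sum>l<K. if hd l = k then fps_nth (rev_fps x l * fps_X ^ i * \<beta> l) (m l - 1) else 0)"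
    using m_pos by (intro sum.cong refl if_cong fps_nth_convolution[where x = "\<lambda>j. x (_, j)"]) (auto simp: rev_fps_def)
  also have "\<dots> = (\<Sum>l\<in>{l. l < K \<and> hd l = k}. fps_nth (rev_fps x l * fps_X ^ i * \<beta> l) (m l - 1))"
    by (intro sum.mono_neutral_cong_right) auto
  finally show ?thesis .
qed

text \<open>Reversal absorbs the embedding shift: the coordinates that occur are the first
  \<open>m k\<close> coefficients of \<open>rev_fps x (hd k)\<close>. A smaller block therefore sees
  the same power series, and hence the same eigenvalue, as its head.\<close>

lemma pairing_nonhead:
  assumes k: "k < K" "k \<noteq> hd k" "i < m k"
  shows "pairing x (k, i) \<beta> = fps_nth (rev_fps x (hd k) * fps_X ^ i * \<beta> k) (m k - 1)"
proof -
  let ?d = "m (hd k) - m k"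
  have "pairing x (k, i) \<beta> = (\<Sum>l<K. if l = k then \<Sum>j<m k. (if i + j < m k then x (hd k, i + j + ?d) else 0) * fps_nth (\<beta> k) j else 0)"
    unfolding pairing_def sum_half by (intro sum.cong refl) (use k in \<open>auto simp: form_def intro!: sum.cong sum.neutral\<close>)
  also have "\<dots> = (\<Sum>j<m k. (if i + j < m k then x (hd k, i + j + ?d) else 0) * fps_nth (\<beta> k) j)"
    using k by simp
  also have "\<dots> = fps_nth (rev_fps x (hd k) * fps_X ^ i * \<beta> k) (m k - 1)"
    using m_pos[OF k(1)] m_less[OF k(1)] k
    by (intro fps_nth_convolution[where x = "\<lambda>j. x (hd k, j + ?d)"]) (auto simp: rev_fps_def)
  finally show ?thesis .
qed

lemma pairing_sum: "finite S \<Longrightarrow> pairing x a (\<lambda>l. \<Sum>s\<in>S. fps_const (z s) * f s l) = (\<Sum>s\<in>S. z s * pairing x a (f s))"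
  by (simp add: pairing_def fps_sum_nth sum_distrib_left mult.left_commute sum.swap[of _ half])

lemma pairing_cong: "(\<And>l j. l < K \<Longrightarrow> j < m l \<Longrightarrow> fps_nth (\<beta> l) j = fps_nth (\<beta>' l) j) \<Longrightarrow> pairing x a \<beta> = pairing x a \<beta>'"
  unfolding pairing_def by (intro sum.cong refl) (auto simp: half_def)

text \<open>The first condition makes \<open>rev_fps y h\<close> a unit; the second says that the
  quotient of \<open>rev_fps x h\<close> by it has a nonzero linear coefficient.\<close>

definition generic :: "(nat \<times> nat \<Rightarrow> complex) \<Rightarrow> (nat \<times> nat \<Rightarrow> complex) \<Rightarrow> bool" where
  "generic x y \<longleftrightarrow> (\<forall>h<K. hd h = h \<longrightarrow> y (h, m h - 1) \<noteq> 0 \<and>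
     (2 \<le> m h \<longrightarrow> x (h, m h - 2) * y (h, m h - 1) - x (h, m h - 1) * y (h, m h - 2) \<noteq> 0))"

definition eig :: "(nat \<times> nat \<Rightarrow> complex) \<Rightarrow> (nat \<times> nat \<Rightarrow> complex) \<Rightarrow> nat \<Rightarrow> complex" where
  "eig x y k = x (hd k, m (hd k) - 1) / y (hd k, m (hd k) - 1)"

section \<open>Jordan chains at a generic point\<close>

context
  fixes x y :: "nat \<times> nat \<Rightarrow> complex"
  assumes gen: "generic x y"
begin

definition ratio :: "nat \<Rightarrow> complex fps" where
  "ratio h = rev_fps x h * inverse (rev_fps y h)"

definition nilp :: "nat \<Rightarrow> complex fps" where
  "nilp h = ratio h - fps_const (eig x y h)"

text \<open>Solves \<open>corr_nilp\<close>: multiplied by \<open>nilp (hd l)\<close> and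
  \<open>rev_fps y (hd l)\<close> it gives the coupling defect of block \<open>l\<close>. Since
  \<open>nilp (hd l)\<close> is a unit times \<open>fps_X\<close>, the division costs one power of
  \<open>fps_X\<close>, whence the \<open>- 1\<close> in the exponent.\<close>

definition corr :: "nat \<Rightarrow> complex fps" where
  "corr l = fps_X ^ (m (hd l) - m l - 1) * (rev_fps x l - ratio (hd l) * rev_fps y l) *
     inverse (rev_fps y (hd l)) * inverse (fps_shift 1 (nilp (hd l)))"

text \<open>The correction term makes the chain of a smaller block end after \<open>m l\<close> steps: the recursion
  operator sends the generator \<open>q\<close> to \<open>ratio (hd l) q\<close> plus a component in the head module.\<close>

definition chain :: "nat \<Rightarrow> nat \<Rightarrow> nat \<Rightarrow> complex fps" where
  "chain l r l' = (if l' = l then nilp (hd l) ^ r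
     else if l' = hd l then fps_const (of_nat r - of_nat (m l)) * nilp (hd l) ^ r * corr l else 0)"

lemma rev_fps_0: "h < K \<Longrightarrow> fps_nth (rev_fps z h) 0 = z (h, m h - 1)"
  using m_pos[of h] by (simp add: rev_fps_def)

lemma rev_fps_head:
  assumes "h < K" "hd h = h"
  shows "fps_nth (rev_fps y h) 0 \<noteq> 0" "ratio h * rev_fps y h = rev_fps x h"
    "fps_nth (nilp h) 0 = 0" "2 \<le> m h \<Longrightarrow> fps_nth (nilp h) 1 \<noteq> 0"
proof -
  show y0: "fps_nth (rev_fps y h) 0 \<noteq> 0" using gen assms by (simp add: generic_def rev_fps_0)
  then show rxy: "ratio h * rev_fps y h = rev_fps x h"
    by (simp add: ratio_def mult.assoc inverse_mult_eq_1)
  have r0: "fps_nth (ratio h) 0 = eig x y h"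
    using y0 assms by (simp add: ratio_def eig_def rev_fps_0 field_simps)
  then show "fps_nth (nilp h) 0 = 0" by (simp add: nilp_def)
  assume m: "2 \<le> m h"
  have "fps_nth (rev_fps x h) 1 = fps_nth (ratio h) 0 * fps_nth (rev_fps y h) 1 + fps_nth (ratio h) 1 * fps_nth (rev_fps y h) 0"
    by (simp add: rxy[symmetric] fps_mult_nth)
  moreover have "fps_nth (rev_fps z h) 1 = z (h, m h - 2)" for z using m by (simp add: rev_fps_def numeral_2_eq_2)
  ultimately have "x (h, m h - 2) = eig x y h * y (h, m h - 2) + fps_nth (ratio h) 1 * y (h, m h - 1)"
    using assms by (simp add: r0 rev_fps_0)
  moreover have "eig x y h * y (h, m h - 1) = x (h, m h - 1)" using y0 assms by (simp add: eig_def rev_fps_0)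
  moreover have "p * d - q * b = s * (d * d)" if "p = e * b + s * d" "e * d = q" for p q b d e s :: complex
    unfolding that(1) that(2)[symmetric] by (simp add: algebra_simps)
  ultimately have "x (h, m h - 2) * y (h, m h - 1) - x (h, m h - 1) * y (h, m h - 2) = fps_nth (ratio h) 1 * (y (h, m h - 1) * y (h, m h - 1))"
    by blast
  then show "fps_nth (nilp h) 1 \<noteq> 0" using gen assms m by (auto simp: generic_def nilp_def)
qed

lemma corr_nilp:
  assumes "l < K" "hd l \<noteq> l"
  shows "corr l * nilp (hd l) * rev_fps y (hd l) = fps_X ^ (m (hd l) - m l) * (rev_fps x l - ratio (hd l) * rev_fps y l)"
proof -
  let ?h = "hd l"
  have h: "?h < K" "hd ?h = ?h" using assms hd_less hd_hd by auto
  have m: "m l < m ?h" "0 < m l" using m_less m_pos assms by auto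
  define \<nu> where "\<nu> = fps_shift 1 (nilp ?h)"
  have corr: "corr l = fps_X ^ (m ?h - m l - 1) * (rev_fps x l - ratio ?h * rev_fps y l) * inverse (rev_fps y ?h) * inverse \<nu>"
    by (simp only: corr_def \<nu>_def)
  have \<nu>: "nilp ?h = \<nu> * fps_X" unfolding \<nu>_def using rev_fps_head(3)[OF h] by (intro fps_ext) auto
  have "fps_nth \<nu> 0 \<noteq> 0" using rev_fps_head(4)[OF h] m by (simp add: \<nu>_def)
  then have i: "inverse \<nu> * \<nu> = 1" by (rule inverse_mult_eq_1)
  have j: "inverse (rev_fps y ?h) * rev_fps y ?h = 1" by (rule inverse_mult_eq_1[OF rev_fps_head(1)[OF h]])
  have "m ?h - m l = Suc (m ?h - m l - 1)" using m by simp
  then have X: "fps_X ^ (m ?h - m l) = fps_X * (fps_X ^ (m ?h - m l - 1) :: complex fps)" by (metis power_Suc)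
  have "corr l * nilp ?h * rev_fps y ?h = (fps_X ^ (m ?h - m l - 1) * fps_X) * (rev_fps x l - ratio ?h * rev_fps y l) *
     (inverse (rev_fps y ?h) * rev_fps y ?h) * (inverse \<nu> * \<nu>)"
    unfolding corr \<nu> by (simp only: mult_ac)
  then show ?thesis unfolding i j X by (simp only: mult_ac mult_1_right mult_1_left)
qed

text \<open>In the head equation of a smaller block, each step creates one copy of the coupling
  defect. It is accounted for by the coefficient \<open>of_nat r - of_nat (m l)\<close> in
  \<open>chain\<close>, which grows by 1 with \<open>r\<close>.\<close>

lemma pairing_chain_step:
  assumes a: "a \<in> half" and l: "l < K"
  shows "pairing x a (chain l r) = eig x y l * pairing y a (chain l r) + pairing y a (chain l (Suc r))"
proof -
  obtain k i where [simp]: "a = (k, i)" by (cases a)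
  have k: "k < K" "i < m k" using a by (auto simp: mem_half)
  let ?h = "hd l"
  have h: "?h < K" "hd ?h = ?h" using l hd_less hd_hd by auto
  define \<nu> A where "\<nu> = nilp ?h" and "A = rev_fps y ?h"
  have eigh: "eig x y ?h = eig x y l" by (simp add: eig_def h)
  have X: "rev_fps x ?h = (fps_const (eig x y l) + \<nu>) * A"
    unfolding \<nu>_def A_def nilp_def eigh by (simp add: rev_fps_head(2)[OF h])
  have "rev_fps x ?h * fps_X ^ i * \<nu> ^ r = fps_const (eig x y l) * (A * fps_X ^ i * \<nu> ^ r) + A * fps_X ^ i * \<nu> ^ Suc r"
    unfolding X by (simp add: algebra_simps)
  from arg_cong[OF this, of "\<lambda>f. fps_nth f n" for n]
  have head_step: "fps_nth (rev_fps x ?h * fps_X ^ i * \<nu> ^ r) n = eig x y l * fps_nth (A * fps_X ^ i * \<nu> ^ r) n + fps_nth (A * fps_X ^ i * \<nu> ^ Suc r) n" for n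
    by (simp only: fps_add_nth fps_mult_left_const_nth)
  show ?thesis
  proof (cases "k = hd k")
    case False
    show ?thesis
    proof (cases "k = l")
      case True
      show ?thesis using head_step True False k unfolding \<nu>_def A_def by (simp add: pairing_nonhead chain_def)
    next
      case kl: False
      then have "chain l r k = 0" for r using False h by (auto simp: chain_def)
      then show ?thesis using False k by (simp add: pairing_nonhead)
    qed
  next
    case True
    show ?thesis
    proof (cases "?h = k")
      case kh: False
      have z: "chain l r l' = 0" if "hd l' = k" for r l' using that kh h by (auto simp: chain_def)
      show ?thesis using True k by (simp add: pairing_head z)
    next
      case kh: True
      show ?thesis
      proof (cases "l = k")
        case lk: True
        have z: "pairing w (k, i) (chain l r) = fps_nth (rev_fps w ?h * fps_X ^ i * \<nu> ^ r) (m ?h - 1)" for w r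
        proof -
          have "pairing w (k, i) (chain l r) = (\<Sum>l'\<in>{l'. l' < K \<and> hd l' = k}. if l' = k then fps_nth (rev_fps w k * fps_X ^ i * \<nu> ^ r) (m k - 1) else 0)"
            unfolding pairing_head[OF True k(2)] using lk kh by (intro sum.cong refl) (auto simp: chain_def \<nu>_def)
          then show ?thesis using k True kh lk by simp
        qed
        show ?thesis unfolding \<open>a = (k, i)\<close> z by (simp only: head_step A_def[symmetric])
      next
        case lk: False
        have nl: "?h \<noteq> l" using lk kh by simp
        let ?c = "\<lambda>r. fps_const (of_nat r - of_nat (m l)) :: complex fps"
        have z: "pairing w (k, i) (chain l r) = fps_nth (rev_fps w l * fps_X ^ i * \<nu> ^ r) (m l - 1) +
            fps_nth (rev_fps w ?h * fps_X ^ i * (?c r * \<nu> ^ r * corr l)) (m ?h - 1)" for w r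
        proof -
          have "pairing w (k, i) (chain l r) = (\<Sum>l'\<in>{l, k}. fps_nth (rev_fps w l' * fps_X ^ i * chain l r l') (m l' - 1))"
            unfolding pairing_head[OF True k(2)] using lk kh k l True by (intro sum.mono_neutral_right) (auto simp: chain_def)
          then show ?thesis using lk kh nl by (simp add: chain_def \<nu>_def)
        qed
        have sh: "fps_nth f (m l - 1) = fps_nth (fps_X ^ (m ?h - m l) * f) (m ?h - 1)" for f :: "complex fps"
          using m_less[OF l nl] m_pos[OF l] by (simp add: fps_X_power_mult_nth)
        define W where "W = fps_X ^ (m ?h - m l) * (rev_fps x l - ratio ?h * rev_fps y l)"
        have W: "W = corr l * \<nu> * A" unfolding W_def A_def \<nu>_def by (rule corr_nilp[OF l nl, symmetric])
        have R: "ratio ?h = fps_const (eig x y l) + \<nu>" by (simp add: \<nu>_def nilp_def eigh)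
        define B where "B = fps_X ^ i * \<nu> ^ r"
        have cs: "?c (Suc r) = ?c r + 1" by (rule fps_ext) simp
        have "fps_X ^ (m ?h - m l) * (rev_fps x l * B) + rev_fps x ?h * (?c r * B * corr l) =
          fps_const (eig x y l) * (fps_X ^ (m ?h - m l) * (rev_fps y l * B) + A * (?c r * B * corr l)) +
          (fps_X ^ (m ?h - m l) * (rev_fps y l * (B * \<nu>)) + A * (?c (Suc r) * (B * \<nu>) * corr l))"
        proof -
          have "fps_X ^ (m ?h - m l) * (rev_fps x l * B) = W * B + fps_X ^ (m ?h - m l) * (ratio ?h * rev_fps y l * B)"
            by (simp add: W_def algebra_simps)
          then show ?thesis unfolding W R X cs by (simp add: algebra_simps)
        qed
        from arg_cong[OF this, of "\<lambda>f. fps_nth f (m ?h - 1)"]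
        show ?thesis unfolding \<open>a = (k, i)\<close> z sh B_def A_def[symmetric] by (simp add: mult_ac)
      qed
    qed
  qed
qed

text \<open>At \<open>r = m l\<close> the own component has order at least \<open>m l\<close> and is
  invisible, while the coefficient of the correction is 0.\<close>

lemma pairing_chain_end: "l < K \<Longrightarrow> pairing y a (chain l (m l)) = 0"
proof -
  assume l: "l < K"
  have h: "hd l < K" "hd (hd l) = hd l" using l hd_less hd_hd by auto
  have "pairing y a (chain l (m l)) = pairing y a (\<lambda>_. 0)"
    using rev_fps_head(3)[OF h] by (intro pairing_cong) (auto simp: chain_def startsby_zero_power_prefix)
  then show ?thesis by (simp add: pairing_def)
qed

text \<open>Numbered backwards along the chain, to match the superdiagonal of
  \<open>jordan_block\<close>: the successor of vector \<open>j\<close> is vector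
  \<open>j - 1\<close>.\<close>

definition basis_vec :: "nat \<times> nat \<Rightarrow> nat \<Rightarrow> complex fps" where
  "basis_vec b = chain (fst b) (m (fst b) - 1 - snd b)"

text \<open>The system is block triangular: the equation of a non-head sees only its own component,
  so these unknowns vanish first; the head equations then see only the head component.\<close>

lemma pairing_basis_trivial_kernel:
  assumes z: "\<And>a. a \<in> half \<Longrightarrow> (\<Sum>b\<in>half. pairing y a (basis_vec b) * z b) = 0" and b: "b \<in> half"
  shows "z b = 0"
proof -
  define \<beta> where "\<beta> = (\<lambda>l. \<Sum>b\<in>half. fps_const (z b) * basis_vec b l)"
  have p0: "pairing y a \<beta> = 0" if "a \<in> half" for a
    using z[OF that] unfolding \<beta>_def by (subst pairing_sum) (auto simp: mult.commute)
  \<comment> \<open>Component \<open>k\<close> of the combination receives vectors from block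
    \<open>k\<close> and corrections from blocks with head \<open>k\<close>. Once the latter are
    gone, powers of \<open>nilp (hd k)\<close> remain and are independent.\<close>
  have own: "z (k, j) = 0" if k: "k < K" and j: "j < m k"
    and other: "\<And>l j. l < K \<Longrightarrow> j < m l \<Longrightarrow> l \<noteq> k \<Longrightarrow> hd l = k \<Longrightarrow> z (l, j) = 0"
    and nth: "\<And>j. j < m k \<Longrightarrow> fps_nth (\<beta> k) j = 0" for k j
  proof -
    have h: "hd k < K" "hd (hd k) = hd k" using k hd_less hd_hd by auto
    have "\<beta> k = (\<Sum>l<K. \<Sum>j<m l. fps_const (z (l, j)) * basis_vec (l, j) k)" unfolding \<beta>_def by (rule sum_half)
    also have "\<dots> = (\<Sum>l<K. if l = k then \<Sum>j<m k. fps_const (z (k, j)) * nilp (hd k) ^ (m k - 1 - j) else 0)"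
    proof (intro sum.cong refl)
      fix l assume "l \<in> {..<K}"
      then show "(\<Sum>j<m l. fps_const (z (l, j)) * basis_vec (l, j) k) = (if l = k then \<Sum>j<m k. fps_const (z (k, j)) * nilp (hd k) ^ (m k - 1 - j) else 0)"
        using other[of l] by (auto simp: basis_vec_def chain_def intro!: sum.neutral)
    qed
    also have "\<dots> = (\<Sum>j<m k. fps_const (z (k, j)) * nilp (hd k) ^ (m k - 1 - j))" using k by simp
    also have "\<dots> = (\<Sum>r<m k. fps_const (z (k, m k - 1 - r)) * nilp (hd k) ^ r)"
      by (rule sum.reindex_bij_witness[of _ "\<lambda>r. m k - 1 - r" "\<lambda>r. m k - 1 - r"]) auto
    finally have \<beta>k: "\<beta> k = (\<Sum>r<m k. fps_const (z (k, m k - 1 - r)) * nilp (hd k) ^ r)" .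
    have m2: "2 \<le> m (hd k)" if "2 \<le> m k" using that m_less[OF k] by (cases "hd k = k") auto
    have "z (k, m k - 1 - (m k - 1 - j)) = 0"
    proof (rule fps_power_independent[where \<nu> = "nilp (hd k)" and m = "m k" and z = "\<lambda>r. z (k, m k - 1 - r)"])
      show "fps_nth (\<Sum>r<m k. fps_const (z (k, m k - 1 - r)) * nilp (hd k) ^ r) j = 0" if "j < m k" for j
        using nth[OF that] unfolding \<beta>k .
    qed (use rev_fps_head(3,4)[OF h] m2 j in auto)
    then show ?thesis using j by simp
  qed
  have nonhead: "z (k, j) = 0" if k: "k < K" "j < m k" "k \<noteq> hd k" for k j
  proof (rule own[OF k(1,2)])
    show "z (l, j') = 0" if "hd l = k" "l < K" for l j' using that k(3) hd_hd by metis
    fix j' assume j': "j' < m k"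
    have h: "hd k < K" "hd (hd k) = hd k" using k hd_less hd_hd by auto
    show "fps_nth (\<beta> k) j' = 0"
    proof (rule fps_pairing_nondegenerate[OF rev_fps_head(1)[OF h] _ j'])
      fix i assume "i < m k"
      then show "fps_nth (rev_fps y (hd k) * fps_X ^ i * \<beta> k) (m k - 1) = 0"
        using p0[of "(k, i)"] k by (simp add: mem_half pairing_nonhead)
    qed
  qed
  have head: "z (k, j) = 0" if k: "k < K" "j < m k" "k = hd k" for k j
  proof (rule own[OF k(1,2)])
    show "z (l, j') = 0" if "l < K" "j' < m l" "l \<noteq> k" "hd l = k" for l j' using nonhead that by metis
    fix j' assume j': "j' < m k"
    have \<beta>0: "\<beta> l = 0" if l: "l < K" "hd l = k" "l \<noteq> k" for l
    proof -
      have "fps_const (z b) * basis_vec b l = 0" if "b \<in> half" for b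
      proof (cases "fst b = l")
        case True
        then show ?thesis using nonhead[of l "snd b"] that l by (cases b) (auto simp: mem_half)
      next
        case False
        have "hd (fst b) \<noteq> l" using hd_hd[of "fst b"] that l by (cases b) (auto simp: mem_half)
        then show ?thesis using False by (simp add: basis_vec_def chain_def)
      qed
      then show ?thesis unfolding \<beta>_def by (intro sum.neutral) auto
    qed
    show "fps_nth (\<beta> k) j' = 0"
    proof (rule fps_pairing_nondegenerate[OF rev_fps_head(1)[OF k(1) k(3)[symmetric]] _ j'])
      fix i assume i: "i < m k"
      have "pairing y (k, i) \<beta> = (\<Sum>l\<in>{l. l < K \<and> hd l = k}. if l = k then fps_nth (rev_fps y k * fps_X ^ i * \<beta> k) (m k - 1) else 0)"
        unfolding pairing_head[OF k(3) i] using \<beta>0 by (intro sum.cong refl) auto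
      then show "fps_nth (rev_fps y k * fps_X ^ i * \<beta> k) (m k - 1) = 0"
        using p0[of "(k, i)"] k i by (simp add: mem_half)
    qed
  qed
  show ?thesis using b head nonhead by (cases b) (metis mem_half)
qed

end

abbreviation transformed where
  "transformed Q w R b b' \<equiv> \<Sum>a\<in>half. \<Sum>a'\<in>half. Q b a * form w a a' * R a' b'"

text \<open>\<open>R\<close> takes the chains as a basis of the module, \<open>Q\<close> the basis
  of the acting side dual to them under the form of \<open>y\<close>. That form becomes the
  identity, and the form of \<open>x\<close> displays the recursion of the chains.\<close>

lemma form_normal_form:
  assumes gen: "generic x y"
  shows "\<exists>Q R. \<forall>b\<in>half. \<forall>b'\<in>half.
    transformed Q y R b b' = (if b = b' then 1 else 0) \<and>
    transformed Q x R b b' =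
      (if fst b = fst b' then jor_ent (eig x y (fst b)) (m (fst b)) (snd b) (snd b') else 0)"
proof -
  define R where "R = (\<lambda>a b. fps_nth (basis_vec x y b (fst a)) (snd a))"
  define G where "G = (\<lambda>a b. pairing y a (basis_vec x y b))"
  obtain Q where Q: "\<And>b b'. b \<in> half \<Longrightarrow> b' \<in> half \<Longrightarrow> (\<Sum>a\<in>half. Q b a * G a b') = (if b = b' then 1 else 0)"
    by (rule left_inverse_of_trivial_kernel[of half G]) (auto simp: G_def intro: pairing_basis_trivial_kernel[OF gen])
  have GR: "(\<Sum>a'\<in>half. form w a a' * R a' b) = pairing w a (basis_vec x y b)" for w a b
    by (simp add: pairing_def R_def)
  have MR: "transformed Q w R b b' = (\<Sum>a\<in>half. Q b a * pairing w a (basis_vec x y b'))" for w b b'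
    unfolding GR[symmetric] by (simp add: sum_distrib_left mult.assoc)
  show ?thesis
  proof (rule exI[of _ Q], rule exI[of _ R], intro ballI conjI)
    fix b b' assume b: "b \<in> half" "b' \<in> half"
    show "transformed Q y R b b' = (if b = b' then 1 else 0)"
      unfolding MR using Q[OF b] by (simp add: G_def)
    obtain k i l j where [simp]: "b = (k, i)" "b' = (l, j)" by (cases b; cases b') auto
    have l: "l < K" "j < m l" using b by (auto simp: mem_half)
    \<comment> \<open>The case \<open>j = 0\<close> is the end of the chain, where the successor
      pairs to zero.\<close>
    have step: "pairing x a (basis_vec x y (l, j)) = eig x y l * G a (l, j) + (if 0 < j then G a (l, j - 1) else 0)" if "a \<in> half" for a
    proof -
      have "m l - 1 - (j - 1) = Suc (m l - 1 - j)" if "0 < j" using that l by simp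
      moreover have "Suc (m l - 1 - j) = m l" if "j = 0" using that l by simp
      ultimately show ?thesis
        using pairing_chain_step[OF gen that l(1), of "m l - 1 - j"] pairing_chain_end[OF gen l(1), of a]
        by (auto simp: G_def basis_vec_def[OF gen])
    qed
    have "(\<Sum>a\<in>half. Q b a * pairing x a (basis_vec x y b')) =
      eig x y l * (\<Sum>a\<in>half. Q b a * G a (l, j)) + (if 0 < j then (\<Sum>a\<in>half. Q b a * G a (l, j - 1)) else 0)"
      by (simp add: step distrib_left sum.distrib sum_distrib_left mult.left_commute)
    also have "\<dots> = eig x y l * (if b = b' then 1 else 0) + (if 0 < j then (if b = (l, j - 1) then 1 else 0) else 0)"
      using Q[OF b] Q[OF b(1), of "(l, j - 1)"] l by (simp add: mem_half)
    also have "\<dots> = (if fst b = fst b' then jor_ent (eig x y (fst b)) (m (fst b)) (snd b) (snd b') else 0)"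
      by (auto simp: jor_ent_def)
    finally show "transformed Q x R b b' =
      (if fst b = fst b' then jor_ent (eig x y (fst b)) (m (fst b)) (snd b) (snd b') else 0)" unfolding MR .
  qed
qed

end

section \<open>The semidirect product and its generic type\<close>

fun side_index :: "nat \<times> 'a \<times> nat \<times> bool \<times> nat \<Rightarrow> bool \<times> nat \<times> nat" where
  "side_index (k, \<mu>, m, s, i) = (s, k, i)"

lemma side_index_labels_cong:
  "map snd ps = map snd qs \<Longrightarrow> map side_index (labels j ps) = map side_index (labels j qs)"
proof -
  assume *: "map snd ps = map snd qs"
  then have "length ps = length qs" by (metis length_map)
  then show ?thesis using *
  proof (induction ps qs arbitrary: j rule: list_induct2)
    case (Cons p ps q qs)
    then show ?case by (cases p; cases q) (simp add: o_def)
  qed simp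
qed

lemma poly_funs_prod: "finite S \<Longrightarrow> (\<And>s. s \<in> S \<Longrightarrow> F s \<in> poly_funs N) \<Longrightarrow> (\<lambda>z. \<Prod>s\<in>S. F s z) \<in> poly_funs N"
  by (induction S rule: finite_induct) (auto intro: poly_funs.intros)

lemma poly_funs_diff: "F \<in> poly_funs N \<Longrightarrow> G \<in> poly_funs N \<Longrightarrow> (\<lambda>z. F z - G z) \<in> poly_funs N"
  using poly_funs.add[OF _ poly_funs.mult[OF poly_funs.const[of "-1"]], of F N G] by simp

lemma invertible_mat_of_det:
  fixes A :: "complex mat"
  assumes "A \<in> carrier_mat n n" "det A \<noteq> 0"
  shows "invertible_mat A"
proof -
  obtain C where "C \<in> carrier_mat n n" "C * A = 1\<^sub>m n" "A * C = 1\<^sub>m n"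
    using det_non_zero_imp_unit[OF assms] unfolding Units_def ring_mat_def by auto
  then show ?thesis using assms(1) unfolding invertible_mat_def inverts_mat_def by auto
qed

context block_data
begin

definition blocks :: "(nat \<Rightarrow> 'a) \<Rightarrow> ('a \<times> nat) list" where
  "blocks \<mu> = map (\<lambda>k. (\<mu> k, m k)) [0..<K]"

text \<open>Dummy eigenvalues are used because the basis must be fixed before the point is chosen,
  while its order has to agree with the labels for the eigenvalues of every point.\<close>

definition basis :: "(bool \<times> nat \<times> nat) list" where
  "basis = map side_index (labels 0 (blocks (\<lambda>_. ())))"

lemma basis_eq: "basis = map side_index (labels 0 (blocks \<mu>))"
  unfolding basis_def by (rule side_index_labels_cong) (simp add: blocks_def)

lemma mem_labels_blocks: "(k, \<mu>', m', s, i) \<in> set (labels 0 (blocks \<mu>)) \<longleftrightarrow> (k, i) \<in> half \<and> \<mu>' = \<mu> k \<and> m' = m k"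
  by (auto simp: mem_labels blocks_def mem_half)

lemma labels_blocks_nth:
  assumes "q < length basis" "basis ! q = (s, k, i)"
  shows "labels 0 (blocks \<mu>) ! q = (k, \<mu> k, m k, s, i)" "(k, i) \<in> half"
proof -
  have q: "q < length (labels 0 (blocks \<mu>))" using assms(1) by (simp add: basis_eq[of \<mu>])
  obtain k' \<mu>' m' s' i' where l: "labels 0 (blocks \<mu>) ! q = (k', \<mu>', m', s', i')" by (cases "labels 0 (blocks \<mu>) ! q")
  have "(k', \<mu>', m', s', i') \<in> set (labels 0 (blocks \<mu>))" using q l by (metis nth_mem)
  moreover have "s' = s" "k' = k" "i' = i" using assms(2) q l by (simp_all add: basis_eq[of \<mu>])
  ultimately show "labels 0 (blocks \<mu>) ! q = (k, \<mu> k, m k, s, i)" "(k, i) \<in> half" using l by (auto simp: mem_labels_blocks)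
qed

lemma set_basis: "set basis = UNIV \<times> half"
proof
  show "set basis \<subseteq> UNIV \<times> half" by (auto simp: basis_def mem_labels_blocks)
  show "UNIV \<times> half \<subseteq> set basis"
  proof
    fix u assume "u \<in> (UNIV :: bool set) \<times> half"
    then obtain s k i where u: "u = (s, k, i)" "(k, i) \<in> half" by auto
    then have "(k, (), m k, s, i) \<in> set (labels 0 (blocks (\<lambda>_. ())))" by (simp add: mem_labels_blocks)
    from imageI[OF this, of side_index] show "u \<in> set basis" by (simp add: basis_def u)
  qed
qed

lemma distinct_basis: "distinct basis"
  unfolding basis_def distinct_map
  by (intro conjI distinct_labels) (auto simp: inj_on_def mem_labels_blocks)

lemma basis_half: "q < length basis \<Longrightarrow> basis ! q = (s, a) \<Longrightarrow> a \<in> half"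
  using set_basis nth_mem by fastforce

lemma sum_basis: "(\<Sum>q<length basis. F (basis ! q)) = (\<Sum>a\<in>half. F (False, a) + F (True, a))"
proof -
  have "(\<Sum>q<length basis. F (basis ! q)) = sum F (set basis)"
    using sum.distinct_set_conv_list[OF distinct_basis, of F] by (simp add: sum_list_sum_nth atLeast0LessThan)
  also have "\<dots> = (\<Sum>s\<in>UNIV. \<Sum>a\<in>half. F (s, a))" unfolding set_basis by (simp add: sum.cartesian_product)
  also have "\<dots> = (\<Sum>a\<in>half. F (False, a) + F (True, a))" by (simp add: UNIV_bool sum.distrib add.commute)
  finally show ?thesis .
qed

definition act_coeff :: "nat \<times> nat \<Rightarrow> nat \<times> nat \<Rightarrow> nat \<times> nat \<Rightarrow> complex" where
  "act_coeff a b b' = (if act a b = Some b' then 1 else 0)"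

text \<open>\<open>False\<close> marks the acting commutative algebra, \<open>True\<close> the
  abelian ideal on which it acts.\<close>

fun bracket :: "bool \<times> nat \<times> nat \<Rightarrow> bool \<times> nat \<times> nat \<Rightarrow> bool \<times> nat \<times> nat \<Rightarrow> complex" where
  "bracket (s, a) (s', b) (s'', b') =
     (if \<not> s \<and> s' \<and> s'' then act_coeff a b b' else if s \<and> \<not> s' \<and> s'' then - act_coeff b a b' else 0)"

definition struct_const :: "nat \<Rightarrow> nat \<Rightarrow> nat \<Rightarrow> complex" where
  "struct_const q r l = bracket (basis ! q) (basis ! r) (basis ! l)"

lemma act_coeff_commute:
  assumes "a \<in> half" "a' \<in> half" "b \<in> half"
  shows "(\<Sum>l\<in>half. act_coeff a b l * act_coeff a' l b') = (\<Sum>l\<in>half. act_coeff a' b l * act_coeff a l b')"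
proof -
  have *: "(\<Sum>l\<in>half. act_coeff a b l * act_coeff a' l b') = (if Option.bind (act a b) (act a') = Some b' then 1 else 0)"
    if "a \<in> half" for a a'
  proof (cases "act a b")
    case (Some c)
    have "(\<Sum>l\<in>half. act_coeff a b l * act_coeff a' l b') = (\<Sum>l\<in>half. if l = c then act_coeff a' c b' else 0)"
      by (intro sum.cong refl) (auto simp: act_coeff_def Some)
    then show ?thesis using act_half[OF that assms(3) Some] Some by (simp add: act_coeff_def)
  qed (simp add: act_coeff_def)
  show ?thesis unfolding *[OF assms(1)] *[OF assms(2)] act_commute[OF assms] ..
qed

lemma is_lie_alg_struct_const: "is_lie_alg (length basis) struct_const"
  unfolding is_lie_alg_def
proof (intro conjI allI impI)
  fix i j k assume "i < length basis" "j < length basis" "k < length basis"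
  show "struct_const i j k = - struct_const j i k" by (cases "basis ! i"; cases "basis ! j"; cases "basis ! k") (simp add: struct_const_def)
next
  fix i j k r assume *: "i < length basis" "j < length basis" "k < length basis" "r < length basis"
  obtain s1 a1 s2 a2 s3 a3 s4 a4 where e: "basis ! i = (s1, a1)" "basis ! j = (s2, a2)" "basis ! k = (s3, a3)" "basis ! r = (s4, a4)"
    by (metis surj_pair)
  have h: "a1 \<in> half" "a2 \<in> half" "a3 \<in> half" using basis_half * e by metis+
  let ?F = "\<lambda>u. bracket (s1, a1) (s2, a2) u * bracket u (s3, a3) (s4, a4) + bracket (s2, a2) (s3, a3) u * bracket u (s1, a1) (s4, a4) +
     bracket (s3, a3) (s1, a1) u * bracket u (s2, a2) (s4, a4)"
  have "(\<Sum>l<length basis. struct_const i j l * struct_const l k r + struct_const j k l * struct_const l i r + struct_const k i l * struct_const l j r) =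
     (\<Sum>a\<in>half. ?F (False, a) + ?F (True, a))"
    unfolding struct_const_def e by (rule sum_basis[of ?F])
  also have "\<dots> = 0"
    \<comment> \<open>Nonzero terms need two acting elements and one element of the ideal; they
      cancel because the actions commute.\<close>
    using act_coeff_commute[OF h(1,2,3), of a4] act_coeff_commute[OF h(2,3,1), of a4] act_coeff_commute[OF h(3,1,2), of a4]
    by (cases s1; cases s2; cases s3; cases s4) (simp_all add: sum.distrib sum_negf sum_subtractf)
  finally show "(\<Sum>l<length basis. struct_const i j l * struct_const l k r + struct_const j k l * struct_const l i r + struct_const k i l * struct_const l j r) = 0" .
qed

text \<open>Only the \<open>True\<close> half is indexed, since every bracket lies in the ideal and
  the form depends on \<open>x\<close> through these coordinates.\<close>

definition coord :: "nat \<times> nat \<Rightarrow> nat" where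
  "coord b = the_inv_into {..<length basis} ((!) basis) (True, b)"

lemma coord: "b \<in> half \<Longrightarrow> coord b < length basis \<and> basis ! coord b = (True, b)"
proof -
  assume b: "b \<in> half"
  have inj: "inj_on ((!) basis) {..<length basis}" using distinct_basis by (simp add: inj_on_nth)
  have "(True, b) \<in> (!) basis ` {..<length basis}" using b set_basis by (auto simp: set_conv_nth)
  then show ?thesis unfolding coord_def using the_inv_into_into[OF inj] f_the_inv_into_f[OF inj] by blast
qed

lemma coord_basis: "q < length basis \<Longrightarrow> basis ! q = (True, b) \<Longrightarrow> coord b = q"
  using coord[OF basis_half[of q True b]] distinct_basis nth_eq_iff_index_eq by metis

fun full_form :: "(nat \<times> nat \<Rightarrow> complex) \<Rightarrow> bool \<times> nat \<times> nat \<Rightarrow> bool \<times> nat \<times> nat \<Rightarrow> complex" where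
  "full_form x (s, a) (s', b) = (if \<not> s \<and> s' then form x a b else if s \<and> \<not> s' then - form x b a else 0)"

lemma form_eq_sum:
  assumes "a \<in> half" "b \<in> half"
  shows "form x a b = (\<Sum>b'\<in>half. x b' * act_coeff a b b')"
proof (cases "act a b")
  case (Some c)
  have "(\<Sum>b'\<in>half. x b' * act_coeff a b b') = (\<Sum>b'\<in>half. if b' = c then x c else 0)"
    by (intro sum.cong refl) (auto simp: act_coeff_def Some)
  then show ?thesis using act_half[OF assms Some] by (simp add: form_def Some)
qed (simp add: form_def act_coeff_def)

lemma lie_form_struct_const:
  assumes q: "q < length basis" and r: "r < length basis"
  shows "lie_form (length basis) struct_const z $$ (q, r) = full_form (\<lambda>b. z $ coord b) (basis ! q) (basis ! r)"
proof -
  obtain s a s' b where e: "basis ! q = (s, a)" "basis ! r = (s', b)" by (metis surj_pair)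
  have h: "a \<in> half" "b \<in> half" using basis_half e q r by metis+
  have "lie_form (length basis) struct_const z $$ (q, r) = (\<Sum>l<length basis. z $ l * struct_const q r l)" using q r by (simp add: lie_form_def)
  also have "\<dots> = (\<Sum>l<length basis. (\<lambda>u. if fst u then z $ coord (snd u) * bracket (s, a) (s', b) u else 0) (basis ! l))"
  proof (intro sum.cong refl)
    fix l assume "l \<in> {..<length basis}"
    then show "z $ l * struct_const q r l = (\<lambda>u. if fst u then z $ coord (snd u) * bracket (s, a) (s', b) u else 0) (basis ! l)"
      using coord_basis[of l] by (cases "basis ! l") (auto simp: struct_const_def e)
  qed
  also have "\<dots> = (\<Sum>b'\<in>half. z $ coord b' * bracket (s, a) (s', b) (True, b'))"
    by (subst sum_basis) simp
  also have "\<dots> = full_form (\<lambda>b. z $ coord b) (s, a) (s', b)"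
    using h by (cases s; cases s') (simp_all add: form_eq_sum sum_negf)
  finally show ?thesis by (simp add: e)
qed

lemma jk_type_struct_const:
  fixes zx zy :: "complex vec"
  defines "x \<equiv> \<lambda>b. zx $ coord b" and "y \<equiv> \<lambda>b. zy $ coord b"
  assumes gen: "generic x y"
  shows "jk_type (length basis) (lie_form (length basis) struct_const zx) (lie_form (length basis) struct_const zy)
    (jk_data (jor_blocks (blocks (eig x y))))"
proof -
  define n where "n = length basis"
  define ps where "ps = blocks (eig x y)"
  have n: "num_labels ps = n" by (simp add: n_def ps_def basis_eq[of "eig x y"])
  obtain Q R where QR: "\<forall>b\<in>half. \<forall>b'\<in>half.
    transformed Q y R b b' = (if b = b' then 1 else 0) \<and>
    transformed Q x R b b' =
      (if fst b = fst b' then jor_ent (eig x y (fst b)) (m (fst b)) (snd b) (snd b') else 0)"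
    using form_normal_form[OF gen] by (elim exE)
  \<comment> \<open>Base change separately on the two halves, with the transpose of \<open>Q\<close>
    on the acting one, so that \<open>P^T A P\<close> has upper right block \<open>Q\<close> times
    \<open>form\<close> times \<open>R\<close>.\<close>
  define p :: "bool \<times> nat \<times> nat \<Rightarrow> bool \<times> nat \<times> nat \<Rightarrow> complex"
    where "p = (\<lambda>(s, a) (s', b). if s = s' then (if s then R a b else Q b a) else 0)"
  define P where "P = mat n n (\<lambda>(q, r). p (basis ! q) (basis ! r))"
  have P: "P \<in> carrier_mat n n" by (simp add: P_def)
  have cong: "P\<^sup>T * lie_form n struct_const zw * P = ent_mat f ps"
    if w: "w = (\<lambda>b. zw $ coord b)" and
      *: "\<And>b b'. b \<in> half \<Longrightarrow> b' \<in> half \<Longrightarrow> transformed Q w R b b' =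
      (if fst b = fst b' then f (eig x y (fst b)) (m (fst b)) (snd b) (snd b') else 0)" for w zw f
  proof (rule eq_matI)
    define A where "A = lie_form n struct_const zw"
    have A: "A \<in> carrier_mat n n" by (simp add: A_def)
    fix r r' assume "r < dim_row (ent_mat f ps)" "r' < dim_col (ent_mat f ps)"
    then have r: "r < n" "r' < n" by (auto simp: ent_mat_def n)
    obtain s b s' b' where e: "basis ! r = (s, b)" "basis ! r' = (s', b')" by (metis surj_pair)
    have h: "b \<in> half" "b' \<in> half" using basis_half e r unfolding n_def by metis+
    let ?G = "\<lambda>u u'. p u (s, b) * full_form w u u' * p u' (s', b')"
    have "(P\<^sup>T * A * P) $$ (r, r') = (\<Sum>q'<n. (\<Sum>q<n. P $$ (q, r) * A $$ (q, q')) * P $$ (q', r'))"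
      using r P A by (simp add: scalar_prod_def atLeast0LessThan del: assoc_mult_mat)
    also have "\<dots> = (\<Sum>q'<n. \<Sum>q<n. ?G (basis ! q) (basis ! q'))"
      unfolding sum_distrib_right using r
      by (intro sum.cong refl) (simp add: P_def A_def n_def lie_form_struct_const w e)
    also have "\<dots> = (\<Sum>a'\<in>half. (\<Sum>a\<in>half. ?G (False, a) (False, a') + ?G (True, a) (False, a')) +
       (\<Sum>a\<in>half. ?G (False, a) (True, a') + ?G (True, a) (True, a')))"
      unfolding n_def sum_basis[of "\<lambda>u. ?G u _"] by (rule sum_basis[of "\<lambda>u'. \<Sum>a\<in>half. ?G (False, a) u' + ?G (True, a) u'"])
    also have "\<dots> = (if \<not> s \<and> s' then \<Sum>a'\<in>half. \<Sum>a\<in>half. Q b a * form w a a' * R a' b'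
      else if s \<and> \<not> s' then - (\<Sum>a'\<in>half. \<Sum>a\<in>half. Q b' a' * form w a' a * R a b) else 0)"
      by (cases s; cases s') (simp_all add: p_def sum_negf mult_ac)
    also have "\<dots> = (if \<not> s \<and> s' then if fst b = fst b' then f (eig x y (fst b)) (m (fst b)) (snd b) (snd b') else 0
      else if s \<and> \<not> s' then - (if fst b' = fst b then f (eig x y (fst b')) (m (fst b')) (snd b') (snd b) else 0) else 0)"
      using *[OF h] *[OF h(2,1)] sum.swap[of "\<lambda>a' a. Q b a * form w a a' * R a' b'" half half] by simp
    also have "\<dots> = ent_mat f ps $$ (r, r')"
    proof -
      obtain k i k' i' where bb: "b = (k, i)" "b' = (k', i')" by (metis surj_pair)
      have "labels 0 ps ! r = (k, eig x y k, m k, s, i)" "labels 0 ps ! r' = (k', eig x y k', m k', s', i')"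
        unfolding ps_def using labels_blocks_nth(1) r e bb by (auto simp: n_def)
      then show ?thesis using r by (auto simp: ent_mat_def n bb)
    qed
    finally show "(P\<^sup>T * lie_form n struct_const zw * P) $$ (r, r') = ent_mat f ps $$ (r, r')" by (simp only: A_def)
  qed (use P n in \<open>auto simp: ent_mat_def\<close>)
  have Px: "P\<^sup>T * lie_form n struct_const zx * P = ent_mat jor_ent ps"
    by (rule cong[of x]) (use QR in \<open>auto simp: x_def\<close>)
  have Py: "P\<^sup>T * lie_form n struct_const zy * P = ent_mat one_ent ps"
    by (rule cong[of y]) (use QR in \<open>auto simp: y_def one_ent_def prod_eq_iff\<close>)
  \<comment> \<open>Invertibility of \<open>P\<close> comes from the normal form itself:
    \<open>P^T B P\<close> is the standard symplectic matrix, which has an explicit inverse.\<close>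
  have "det P \<noteq> 0"
  proof
    assume "det P = 0"
    then have "det (P\<^sup>T * lie_form n struct_const zy * P) = 0"
      using P by (simp add: det_mult[of _ n] del: assoc_mult_mat)
    then have "det (ent_mat one_ent ps :: complex mat) = 0" unfolding Py .
    moreover have "ent_mat one_ent ps * ent_mat (\<lambda>\<mu> m i j. - one_ent \<mu> m j i) ps = (1 :: complex) \<cdot>\<^sub>m 1\<^sub>m (num_labels ps)"
      by (rule ent_mat_mult) (auto simp: one_ent_def if_distrib[of "\<lambda>x. _ * x"] cong: if_cong)
    then have "det (ent_mat one_ent ps :: complex mat) * det (ent_mat (\<lambda>\<mu> m i j. - one_ent \<mu> m j i) ps :: complex mat) = 1"
      by (subst det_mult[symmetric, of _ "num_labels ps"]) auto
    ultimately show False by simp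
  qed
  then have "invertible_mat P" using P invertible_mat_of_det by blast
  moreover have "\<forall>b\<in>set (jor_blocks ps). block_param b > 0"
    using m_pos by (auto simp: jor_blocks_def ps_def blocks_def)
  ultimately have "jk_decomp n (lie_form n struct_const zx) (lie_form n struct_const zy) (jor_blocks ps)"
    unfolding jk_decomp_def blocks_pair_jor using P Px Py by auto
  then show ?thesis unfolding jk_type_def n_def ps_def by blast
qed

definition heads :: "nat set" where
  "heads = {h. h < K \<and> hd h = h}"

definition tuples :: "nat multiset multiset" where
  "tuples = image_mset (\<lambda>h. image_mset m (mset_set {k. k < K \<and> hd k = h})) (mset_set heads)"

text \<open>All blocks of a tuple share the eigenvalue of their head, so separating the heads keeps
  distinct tuples apart.\<close>

lemma jk_data_blocks:
  assumes inj: "inj_on (eig x y) heads"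
  shows "jk_data (jor_blocks (blocks (eig x y))) = ({#}, tuples)"
proof -
  have eh: "eig x y k = eig x y (hd k)" if "k < K" for k using hd_hd[OF that] by (simp add: eig_def)
  have hh: "hd k \<in> heads" if "k < K" for k using that hd_less hd_hd by (simp add: heads_def)
  have img: "fst ` set (blocks (eig x y)) = eig x y ` heads"
  proof
    show "fst ` set (blocks (eig x y)) \<subseteq> eig x y ` heads" using eh hh by (auto simp: blocks_def)
    show "eig x y ` heads \<subseteq> fst ` set (blocks (eig x y))" by (auto simp: blocks_def heads_def image_image)
  qed
  have tup: "tuple_of (blocks (eig x y)) (eig x y h) = image_mset m (mset_set {k. k < K \<and> hd k = h})" if h: "h \<in> heads" for h
  proof -
    have "eig x y k = eig x y h \<longleftrightarrow> hd k = h" if "k < K" for k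
      using inj_on_eq_iff[OF inj hh[OF that] h] eh[OF that] by simp
    then have "filter (\<lambda>k. eig x y k = eig x y h) [0..<K] = filter (\<lambda>k. hd k = h) [0..<K]" by (intro filter_cong) auto
    then have "tuple_of (blocks (eig x y)) (eig x y h) = image_mset m (mset (filter (\<lambda>k. hd k = h) [0..<K]))"
      by (simp add: tuple_of_def blocks_def filter_map o_def)
    also have "mset (filter (\<lambda>k. hd k = h) [0..<K]) = mset_set {k. k < K \<and> hd k = h}"
      by (subst mset_set_set[symmetric]) (auto intro!: arg_cong[of _ _ mset_set])
    finally show ?thesis .
  qed
  have "finite heads" by (simp add: heads_def)
  have "image_mset (tuple_of (blocks (eig x y))) (mset_set (eig x y ` heads)) =
      image_mset (tuple_of (blocks (eig x y))) (image_mset (eig x y) (mset_set heads))"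
    by (simp add: image_mset_mset_set[OF inj])
  also have "\<dots> = tuples"
    unfolding tuples_def multiset.map_comp o_def using \<open>finite heads\<close> by (intro image_mset_cong) (simp add: tup)
  finally show ?thesis unfolding jk_data_jor img by simp
qed

lemma JK_invariants_struct_const: "JK_invariants (length basis) struct_const ({#}, tuples)"
proof -
  define n where "n = length basis"
  define X where "X = (\<lambda>z b. z $ coord b :: complex)"
  define Y where "Y = (\<lambda>z b. z $ (n + coord b) :: complex)"
  have fin: "finite heads" by (simp add: heads_def)
  have head: "(h, m h - 1) \<in> half" "(h, m h - 2) \<in> half" if "h \<in> heads" for h
    using that m_pos[of h] by (auto simp: heads_def mem_half)
  have pX: "(\<lambda>z. X z b) \<in> poly_funs (2 * n)" and pY: "(\<lambda>z. Y z b) \<in> poly_funs (2 * n)" if "b \<in> half" for b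
    using coord[OF that] by (auto simp: X_def Y_def n_def intro!: poly_funs.coord)
  \<comment> \<open>Nonvanishing of \<open>f1\<close> for all heads is \<open>generic\<close>;
    nonvanishing of \<open>f2\<close> for all pairs of heads says that their eigenvalues differ,
    after cross-multiplication.\<close>
  define f1 where "f1 = (\<lambda>h z. Y z (h, m h - 1) * (if 2 \<le> m h then
     X z (h, m h - 2) * Y z (h, m h - 1) - X z (h, m h - 1) * Y z (h, m h - 2) else 1))"
  define f2 where "f2 = (\<lambda>(h, h') z. X z (h, m h - 1) * Y z (h', m h' - 1) - X z (h', m h' - 1) * Y z (h, m h - 1))"
  define pairs where "pairs = {(h, h'). h \<in> heads \<and> h' \<in> heads \<and> h \<noteq> h'}"
  have finp: "finite pairs" by (rule finite_subset[OF _ finite_cartesian_product[OF fin fin]]) (auto simp: pairs_def)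
  define f where "f = (\<lambda>z. (\<Prod>h\<in>heads. f1 h z) * (\<Prod>hh\<in>pairs. f2 hh z))"
  have "f1 h \<in> poly_funs (2 * n)" if "h \<in> heads" for h
    unfolding f1_def using head[OF that] by (cases "2 \<le> m h") (auto intro!: poly_funs.intros poly_funs_diff pX pY)
  moreover have "f2 hh \<in> poly_funs (2 * n)" if "hh \<in> pairs" for hh
    using that head unfolding f2_def pairs_def by (auto intro!: poly_funs.mult poly_funs_diff pX pY)
  ultimately have f: "f \<in> poly_funs (2 * n)"
    unfolding f_def by (intro poly_funs.mult poly_funs_prod fin finp) auto
  define U where "U = {z \<in> carrier_vec (2 * n). \<exists>g\<in>{f}. g z \<noteq> 0}"
  have "zariski_open (2 * n) U" unfolding zariski_open_def U_def using f by blast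
  moreover have "U \<noteq> {}"
  proof -
    \<comment> \<open>A test point where \<open>f\<close> is nonzero: the head \<open>h\<close> gets
      the eigenvalue \<open>h\<close>, so the eigenvalues are distinct, and for
      \<open>2 \<le> m h\<close> the determinant in \<open>f1\<close> is
      \<open>1 * 1 - h * 0 = 1\<close>.\<close>
    define x0 where "x0 = (\<lambda>b. if snd b = m (fst b) - 1 then of_nat (fst b) else 1 :: complex)"
    define y0 where "y0 = (\<lambda>b. if snd b = m (fst b) - 1 then 1 else 0 :: complex)"
    define z where "z = vec (2 * n) (\<lambda>q. if q < n then x0 (snd (basis ! q)) else y0 (snd (basis ! (q - n))))"
    have z: "X z b = x0 b" "Y z b = y0 b" if "b \<in> half" for b
      using coord[OF that] by (auto simp: X_def Y_def z_def n_def)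
    have "f1 h z \<noteq> 0" if "h \<in> heads" for h
      using head[OF that] by (auto simp: f1_def z x0_def y0_def)
    moreover have "f2 hh z \<noteq> 0" if "hh \<in> pairs" for hh
      using that head by (auto simp: f2_def pairs_def z x0_def y0_def)
    ultimately have "f z \<noteq> 0" using fin finp by (auto simp: f_def)
    moreover have "z \<in> carrier_vec (2 * n)" by (simp add: z_def)
    ultimately show ?thesis unfolding U_def by blast
  qed
  moreover have "jk_type n (lie_form n struct_const (vec n (\<lambda>i. z $ i))) (lie_form n struct_const (vec n (\<lambda>i. z $ (n + i)))) ({#}, tuples)"
    if "z \<in> U" for z
  proof -
    define x where "x = (\<lambda>b. vec n (\<lambda>i. z $ i) $ coord b)"
    define y where "y = (\<lambda>b. vec n (\<lambda>i. z $ (n + i)) $ coord b)"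
    have xy: "x b = X z b" "y b = Y z b" if "b \<in> half" for b
      using coord[OF that] by (auto simp: x_def y_def X_def Y_def n_def)
    have "f z \<noteq> 0" using that by (simp add: U_def)
    then have nz1: "\<And>h. h \<in> heads \<Longrightarrow> f1 h z \<noteq> 0" and nz2: "\<And>hh. hh \<in> pairs \<Longrightarrow> f2 hh z \<noteq> 0"
      using fin finp by (auto simp: f_def)
    have gen: "generic x y"
      unfolding generic_def
    proof (intro allI impI)
      fix h assume "h < K" "hd h = h"
      then have h: "h \<in> heads" by (simp add: heads_def)
      show "y (h, m h - 1) \<noteq> 0 \<and> (2 \<le> m h \<longrightarrow> x (h, m h - 2) * y (h, m h - 1) - x (h, m h - 1) * y (h, m h - 2) \<noteq> 0)"
        using nz1[OF h] unfolding f1_def xy[OF head(1)[OF h]] xy[OF head(2)[OF h]] by (auto split: if_splits)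
    qed
    have "inj_on (eig x y) heads"
    proof (rule inj_onI, rule ccontr)
      fix h h' assume h: "h \<in> heads" "h' \<in> heads" and eq: "eig x y h = eig x y h'" and ne: "h \<noteq> h'"
      have "y (h, m h - 1) \<noteq> 0" "y (h', m h' - 1) \<noteq> 0" using gen h by (auto simp: generic_def heads_def)
      then have "x (h, m h - 1) * y (h', m h' - 1) = x (h', m h' - 1) * y (h, m h - 1)"
        using eq h by (simp add: eig_def heads_def field_simps)
      then have "f2 (h, h') z = 0" unfolding xy[OF head(1)[OF h(1)]] xy[OF head(1)[OF h(2)]] by (simp add: f2_def)
      then show False using nz2[of "(h, h')"] h ne by (simp add: pairs_def)
    qed
    then have "jk_data (jor_blocks (blocks (eig x y))) = ({#}, tuples)" by (rule jk_data_blocks)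
    then show ?thesis using jk_type_struct_const[of "vec n (\<lambda>i. z $ i)" "vec n (\<lambda>i. z $ (n + i))"] gen
      unfolding x_def y_def n_def by simp
  qed
  ultimately show ?thesis unfolding JK_invariants_def n_def by blast
qed

end

text \<open>Each further tuple is appended with its maximum first, so that the index
  \<open>K\<close> becomes its head. Multiplicity one of the maximum leaves only strictly smaller
  sizes in \<open>l\<close>.\<close>

lemma block_data_exists:
  assumes "\<forall>T \<in># Ts. T \<noteq> {#} \<and> (\<forall>m \<in># T. m > 0)" "\<forall>T \<in># Ts. count T (Max_mset T) = 1"
  shows "\<exists>K m hd. block_data K m hd \<and> block_data.tuples K m hd = Ts"
  using assms
proof (induction Ts)
  case empty
  have "block_data 0 (\<lambda>_. 0) id" by unfold_locales auto
  moreover from this have "block_data.tuples 0 (\<lambda>_. 0) id = {#}"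
    by (simp add: block_data.tuples_def block_data.heads_def)
  ultimately show ?case by blast
next
  case (add T Ts)
  obtain K m hd where bd: "block_data K m hd" and tup: "block_data.tuples K m hd = Ts" using add by auto
  interpret B: block_data K m hd by (rule bd)
  have T: "T \<noteq> {#}" "\<And>m. m \<in># T \<Longrightarrow> m > 0" "count T (Max_mset T) = 1" using add.prems by auto
  define M where "M = Max_mset T"
  have M: "M \<in># T" using T(1) unfolding M_def by (intro Max_in) auto
  obtain l where l: "mset l = T - {#M#}" using ex_mset by blast
  have Tl: "mset (M # l) = T" using M l by simp
  have small: "r < M" if "r \<in> set l" for r
  proof -
    have "r \<in># T" using that Tl by (metis set_mset_mset list.set_intros(2))
    then have "r \<le> M" by (simp add: M_def)
    moreover have "M \<notin># T - {#M#}" using T(3) by (simp add: M_def not_in_iff)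
    then have "r \<noteq> M" using that l by (metis set_mset_mset)
    ultimately show ?thesis by simp
  qed
  define K' where "K' = K + length (M # l)"
  define m' where "m' = (\<lambda>k. if k < K then m k else (M # l) ! (k - K))"
  define hd' where "hd' = (\<lambda>k. if k < K then hd k else K)"
  have new: "m' k \<in># T" if "K \<le> k" "k < K'" for k
    using that nth_mem[of "k - K" "M # l"] unfolding Tl[symmetric] m'_def K'_def by auto
  interpret B': block_data K' m' hd'
  proof
    fix k assume k: "k < K'"
    show "hd' k < K'" using B.hd_less[of k] k by (auto simp: hd'_def K'_def)
    show "hd' (hd' k) = hd' k" using B.hd_less[of k] B.hd_hd[of k] by (auto simp: hd'_def)
    show "0 < m' k" using B.m_pos[of k] new[of k] T(2) k by (cases "k < K") (auto simp: m'_def)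
    assume hk: "hd' k \<noteq> k"
    show "m' k < m' (hd' k)"
    proof (cases "k < K")
      case True
      then show ?thesis using B.m_less[of k] B.hd_less[of k] hk by (simp add: m'_def hd'_def)
    next
      case False
      then have "k - K \<noteq> 0" "k - K < length (M # l)" using hk k by (auto simp: hd'_def K'_def)
      then have "(M # l) ! (k - K) \<in> set l" by (cases "k - K") auto
      then show ?thesis using small False by (simp add: m'_def hd'_def)
    qed
  qed
  have heads: "B'.heads = insert K B.heads" "K \<notin> B.heads" "finite B.heads"
    unfolding B'.heads_def B.heads_def by (auto simp: hd'_def K'_def)
  have old: "image_mset m' (mset_set {k. k < K' \<and> hd' k = h}) = image_mset m (mset_set {k. k < K \<and> hd k = h})" if "h \<in> B.heads" for h
  proof -
    have h: "h < K" using that by (simp add: B.heads_def)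
    then have "k < K' \<and> hd' k = h \<longleftrightarrow> k < K \<and> hd k = h" for k
      by (cases "k < K") (simp_all add: hd'_def K'_def)
    then have eq: "{k. k < K' \<and> hd' k = h} = {k. k < K \<and> hd k = h}" by (simp only:)
    show ?thesis unfolding eq by (rule image_mset_cong) (simp add: m'_def)
  qed
  have new_tuple: "image_mset m' (mset_set {k. k < K' \<and> hd' k = K}) = T"
  proof -
    have "k < K' \<and> hd' k = K \<longleftrightarrow> k \<in> {K..<K'}" for k
      using B.hd_less[of k] by (cases "k < K") (simp_all add: hd'_def)
    then have "{k. k < K' \<and> hd' k = K} = {K..<K'}" by (simp only: Collect_mem_eq)
    also have "\<dots> = (+) K ` {0..<length (M # l)}"
      by (simp add: K'_def image_add_atLeastLessThan add.commute)
    finally have "{k. k < K' \<and> hd' k = K} = (+) K ` {0..<length (M # l)}" .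
    then have "image_mset m' (mset_set {k. k < K' \<and> hd' k = K}) = image_mset m' (image_mset ((+) K) (mset_set {0..<length (M # l)}))"
      by (simp add: image_mset_mset_set)
    also have "\<dots> = image_mset (\<lambda>i. (M # l) ! i) (mset_set {0..<length (M # l)})" by (simp add: multiset.map_comp o_def m'_def)
    also have "\<dots> = mset (map (\<lambda>i. (M # l) ! i) [0..<length (M # l)])" by (simp only: mset_map mset_upt)
    also have "\<dots> = T" by (simp only: map_nth Tl)
    finally show ?thesis .
  qed
  have old_tuples: "image_mset (\<lambda>h. image_mset m' (mset_set {k. k < K' \<and> hd' k = h})) (mset_set B.heads) = B.tuples"
    unfolding B.tuples_def by (rule image_mset_cong) (rule old, use heads(3) in simp)
  have "B'.tuples = add_mset T B.tuples"
    unfolding B'.tuples_def heads(1) mset_set.insert[OF heads(3,2)] image_mset_add_mset new_tuple old_tuples ..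
  then show ?case using tup B'.block_data_axioms by metis
qed

theorem theorem6:
  fixes Ts :: "nat multiset multiset"
  assumes "\<forall>T \<in># Ts. T \<noteq> {#} \<and> (\<forall>m \<in># T. m > 0)"
  shows "(\<exists>n c. is_lie_alg n c \<and> JK_invariants n c ({#}, Ts)) \<longleftrightarrow>
         (\<forall>T \<in># Ts. count T (Max_mset T) = 1)"
proof
  assume "\<exists>n c. is_lie_alg n c \<and> JK_invariants n c ({#}, Ts)"
  then obtain n c where "is_lie_alg n c" "JK_invariants n c ({#}, Ts)" by blast
  then show "\<forall>T \<in># Ts. count T (Max_mset T) = 1"
    using JK_invariants_imp_unique_max assms by blast
next
  assume "\<forall>T \<in># Ts. count T (Max_mset T) = 1"
  then obtain K m hd where bd: "block_data K m hd" "block_data.tuples K m hd = Ts"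
    using block_data_exists assms by blast
  have "is_lie_alg (length (block_data.basis K m)) (block_data.struct_const K m hd)"
    by (rule block_data.is_lie_alg_struct_const[OF bd(1)])
  moreover have "JK_invariants (length (block_data.basis K m)) (block_data.struct_const K m hd) ({#}, Ts)"
    using block_data.JK_invariants_struct_const[OF bd(1)] bd(2) by simp
  ultimately show "\<exists>n c. is_lie_alg n c \<and> JK_invariants n c ({#}, Ts)" by blast
qed

end
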